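(* Let $N\ge 1$, $s\in(0,1)$, and let $\mathcal H:\mathbb R^N\times\mathbb R^N\times\mathbb R\to[0,\infty)$, $\mathcal H(x,y,t)=\int_0^{|t|}h(x,y,r)\,r\,dr$, be a locally integrable generalized $N$-function satisfying the standing assumptions (i)--(v) listed in the context. Then $C_c^\infty(\mathbb R^N)$ is a dense subspace of $\mathring W^{s,\mathcal H}(\mathbb R^N)$. Moreover, there exists a linear isomorphism between $\mathring W^{s,\mathcal H}(\mathbb R^N)$ and $D^{s,\mathcal H}(\mathbb R^N)$ under which the norm $\|\cdot\|_{D^{s,\mathcal H}(\mathbb R^N)}$ corresponds to the norm $[\cdot]_{s,\mathcal H}$ on $\mathring W^{s,\mathcal H}(\mathbb R^N)$; that is, $D^{s,\mathcal H}(\mathbb R^N)$ can be identified with $\mathring W^{s,\mathcal H}(\mathbb R^N)$ normed by $[\cdot]_{s,\mathcal H}$.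
   Context: Here $h:\mathbb R^N\times\mathbb R^N\times[0,\infty)\to[0,\infty)$. $\mathcal H$ is a generalized $N$-function if it is continuous, even and convex in $t$; $\mathcal H(x,y,t)=0$ iff $t=0$; and $\lim_{t\to0}\mathcal H(x,y,t)/t=0$, $\lim_{t\to\infty}\mathcal H(x,y,t)/t=\infty$ for all $x,y$. It is locally integrable if $\int_{K\times K}\mathcal H(x,y,t)\,dx\,dy<\infty$ and $\int_K\mathcal H(x,x,t)\,dx<\infty$ for every $t>0$ and compact $K\subset\mathbb R^N$. Write $\mathcal H_x(x,t)=\mathcal H(x,x,t)$. Standing assumptions: (i) for all $x,y\in\mathbb R^N$, $h(x,y,\cdot)\in C^1(0,\infty)$ and $\frac{d}{dt}(t\,h(x,y,t))>0$ for all $t>0$. (ii) There are constants $1<h_1<h_2$ with $h_2<N$ and $h_2<h_1^*$, where $h_i^*=\frac{Nh_i}{N-sh_i}$, such that $h_1\le \frac{h(x,y,|t|)|t|^2}{\mathcal H(x,y,|t|)}\le h_2$ for all $x,y\in\mathbb R^N$, $t\ne0$. (iii) $\inf_{x,y}\mathcal H(x,y,1)=b_1>0$ and $\sup_{x,y}\mathcal H(x,y,1)=b_2<\infty$. (iv) For every $x$, $\int_a^\infty\big(\frac{t}{\mathcal H(x,x,t)}\big)^{\frac{s}{N-s}}dt=\infty$ and $\int_0^b\big(\frac{t}{\mathcal H(x,x,t)}\big)^{\frac{s}{N-s}}dt<\infty$ for some $a,b>0$. (v) $\mathcal H(x-z,y-z,t)=\mathcal H(x,y,t)$ for all $x,y,z\in\mathbb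 R^N$, $t\ge0$. Sobolev conjugate: $\mathcal H^*(x,t)=\mathcal H_x(x,G^{-1}(x,t))$ for $t\ge0$ (extended evenly), where $G(x,t)=\Big(\int_0^t\big(\frac{r}{\mathcal H_x(x,r)}\big)^{\frac{s}{N-s}}dr\Big)^{\frac{N-s}{N}}$ and $G^{-1}(x,\cdot)$ is the inverse of $G(x,\cdot)$. $L^{\mathcal H^*}(\mathbb R^N)$ is the space of measurable $u$ with $\int\mathcal H^*(x,\tau|u|)dx<\infty$ for some $\tau>0$, with Luxemburg norm $\|u\|_{L^{\mathcal H^*}}=\inf\{\tau>0:\int\mathcal H^*(x,|u|/\tau)dx\le1\}$. Define $[u]_{s,\mathcal H}=\inf\Big\{\tau>0:\int_{\mathbb R^N}\int_{\mathbb R^N}\mathcal H\Big(x,y,\frac{|u(x)-u(y)|}{\tau|x-y|^s}\Big)\frac{dx\,dy}{|x-y|^N}\le1\Big\}$. $\mathring W^{s,\mathcal H}(\mathbb R^N)=\{u\in L^{\mathcal H^*}(\mathbb R^N):[u]_{s,\mathcal H}<\infty\}$, a normed space with norm $[u]_{s,\mathcal H}+\|u\|_{L^{\mathcal H^*}(\mathbb R^N)}$, which is equivalent to $[u]_{s,\mathcal H}$ (by the inequality $\|u\|_{L^{\mathcal H^*}}\le c[u]_{s,\mathcal H}$). $D^{s,\mathcal H}(\mathbb R^N)$ is the abstract completion of the normed space $(C_c^\infty(\mathbb R^N),[\cdot]_{s,\mathcal H})$: the set of equivalence classes of $[\cdot]_{s,\mathcal H}$-Cauchy sequences $\{u_n\}\subset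 C_c^\infty(\mathbb R^N)$, where $\{u_n\}\sim\{v_n\}$ iff $[u_n-v_n]_{s,\mathcal H}\to0$, with the norm of the class of $\{u_n\}$ equal to $\lim_n[u_n]_{s,\mathcal H}$.
   Formalization: The isomorphism with D^{s,H} is stated under the explicit hypothesis that ‖u‖_{L^{H*}} ≤ c[u]_{s,H} holds on W^{s,H}; this inequality does not follow from (i)–(v), and the isomorphism would fail without it. Density is unconditional. *)

theory Defs
  imports "HOL-Analysis.Analysis"
begin

text \<open>
  \<open>\<real>\<^sup>N\<close> is an arbitrary type \<open>'a\<close> of class \<open>euclidean_space\<close>, with \<open>N = DIM('a)\<close>.
  Functions are Lebesgue measurable; extended (\<open>ennreal\<close>) values are used for modulars and
  Luxemburg functionals, so that an infimum over the empty set is \<open>\<infinity>\<close>.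
\<close>

section \<open>Test functions\<close>

fun C_k :: "nat \<Rightarrow> ('a::euclidean_space \<Rightarrow> real) \<Rightarrow> bool" where
  "C_k 0 u \<longleftrightarrow> continuous_on UNIV u"
| "C_k (Suc k) u \<longleftrightarrow>
     (\<forall>x. u differentiable (at x)) \<and> (\<forall>v. C_k k (\<lambda>x. frechet_derivative u (at x) v))"

definition Cc_inf :: "('a::euclidean_space \<Rightarrow> real) set" where
  "Cc_inf = {u. (\<forall>k. C_k k u) \<and> compact (closure (support_on UNIV u))}"

section \<open>Generalized N-functions\<close>

text \<open>
  Continuity is required in \<open>t\<close> only; measurability in \<open>(x, y)\<close> is part of local
  integrability below.
\<close>

definition generalized_N_function :: "('a \<Rightarrow> 'a \<Rightarrow> real \<Rightarrow> real) \<Rightarrow> bool" where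
  "generalized_N_function H \<longleftrightarrow> (\<forall>x y.
     (\<forall>t. 0 \<le> H x y t) \<and>
     continuous_on UNIV (H x y) \<and>
     (\<forall>t. H x y (- t) = H x y t) \<and>
     convex_on UNIV (H x y) \<and>
     (\<forall>t. H x y t = 0 \<longleftrightarrow> t = 0) \<and>
     ((\<lambda>t. H x y t / t) \<longlongrightarrow> 0) (at 0) \<and>
     filterlim (\<lambda>t. H x y t / t) at_top at_top)"

definition locally_integrable_N :: "('a::euclidean_space \<Rightarrow> 'a \<Rightarrow> real \<Rightarrow> real) \<Rightarrow> bool" where
  "locally_integrable_N H \<longleftrightarrow> (\<forall>t>0. \<forall>K. compact K \<longrightarrow>
     set_integrable lebesgue (K \<times> K) (\<lambda>(x, y). H x y t) \<and>
     set_integrable lebesgue K (\<lambda>x. H x x t))"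

section \<open>The Sobolev conjugate and its Orlicz space\<close>

definition G_fun :: "('a::euclidean_space \<Rightarrow> 'a \<Rightarrow> real \<Rightarrow> real) \<Rightarrow> real \<Rightarrow> 'a \<Rightarrow> real \<Rightarrow> real" where
  "G_fun H s x t =
     (integral {0..t} (\<lambda>r. (r / H x x r) powr (s / (real DIM('a) - s))))
       powr ((real DIM('a) - s) / real DIM('a))"

definition H_star :: "('a::euclidean_space \<Rightarrow> 'a \<Rightarrow> real \<Rightarrow> real) \<Rightarrow> real \<Rightarrow> 'a \<Rightarrow> real \<Rightarrow> real" where
  "H_star H s x t = H x x (inv_into {0..} (G_fun H s x) \<bar>t\<bar>)"

definition L_star ::
    "('a::euclidean_space \<Rightarrow> 'a \<Rightarrow> real \<Rightarrow> real) \<Rightarrow> real \<Rightarrow> ('a \<Rightarrow> real) set" where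
  "L_star H s = {u \<in> borel_measurable lebesgue.
     \<exists>\<tau>>0. (\<integral>\<^sup>+x. ennreal (H_star H s x (\<tau> * \<bar>u x\<bar>)) \<partial>lebesgue) < \<infinity>}"

definition L_star_norm ::
    "('a::euclidean_space \<Rightarrow> 'a \<Rightarrow> real \<Rightarrow> real) \<Rightarrow> real \<Rightarrow> ('a \<Rightarrow> real) \<Rightarrow> ennreal" where
  "L_star_norm H s u = Inf {ennreal \<tau> | \<tau>. \<tau> > 0 \<and>
     (\<integral>\<^sup>+x. ennreal (H_star H s x (\<bar>u x\<bar> / \<tau>)) \<partial>lebesgue) \<le> 1}"

section \<open>The Gagliardo functional and the space W\<close>

definition gagliardo ::
    "('a::euclidean_space \<Rightarrow> 'a \<Rightarrow> real \<Rightarrow> real) \<Rightarrow> real \<Rightarrow> ('a \<Rightarrow> real) \<Rightarrow> ennreal" where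
  "gagliardo H s u = Inf {ennreal \<tau> | \<tau>. \<tau> > 0 \<and>
     (\<integral>\<^sup>+(x, y). ennreal (H x y (\<bar>u x - u y\<bar> / (\<tau> * norm (x - y) powr s))
          / norm (x - y) ^ DIM('a)) \<partial>(lebesgue :: ('a \<times> 'a) measure)) \<le> 1}"

definition W_fun ::
    "('a::euclidean_space \<Rightarrow> 'a \<Rightarrow> real \<Rightarrow> real) \<Rightarrow> real \<Rightarrow> ('a \<Rightarrow> real) set" where
  "W_fun H s = {u \<in> L_star H s. gagliardo H s u < \<infinity>}"

text \<open>The elements of W are classes of functions modulo equality almost everywhere.\<close>

definition W_rel ::
    "('a::euclidean_space \<Rightarrow> 'a \<Rightarrow> real \<Rightarrow> real) \<Rightarrow> real \<Rightarrow> (('a \<Rightarrow> real) \<times> ('a \<Rightarrow> real)) set" where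
  "W_rel H s = {(u, v). u \<in> W_fun H s \<and> v \<in> W_fun H s \<and> (AE x in lebesgue. u x = v x)}"

definition W_space ::
    "('a::euclidean_space \<Rightarrow> 'a \<Rightarrow> real \<Rightarrow> real) \<Rightarrow> real \<Rightarrow> ('a \<Rightarrow> real) set set" where
  "W_space H s = W_fun H s // W_rel H s"

definition W_add ::
    "('a::euclidean_space \<Rightarrow> 'a \<Rightarrow> real \<Rightarrow> real) \<Rightarrow> real \<Rightarrow>
     ('a \<Rightarrow> real) set \<Rightarrow> ('a \<Rightarrow> real) set \<Rightarrow> ('a \<Rightarrow> real) set" where
  "W_add H s A B = (\<Union>u\<in>A. \<Union>v\<in>B. W_rel H s `` {\<lambda>x. u x + v x})"

definition W_scale ::
    "('a::euclidean_space \<Rightarrow> 'a \<Rightarrow> real \<Rightarrow> real) \<Rightarrow> real \<Rightarrow>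
     real \<Rightarrow> ('a \<Rightarrow> real) set \<Rightarrow> ('a \<Rightarrow> real) set" where
  "W_scale H s c A = (\<Union>u\<in>A. W_rel H s `` {\<lambda>x. c * u x})"

definition W_gagliardo ::
    "('a::euclidean_space \<Rightarrow> 'a \<Rightarrow> real \<Rightarrow> real) \<Rightarrow> real \<Rightarrow> ('a \<Rightarrow> real) set \<Rightarrow> ennreal" where
  "W_gagliardo H s A = the_elem (gagliardo H s ` A)"

definition W_norm ::
    "('a::euclidean_space \<Rightarrow> 'a \<Rightarrow> real \<Rightarrow> real) \<Rightarrow> real \<Rightarrow> ('a \<Rightarrow> real) set \<Rightarrow> ennreal" where
  "W_norm H s A = the_elem ((\<lambda>u. gagliardo H s u + L_star_norm H s u) ` A)"

definition Cc_classes ::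
    "('a::euclidean_space \<Rightarrow> 'a \<Rightarrow> real \<Rightarrow> real) \<Rightarrow> real \<Rightarrow> ('a \<Rightarrow> real) set set" where
  "Cc_classes H s = (\<lambda>\<phi>. W_rel H s `` {\<phi>}) ` Cc_inf"

definition W_subspace ::
    "('a::euclidean_space \<Rightarrow> 'a \<Rightarrow> real \<Rightarrow> real) \<Rightarrow> real \<Rightarrow> ('a \<Rightarrow> real) set set \<Rightarrow> bool" where
  "W_subspace H s V \<longleftrightarrow> V \<subseteq> W_space H s \<and> W_rel H s `` {\<lambda>x. 0} \<in> V \<and>
     (\<forall>A\<in>V. \<forall>B\<in>V. W_add H s A B \<in> V) \<and> (\<forall>c. \<forall>A\<in>V. W_scale H s c A \<in> V)"

definition W_dense ::
    "('a::euclidean_space \<Rightarrow> 'a \<Rightarrow> real \<Rightarrow> real) \<Rightarrow> real \<Rightarrow> ('a \<Rightarrow> real) set set \<Rightarrow> bool" where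
  "W_dense H s V \<longleftrightarrow> (\<forall>A\<in>W_space H s. \<forall>\<epsilon>>0. \<exists>B\<in>V.
     W_norm H s (W_add H s A (W_scale H s (- 1) B)) < ennreal \<epsilon>)"

text \<open>
  The inequality behind the equivalence of the norm of W with \<open>gagliardo\<close>. It is not a
  consequence of the structural hypotheses on \<open>H\<close>, since \<open>H_star\<close> sees only the diagonal
  values of \<open>H\<close>: let \<open>N = 3\<close>, \<open>s = 1/2\<close> and \<open>H x y t = \<bar>t\<bar> powr p (norm (x - y))\<close> with \<open>p\<close>
  smooth, equal to \<open>2\<close> near \<open>0\<close>, equal to \<open>2.1\<close> on \<open>[1, \<infinity>)\<close> and with values in \<open>[2, 2.1]\<close>.
  For a fixed nonzero test function \<open>u\<close>, the dilates \<open>\<lambda>x. u (x / \<lambda>)\<close> have \<open>gagliardo\<close> of order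
  at most \<open>\<lambda> powr (3 / 2.1 - 1/2)\<close> as \<open>\<lambda> \<rightarrow> \<infinity>\<close>, while their norm in \<open>L_star\<close> is a multiple of \<open>\<lambda>\<close>.
\<close>

definition sobolev_inequality :: "('a::euclidean_space \<Rightarrow> 'a \<Rightarrow> real \<Rightarrow> real) \<Rightarrow> real \<Rightarrow> bool" where
  "sobolev_inequality H s \<longleftrightarrow>
     (\<exists>c::real. \<forall>u\<in>W_fun H s. L_star_norm H s u \<le> ennreal c * gagliardo H s u)"

section \<open>The abstract completion D\<close>

definition D_cauchy ::
    "('a::euclidean_space \<Rightarrow> 'a \<Rightarrow> real \<Rightarrow> real) \<Rightarrow> real \<Rightarrow> (nat \<Rightarrow> 'a \<Rightarrow> real) set" where
  "D_cauchy H s = {X. (\<forall>n. X n \<in> Cc_inf) \<and>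
     (\<forall>\<epsilon>>0. \<exists>M. \<forall>m\<ge>M. \<forall>n\<ge>M. gagliardo H s (\<lambda>x. X m x - X n x) < ennreal \<epsilon>)}"

definition D_rel ::
    "('a::euclidean_space \<Rightarrow> 'a \<Rightarrow> real \<Rightarrow> real) \<Rightarrow> real \<Rightarrow>
     ((nat \<Rightarrow> 'a \<Rightarrow> real) \<times> (nat \<Rightarrow> 'a \<Rightarrow> real)) set" where
  "D_rel H s = {(X, Y). X \<in> D_cauchy H s \<and> Y \<in> D_cauchy H s \<and>
     (\<lambda>n. gagliardo H s (\<lambda>x. X n x - Y n x)) \<longlonglongrightarrow> 0}"

definition D_space ::
    "('a::euclidean_space \<Rightarrow> 'a \<Rightarrow> real \<Rightarrow> real) \<Rightarrow> real \<Rightarrow> (nat \<Rightarrow> 'a \<Rightarrow> real) set set" where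
  "D_space H s = D_cauchy H s // D_rel H s"

definition D_add ::
    "('a::euclidean_space \<Rightarrow> 'a \<Rightarrow> real \<Rightarrow> real) \<Rightarrow> real \<Rightarrow> (nat \<Rightarrow> 'a \<Rightarrow> real) set \<Rightarrow>
     (nat \<Rightarrow> 'a \<Rightarrow> real) set \<Rightarrow> (nat \<Rightarrow> 'a \<Rightarrow> real) set" where
  "D_add H s A B = (\<Union>X\<in>A. \<Union>Y\<in>B. D_rel H s `` {\<lambda>n x. X n x + Y n x})"

definition D_scale ::
    "('a::euclidean_space \<Rightarrow> 'a \<Rightarrow> real \<Rightarrow> real) \<Rightarrow> real \<Rightarrow> real \<Rightarrow>
     (nat \<Rightarrow> 'a \<Rightarrow> real) set \<Rightarrow> (nat \<Rightarrow> 'a \<Rightarrow> real) set" where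
  "D_scale H s c A = (\<Union>X\<in>A. D_rel H s `` {\<lambda>n x. c * X n x})"

definition D_norm ::
    "('a::euclidean_space \<Rightarrow> 'a \<Rightarrow> real \<Rightarrow> real) \<Rightarrow> real \<Rightarrow> (nat \<Rightarrow> 'a \<Rightarrow> real) set \<Rightarrow> ennreal" where
  "D_norm H s A = the_elem ((\<lambda>X. lim (\<lambda>n. gagliardo H s (X n))) ` A)"

end

theory Submission
  imports Defs "HOL-Probability.Probability_Measure"
begin

text \<open>
  The proof works with modulars instead of norms. By the bounds on \<open>h x y t * t\<^sup>2 / H x y t\<close> the
  function \<open>H\<close> gains at most the factor \<open>c powr h2\<close> under a dilation by \<open>c \<ge> 1\<close>, so it is doubling;
  the same holds for the Sobolev conjugate \<open>H_star\<close>, because \<open>s * h2 < N\<close>. Hence a measurable function lies in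
  the space iff its \<open>energy\<close>, the sum of the Gagliardo modular and the modular of \<open>H_star\<close>, is finite,
  and convergence in norm means that the energies of all multiples of the error tend to \<open>0\<close>. By
  translation invariance \<open>H_star\<close> does not depend on the point.

  Density of the test functions is obtained in three steps. First the small and the large values of
  \<open>u\<close> are cut off (\<open>approximable_truncation\<close>). This map and its complement are contractions of the
  real line, so dominated convergence applies. The result is bounded, and its support has finite
  measure because \<open>u\<close> lies in the Orlicz space of \<open>H_star\<close>. Next it is multiplied by Lipschitz
  cutoffs (\<open>approximable_cutoff\<close>). Boundedness and finite measure of the support give an integrable
  majorant for the error, whatever the relation between the growth of \<open>H\<close> near the diagonal and
  far from it. Finally the function is mollified (\<open>approximable_mollification\<close>). Jensen's
  inequality and translation invariance show that mollification does not increase the Gagliardo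
  modular (\<open>gag_rho_convolve_le\<close>), a subsequence of the mollifications converges almost
  everywhere, and for a convex modular almost everywhere convergence without gain of modular is
  modular convergence (\<open>rho_half_diff_small\<close>, an argument with Fatou's lemma).

  For the identification with the completion, the class of \<open>u\<close> is sent to the set of all sequences
  of test functions that converge to \<open>u\<close> in the Gagliardo functional. By density this set is
  nonempty, so it is a class of Cauchy sequences, and linearity and preservation of the norm follow
  from the triangle inequality. The Sobolev inequality gives injectivity, as it makes the functional
  definite (\<open>gagliardo_zero_imp_AE\<close>), and surjectivity: a Cauchy sequence is Cauchy in measure, and
  by lower semicontinuity the almost everywhere limit of a subsequence is its limit
  (\<open>D_cauchy_converges\<close>).
\<close>

section \<open>Calculus of smooth functions\<close>

lemma C_k_Suc_iff:
  "C_k (Suc k) u \<longleftrightarrow>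
    (\<exists>D. (\<forall>x. (u has_derivative D x) (at x)) \<and> (\<forall>v. C_k k (\<lambda>x. D x v)))"
proof
  assume "C_k (Suc k) u"
  then show "\<exists>D. (\<forall>x. (u has_derivative D x) (at x)) \<and> (\<forall>v. C_k k (\<lambda>x. D x v))"
    by (intro exI[of _ "\<lambda>x. frechet_derivative u (at x)"]) (auto simp: frechet_derivative_works)
next
  assume "\<exists>D. (\<forall>x. (u has_derivative D x) (at x)) \<and> (\<forall>v. C_k k (\<lambda>x. D x v))"
  then obtain D where D: "\<And>x. (u has_derivative D x) (at x)" "\<And>v. C_k k (\<lambda>x. D x v)"
    by blast
  have "frechet_derivative u (at x) = D x" for x
    using frechet_derivative_at[OF D(1)] by metis
  then show "C_k (Suc k) u"
    using D by (auto simp: differentiable_def)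
qed

lemma C_k_SucI:
  assumes "\<And>x. (u has_derivative D x) (at x)" and "\<And>v. C_k k (\<lambda>x. D x v)"
  shows "C_k (Suc k) u"
  unfolding C_k_Suc_iff using assms by blast

lemma C_k_Suc_imp: "C_k (Suc k) u \<Longrightarrow> C_k k u"
proof (induction k arbitrary: u)
  case 0
  then have "\<And>x. u differentiable (at x)"
    by simp
  then show ?case
    by (auto simp: continuous_on_eq_continuous_at intro!: differentiable_imp_continuous_within)
next
  case (Suc k)
  then show ?case
    by (metis C_k_Suc_iff)
qed

lemma C_k_const: "C_k k (\<lambda>x. c)"
proof (induction k arbitrary: c)
  case (Suc k)
  show ?case
    by (rule C_k_SucI[OF has_derivative_const Suc])
qed simp

lemma C_k_bounded_linear:
  assumes "bounded_linear f"
  shows "C_k k f"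
proof (cases k)
  case 0
  then show ?thesis
    using assms by (simp add: linear_continuous_on)
next
  case (Suc m)
  then show ?thesis
    unfolding Suc
    by (intro C_k_SucI[of f "\<lambda>x. f"] C_k_const bounded_linear_imp_has_derivative assms)
qed

lemma C_k_add: "C_k k u \<Longrightarrow> C_k k v \<Longrightarrow> C_k k (\<lambda>x. u x + v x)"
proof (induction k arbitrary: u v)
  case 0
  then show ?case
    by (simp add: continuous_on_add)
next
  case (Suc k)
  from Suc.prems(1) obtain D where D: "\<And>x. (u has_derivative D x) (at x)" "\<And>w. C_k k (\<lambda>x. D x w)"
    unfolding C_k_Suc_iff by blast
  from Suc.prems(2) obtain E where E: "\<And>x. (v has_derivative E x) (at x)" "\<And>w. C_k k (\<lambda>x. E x w)"
    unfolding C_k_Suc_iff by blast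
  show ?case
    by (rule C_k_SucI[OF has_derivative_add[OF D(1) E(1)]]) (intro Suc.IH D E)
qed

lemma C_k_mult: "C_k k u \<Longrightarrow> C_k k v \<Longrightarrow> C_k k (\<lambda>x. u x * v x)"
proof (induction k arbitrary: u v)
  case 0
  then show ?case
    by (simp add: continuous_on_mult)
next
  case (Suc k)
  from Suc.prems(1) obtain D where D: "\<And>x. (u has_derivative D x) (at x)" "\<And>w. C_k k (\<lambda>x. D x w)"
    unfolding C_k_Suc_iff by blast
  from Suc.prems(2) obtain E where E: "\<And>x. (v has_derivative E x) (at x)" "\<And>w. C_k k (\<lambda>x. E x w)"
    unfolding C_k_Suc_iff by blast
  show ?case
    by (rule C_k_SucI[OF has_derivative_mult[OF D(1) E(1)]])
       (intro C_k_add Suc.IH D E C_k_Suc_imp[OF Suc.prems(1)] C_k_Suc_imp[OF Suc.prems(2)])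
qed

text \<open>
  A family of real functions that is closed under taking derivatives consists of smooth functions;
  working with the whole family avoids any formula for higher derivatives.
\<close>

lemma C_k_compose:
  assumes deriv: "\<And>g. g \<in> F \<Longrightarrow> \<exists>g'\<in>F. \<forall>t. (g has_real_derivative g' t) (at t)"
    and "g \<in> F" "C_k k u"
  shows "C_k k (\<lambda>x. g (u x))"
  using assms(2,3)
proof (induction k arbitrary: g)
  case 0
  obtain g' where "\<And>t. (g has_real_derivative g' t) (at t)"
    using deriv[OF 0(1)] by blast
  then have "continuous_on UNIV g"
    by (meson DERIV_isCont continuous_at_imp_continuous_on)
  then have "continuous_on (range u) g"
    using continuous_on_subset by blast
  with 0 show ?case
    by (auto intro: continuous_on_compose2)
next
  case (Suc k)
  obtain g' where g': "g' \<in> F" "\<And>t. (g has_real_derivative g' t) (at t)"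
    using deriv[OF Suc.prems(1)] by blast
  from Suc.prems(2) obtain D where D: "\<And>x. (u has_derivative D x) (at x)" "\<And>w. C_k k (\<lambda>x. D x w)"
    unfolding C_k_Suc_iff by blast
  show ?case
    by (rule C_k_SucI[OF DERIV_compose_FDERIV[OF g'(2) D(1)]])
       (rule C_k_mult[OF D(2) Suc.IH[OF g'(1) C_k_Suc_imp[OF Suc.prems(2)]]])
qed

lemma C_k_inner_self: "C_k k (\<lambda>x::'a::euclidean_space. x \<bullet> x)"
proof (cases k)
  case 0
  then show ?thesis
    by (simp add: continuous_intros)
next
  case (Suc m)
  have "((\<lambda>x. x \<bullet> x) has_derivative (\<lambda>v. 2 * (v \<bullet> x))) (at x)" for x :: 'a
    by (auto intro!: derivative_eq_intros simp: inner_commute)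
  moreover have "C_k m (\<lambda>x::'a. 2 * (v \<bullet> x))" for v
    by (intro C_k_bounded_linear bounded_linear_mult_right bounded_linear_compose[OF bounded_linear_mult_right]
        bounded_linear_inner_right)
  ultimately show ?thesis
    unfolding Suc by (rule C_k_SucI)
qed

text \<open>
  For constant \<open>p\<close> this is the classical function \<open>exp (-1/t)\<close>, extended by \<open>0\<close>, that is smooth but
  not analytic at \<open>0\<close>; letting \<open>p\<close> vary makes the family closed under derivatives.
\<close>

definition exp_flat :: "real poly \<Rightarrow> real \<Rightarrow> real" where
  "exp_flat p t = (if t > 0 then poly p (1 / t) * exp (- (1 / t)) else 0)"

lemma poly_mult_exp_minus_tendsto_0: "((\<lambda>y::real. poly p y * exp (- y)) \<longlongrightarrow> 0) at_top"
proof -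
  have "((\<lambda>y::real. \<Sum>i\<le>degree p. coeff p i * (y ^ i / exp y)) \<longlongrightarrow> (\<Sum>i\<le>degree p. coeff p i * 0)) at_top"
    by (intro tendsto_sum tendsto_mult tendsto_const tendsto_power_div_exp_0)
  moreover have "(\<lambda>y::real. \<Sum>i\<le>degree p. coeff p i * (y ^ i / exp y)) = (\<lambda>y. poly p y * exp (- y))"
    by (simp add: poly_altdef sum_distrib_right exp_minus divide_inverse mult.assoc)
  ultimately show ?thesis
    by simp
qed

lemma exp_flat_deriv_0: "(exp_flat p has_real_derivative 0) (at 0)"
proof -
  have "((\<lambda>y::real. poly (pCons 0 p) y * exp (- y)) \<longlongrightarrow> 0) at_top"
    by (rule poly_mult_exp_minus_tendsto_0)
  then have "((\<lambda>t. poly (pCons 0 p) (inverse t) * exp (- inverse t)) \<longlongrightarrow> 0) (at_right 0)"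
    by (rule filterlim_compose) (rule filterlim_inverse_at_top_right)
  then have "((\<lambda>t. (exp_flat p t - exp_flat p 0) / (t - 0)) \<longlongrightarrow> 0) (at_right 0)"
    by (rule Lim_transform_eventually)
       (auto simp: exp_flat_def eventually_at_filter field_simps)
  moreover have "((\<lambda>t. (exp_flat p t - exp_flat p 0) / (t - 0)) \<longlongrightarrow> 0) (at_left 0)"
    by (rule Lim_transform_eventually[OF tendsto_const])
       (auto simp: exp_flat_def eventually_at_filter)
  ultimately show ?thesis
    unfolding has_field_derivative_iff by (rule filterlim_split_at[rotated])
qed

lemma exp_flat_deriv:
  "(exp_flat p has_real_derivative exp_flat (pCons 0 (pCons 0 (p - pderiv p))) t) (at t)"
proof -
  consider "t < 0" | "t = 0" | "t > 0"
    by linarith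
  then show ?thesis
  proof cases
    case 1
    have "((\<lambda>t. 0) has_real_derivative 0) (at t)"
      by simp
    then have "(exp_flat p has_real_derivative 0) (at t)"
      by (rule has_field_derivative_transform_within_open[of _ _ _ "{..<0}"]) (auto simp: exp_flat_def 1)
    then show ?thesis
      using 1 by (simp add: exp_flat_def)
  next
    case 2
    then show ?thesis
      using exp_flat_deriv_0 by (simp add: exp_flat_def)
  next
    case 3
    have inv: "((\<lambda>t. 1 / t) has_real_derivative - (1 / t\<^sup>2)) (at t)"
      using 3 by (auto intro!: derivative_eq_intros simp: power2_eq_square)
    note DERIV_mult[OF DERIV_chain2[OF poly_DERIV[of p] inv] DERIV_chain2[OF DERIV_exp DERIV_minus[OF inv]]]
    then have "(exp_flat p has_real_derivative
        poly (pderiv p) (1 / t) * - (1 / t\<^sup>2) * exp (- (1 / t))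
        + exp (- (1 / t)) * - (- (1 / t\<^sup>2)) * poly p (1 / t)) (at t)"
      by (rule has_field_derivative_transform_within_open[of _ _ _ "{0<..}"]) (auto simp: exp_flat_def 3)
    moreover have "poly (pderiv p) (1 / t) * - (1 / t\<^sup>2) * exp (- (1 / t))
        + exp (- (1 / t)) * - (- (1 / t\<^sup>2)) * poly p (1 / t)
      = exp_flat (pCons 0 (pCons 0 (p - pderiv p))) t"
      using 3 by (simp add: exp_flat_def power2_eq_square algebra_simps)
    ultimately show ?thesis
      by simp
  qed
qed

lemma C_k_exp_flat: "C_k k u \<Longrightarrow> C_k k (\<lambda>x. exp_flat p (u x))"
  by (rule C_k_compose[where F = "range exp_flat"]) (use exp_flat_deriv in blast)+

lemma Cc_infI:
  assumes "\<And>k. C_k k u" and "\<And>x. r \<le> norm x \<Longrightarrow> u x = 0"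
  shows "u \<in> Cc_inf"
proof -
  have "support_on UNIV u \<subseteq> cball 0 r"
    using assms(2) by (force simp: support_on_def)
  then have "bounded (support_on UNIV u)"
    using bounded_cball bounded_subset by blast
  then show ?thesis
    using assms(1) by (simp add: Cc_inf_def compact_closure)
qed

lemma Cc_inf_iff:
  "u \<in> Cc_inf \<longleftrightarrow> (\<forall>k. C_k k u) \<and> (\<exists>r>0. \<forall>x. r \<le> norm x \<longrightarrow> u x = 0)"
proof
  assume u: "u \<in> Cc_inf"
  then have "bounded (support_on UNIV u)"
    by (simp add: Cc_inf_def compact_closure)
  then obtain B where B: "\<And>x. u x \<noteq> 0 \<Longrightarrow> norm x \<le> B"
    by (auto simp: bounded_iff support_on_def)
  have "u x = 0" if "max 0 B + 1 \<le> norm x" for x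
    using B[of x] that by linarith
  then show "(\<forall>k. C_k k u) \<and> (\<exists>r>0. \<forall>x. r \<le> norm x \<longrightarrow> u x = 0)"
    using u by (intro conjI exI[of _ "max 0 B + 1"]) (auto simp: Cc_inf_def)
qed (auto intro: Cc_infI)

lemma Cc_inf_continuous: "u \<in> Cc_inf \<Longrightarrow> continuous_on UNIV u"
  unfolding Cc_inf_def using C_k.simps(1) by blast

lemma Cc_inf_zero: "(\<lambda>x. 0) \<in> Cc_inf"
  by (rule Cc_infI[of _ 0]) (auto intro: C_k_const)

lemma Cc_inf_add:
  assumes "u \<in> Cc_inf" "v \<in> Cc_inf"
  shows "(\<lambda>x. u x + v x) \<in> Cc_inf"
proof -
  obtain r where r: "\<And>k. C_k k u" "\<And>x. r \<le> norm x \<Longrightarrow> u x = 0"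
    using assms(1) unfolding Cc_inf_iff by blast
  obtain r' where r': "\<And>k. C_k k v" "\<And>x. r' \<le> norm x \<Longrightarrow> v x = 0"
    using assms(2) unfolding Cc_inf_iff by blast
  show ?thesis
    by (rule Cc_infI[of _ "max r r'"]) (use r r' in \<open>auto intro!: C_k_add\<close>)
qed

lemma Cc_inf_scale:
  assumes "u \<in> Cc_inf"
  shows "(\<lambda>x. c * u x) \<in> Cc_inf"
proof -
  obtain r where r: "\<And>k. C_k k u" "\<And>x. r \<le> norm x \<Longrightarrow> u x = 0"
    using assms(1) unfolding Cc_inf_iff by blast
  show ?thesis
    by (rule Cc_infI[of _ r]) (use r in \<open>auto intro!: C_k_mult C_k_const\<close>)
qed

lemma Cc_inf_derivative:
  assumes "u \<in> Cc_inf"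
  obtains D where "\<And>x. (u has_derivative D x) (at x)" "\<And>v. (\<lambda>x. D x v) \<in> Cc_inf"
proof -
  obtain r where r: "\<And>k. C_k k u" "\<And>x. r \<le> norm x \<Longrightarrow> u x = 0"
    using assms(1) unfolding Cc_inf_iff by blast
  define D where "D x = frechet_derivative u (at x)" for x
  have D: "(u has_derivative D x) (at x)" for x
    using r(1)[of "Suc 0"] unfolding D_def by (simp add: frechet_derivative_works)
  have Ck: "C_k k (\<lambda>x. D x v)" for k v
    using r(1)[of "Suc k"] unfolding D_def by simp
  have zero: "D x v = 0" if "r + 1 \<le> norm x" for x v
  proof -
    have "((\<lambda>x. 0) has_derivative D x) (at x)"
    proof (rule has_derivative_transform_within_open[OF D])
      show "open {x::'a. r < norm x}" "x \<in> {x. r < norm x}"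
        using that by (auto intro!: open_Collect_less continuous_intros)
    qed (use r(2) in auto)
    then have "D x = (\<lambda>v. 0)"
      using has_derivative_const has_derivative_unique by blast
    then show ?thesis
      by simp
  qed
  show thesis
    by (rule that[OF D]) (rule Cc_infI[OF Ck zero])
qed

lemma Cc_inf_bounded:
  assumes "u \<in> Cc_inf"
  obtains B where "B > 0" "\<And>x. \<bar>u x\<bar> \<le> B"
proof -
  obtain r where r: "\<And>x. r \<le> norm x \<Longrightarrow> u x = 0"
    using assms(1) unfolding Cc_inf_iff by blast
  have "compact (u ` cball 0 r)"
    by (rule compact_continuous_image) (auto intro: continuous_on_subset[OF Cc_inf_continuous[OF assms]])
  then have "bounded (u ` cball 0 r)"
    by (rule compact_imp_bounded)
  then obtain B where B: "\<And>x. x \<in> cball 0 r \<Longrightarrow> norm (u x) \<le> B"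
    unfolding bounded_iff by blast
  have "\<bar>u x\<bar> \<le> max B 0 + 1" for x
    using B[of x] r[of x] by (cases "norm x \<le> r") auto
  then show thesis
    by (intro that[of "max B 0 + 1"]) auto
qed

lemma uniformly_continuous_bounded_support:
  fixes u :: "'a::euclidean_space \<Rightarrow> real"
  assumes u: "continuous_on UNIV u" and r: "\<And>x. r \<le> norm x \<Longrightarrow> u x = 0" and "e > 0"
  obtains d where "d > 0" "\<And>x y. norm (x - y) < d \<Longrightarrow> \<bar>u x - u y\<bar> < e"
proof -
  have "uniformly_continuous_on (cball 0 (r + 1)) u"
    by (rule compact_uniformly_continuous)
       (auto intro: continuous_on_subset[OF u])
  then obtain d where d: "d > 0"
    "\<And>x y. x \<in> cball 0 (r + 1) \<Longrightarrow> y \<in> cball 0 (r + 1) \<Longrightarrow> dist y x < d \<Longrightarrow> dist (u y) (u x) < e"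
    using assms(3) unfolding uniformly_continuous_on_def by metis
  have "\<bar>u x - u y\<bar> < e" if xy: "norm (x - y) < min d 1" for x y
  proof (cases "norm x \<le> r + 1 \<and> norm y \<le> r + 1")
    case True
    then show ?thesis
      using d(2)[of y x] xy by (simp add: dist_norm dist_real_def)
  next
    case False
    have "norm x \<le> norm y + norm (x - y)" "norm y \<le> norm x + norm (x - y)"
      using norm_triangle_sub[of x y] norm_triangle_sub[of y x] by (auto simp: norm_minus_commute)
    then have "r \<le> norm x" "r \<le> norm y"
      using False xy by linarith+
    then show ?thesis
      using r assms(3) by simp
  qed
  then show thesis
    using d(1) by (intro that[of "min d 1"]) auto
qed

lemma Cc_inf_uniformly_continuous:
  assumes "u \<in> Cc_inf" "e > 0"
  obtains d where "d > 0" "\<And>x y. norm (x - y) < d \<Longrightarrow> \<bar>u x - u y\<bar> < e"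
proof -
  obtain r where "\<And>x. r \<le> norm x \<Longrightarrow> u x = 0"
    using assms(1) unfolding Cc_inf_iff by blast
  then show thesis
    using uniformly_continuous_bounded_support[OF Cc_inf_continuous[OF assms(1)] _ assms(2)] that by blast
qed

lemma linear_functional_bound:
  fixes L :: "'a::euclidean_space \<Rightarrow> real"
  assumes "bounded_linear L" and "\<And>b. b \<in> Basis \<Longrightarrow> \<bar>L b\<bar> \<le> e"
  shows "\<bar>L v\<bar> \<le> real DIM('a) * e * norm v"
proof -
  interpret bounded_linear L by fact
  have "L v = L (\<Sum>b\<in>Basis. (v \<bullet> b) *\<^sub>R b)"
    by (simp add: euclidean_representation)
  also have "\<dots> = (\<Sum>b\<in>Basis. (v \<bullet> b) * L b)"
    by (simp add: sum scale)
  finally have "\<bar>L v\<bar> \<le> (\<Sum>b\<in>Basis. \<bar>(v \<bullet> b) * L b\<bar>)"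
    by (simp add: sum_abs)
  also have "\<dots> \<le> (\<Sum>b\<in>(Basis::'a set). norm v * e)"
  proof (rule sum_mono)
    fix b :: 'a assume b: "b \<in> Basis"
    have "\<bar>v \<bullet> b\<bar> * \<bar>L b\<bar> \<le> norm v * e"
      using b assms(2)[OF b] Basis_le_norm[OF b, of v] by (intro mult_mono) auto
    then show "\<bar>(v \<bullet> b) * L b\<bar> \<le> norm v * e"
      by (simp add: abs_mult)
  qed
  finally show ?thesis
    by (simp add: mult_ac)
qed

lemma Cc_inf_Lipschitz:
  fixes u :: "'a::euclidean_space \<Rightarrow> real"
  assumes "u \<in> Cc_inf"
  obtains L where "L > 0" "\<And>x y. \<bar>u x - u y\<bar> \<le> L * norm (x - y)"
proof -
  obtain D where D: "\<And>x. (u has_derivative D x) (at x)" "\<And>v. (\<lambda>x. D x v) \<in> Cc_inf"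
    using Cc_inf_derivative[OF assms] by metis
  have "\<exists>B. \<forall>x. \<bar>D x v\<bar> \<le> B" for v
    using Cc_inf_bounded[OF D(2)[of v]] by metis
  then obtain B where B: "\<And>v x. \<bar>D x v\<bar> \<le> B v"
    by metis
  define M where "M = Max (insert 0 (B ` Basis))"
  have "\<bar>D x b\<bar> \<le> M" if "b \<in> Basis" for x b
    using B[of x b] that unfolding M_def by (intro order_trans[OF _ Max_ge[of _ "B b"]]) auto
  then have bd: "\<bar>D x v\<bar> \<le> real DIM('a) * M * norm v" for x v
    using linear_functional_bound has_derivative_bounded_linear D(1) by metis
  have M0: "M \<ge> 0"
    unfolding M_def by (intro Max_ge) auto
  have "norm (u x - u y) \<le> (real DIM('a) * M) * norm (x - y)" for x y
    by (rule differentiable_bound[of UNIV u D]) (auto intro!: onorm_le bd D(1))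
  then have "\<bar>u x - u y\<bar> \<le> (real DIM('a) * M + 1) * norm (x - y)" for x y
    by (smt (verit) mult_right_mono norm_ge_zero real_norm_def)
  then show thesis
    using M0 by (intro that[of "real DIM('a) * M + 1"]) (auto intro: add_nonneg_pos)
qed

text \<open>
  The remainder is controlled by the oscillation of the derivative, which is uniformly small because
  the derivative in each of the finitely many basis directions is again a test function.
\<close>

lemma Cc_inf_uniform_Taylor:
  fixes u :: "'a::euclidean_space \<Rightarrow> real"
  assumes D: "\<And>x. (u has_derivative D x) (at x)" "\<And>v. (\<lambda>x. D x v) \<in> Cc_inf" and "e > 0"
  obtains d where "d > 0" "\<And>x w. norm w < d \<Longrightarrow> \<bar>u (x + w) - u x - D x w\<bar> \<le> e * norm w"
proof -
  define e' where "e' = e / real DIM('a)"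
  have e': "e' > 0"
    using assms(3) by (simp add: e'_def)
  have "\<exists>d>0. \<forall>x y. norm (x - y) < d \<longrightarrow> \<bar>D x v - D y v\<bar> < e'" for v
    using Cc_inf_uniformly_continuous[OF D(2) e', of v] by metis
  then obtain d where d: "\<And>v. d v > 0" "\<And>v x y. norm (x - y) < d v \<Longrightarrow> \<bar>D x v - D y v\<bar> < e'"
    by metis
  define m where "m = Min (insert 1 (d ` Basis))"
  have m: "m > 0"
    using d(1) by (auto simp: m_def)
  have "\<bar>u (x + w) - u x - D x w\<bar> \<le> e * norm w" if w: "norm w < m" for x w
  proof -
    have bd: "\<bar>D y v - D x v\<bar> \<le> e * norm v" if "norm (y - x) < m" for y v
    proof -
      have "bounded_linear (\<lambda>v. D y v - D x v)"
        using D(1) by (intro bounded_linear_sub) (auto dest: has_derivative_bounded_linear)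
      moreover have "\<bar>D y b - D x b\<bar> \<le> e'" if "b \<in> Basis" for b
      proof -
        have "m \<le> d b"
          unfolding m_def using that by (intro Min_le) auto
        then show ?thesis
          using d(2)[of y x b] \<open>norm (y - x) < m\<close> by simp
      qed
      ultimately have "\<bar>D y v - D x v\<bar> \<le> real DIM('a) * e' * norm v"
        by (rule linear_functional_bound)
      then show ?thesis
        by (simp add: e'_def)
    qed
    have "norm (u (x + w) - u x - D x (x + w - x)) \<le> norm (x + w - x) * e"
    proof (rule differentiable_bound_linearization[of x "x + w" "ball x m" u D x e])
      show "x + t *\<^sub>R (x + w - x) \<in> ball x m" if "t \<in> {0..1}" for t :: real
        using that w by (auto simp: dist_norm intro: le_less_trans[OF mult_left_le_one_le])
      show "(u has_derivative D y) (at y within ball x m)" for y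
        using D(1) has_derivative_at_withinI by blast
      show "onorm (D y - D x) \<le> e" if "y \<in> ball x m" for y
        using that bd[of y] by (intro onorm_le) (auto simp: dist_norm norm_minus_commute)
    qed (use m in auto)
    then show ?thesis
      by (simp add: mult.commute)
  qed
  with m show thesis
    by (rule that)
qed

lemma compact_support_integrable:
  fixes u :: "'a::euclidean_space \<Rightarrow> real" and B r :: real
  assumes "u \<in> borel_measurable borel" "\<And>x. \<bar>u x\<bar> \<le> B" "\<And>x. r \<le> norm x \<Longrightarrow> u x = 0"
  shows "integrable lborel u"
proof (rule Bochner_Integration.integrable_bound)
  show "integrable lborel (\<lambda>x. B * indicator (cball 0 r) x :: real)"
    using emeasure_lborel_cball_finite by (intro integrable_mult_right integrable_real_indicator) (auto simp: less_top)
  have "0 \<le> B"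
    using assms(2)[of 0] by linarith
  then show "AE x in lborel. norm (u x) \<le> norm (B * indicator (cball 0 r) x :: real)"
    using assms(2,3) by (intro AE_I2) (auto simp: indicator_def split: if_splits)
qed (use assms in auto)

lemma Cc_inf_borel: "u \<in> Cc_inf \<Longrightarrow> u \<in> borel_measurable borel"
  by (rule borel_measurable_continuous_onI[OF Cc_inf_continuous])

lemma Cc_inf_integrable:
  assumes "u \<in> Cc_inf"
  shows "integrable lborel u"
proof -
  obtain B where B: "\<And>x. \<bar>u x\<bar> \<le> B"
    using Cc_inf_bounded[OF assms] by metis
  obtain r where r: "\<And>x. r \<le> norm x \<Longrightarrow> u x = 0"
    using assms(1) unfolding Cc_inf_iff by blast
  show ?thesis
    using Cc_inf_borel[OF assms] B r by (rule compact_support_integrable)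
qed

lemma mollifier_exists:
  assumes "\<delta> > 0"
  obtains \<phi> :: "'a::euclidean_space \<Rightarrow> real" where "\<phi> \<in> Cc_inf" "\<And>x. 0 \<le> \<phi> x"
    "\<And>x. \<delta> \<le> norm x \<Longrightarrow> \<phi> x = 0" "(\<integral>x. \<phi> x \<partial>lborel) = 1"
proof -
  define b where "b x = exp_flat 1 (\<delta>\<^sup>2 + (-1) * (x \<bullet> x))" for x :: 'a
  have "C_k k b" for k
    unfolding b_def by (intro C_k_exp_flat C_k_add C_k_mult C_k_const C_k_inner_self)
  moreover have supp: "b x = 0" if "\<delta> \<le> norm x" for x
  proof -
    have "\<delta>\<^sup>2 \<le> (norm x)\<^sup>2"
      using that assms by (intro power_mono) auto
    then show ?thesis
      by (simp add: b_def exp_flat_def power2_norm_eq_inner)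
  qed
  ultimately have b: "b \<in> Cc_inf"
    by (rule Cc_infI)
  have nonneg: "0 \<le> b x" for x
    by (simp add: b_def exp_flat_def)
  have "(\<integral>x. b x \<partial>lborel) \<noteq> 0"
  proof
    assume "(\<integral>x. b x \<partial>lborel) = 0"
    then have "AE x in lborel. b x = 0"
      using integral_nonneg_eq_0_iff_AE[OF Cc_inf_integrable[OF b]] nonneg by simp
    then have "AE x in lebesgue. x \<in> {x. b x = 0}"
      by (simp add: AE_completion)
    moreover have "closed {x. b x = 0}"
      by (intro closed_Collect_eq Cc_inf_continuous b continuous_on_const)
    ultimately have "(0::'a) \<in> {x. b x = 0}"
      by (intro mem_closed_if_AE_lebesgue)
    then show False
      using assms by (simp add: b_def exp_flat_def)
  qed
  moreover have "(\<integral>x. b x \<partial>lborel) \<ge> 0"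
    using nonneg by (intro integral_nonneg_AE) auto
  ultimately have pos: "(\<integral>x. b x \<partial>lborel) > 0"
    by linarith
  show thesis
  proof (rule that[of "\<lambda>x. (1 / (\<integral>x. b x \<partial>lborel)) * b x"])
    show "(\<lambda>x. (1 / (\<integral>x. b x \<partial>lborel)) * b x) \<in> Cc_inf"
      by (rule Cc_inf_scale[OF b])
  qed (use pos nonneg supp in \<open>auto simp: less_imp_le\<close>)
qed

section \<open>Musielak--Orlicz modulars\<close>

lemma ennreal_leI_epsilon:
  fixes a b :: ennreal
  assumes "\<And>e. e > 0 \<Longrightarrow> b < \<infinity> \<Longrightarrow> a \<le> b + ennreal e"
  shows "a \<le> b"
proof (rule ennreal_le_epsilon)
  fix e :: real
  assume "b < top" "0 < e"
  then show "a \<le> b + ennreal e"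
    using assms[of e] by simp
qed

text \<open>
  Two modulars occur below: the Gagliardo modular, on pairs of points, and the modular of the Sobolev
  conjugate. The first is convex in its last argument; for the second, monotonicity, continuity and
  doubling carry all arguments, so convexity is split off into the locale \<open>convex_musielak\<close>.
\<close>

locale musielak =
  fixes M :: "'p measure" and \<Phi> :: "'p \<Rightarrow> real \<Rightarrow> real" and C :: real
  assumes measurable_Phi: "F \<in> borel_measurable M \<Longrightarrow> (\<lambda>p. \<Phi> p (F p)) \<in> borel_measurable M"
    and Phi_even: "\<Phi> p (- t) = \<Phi> p t"
    and Phi_zero: "\<Phi> p 0 = 0"
    and Phi_mono: "0 \<le> a \<Longrightarrow> a \<le> b \<Longrightarrow> \<Phi> p a \<le> \<Phi> p b"
    and Phi_cont: "isCont (\<Phi> p) t"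
    and C_nonneg: "0 \<le> C"
    and Phi_doubling: "\<Phi> p (2 * t) \<le> C * \<Phi> p t"
begin

definition rho :: "('p \<Rightarrow> real) \<Rightarrow> ennreal" where
  "rho F = (\<integral>\<^sup>+p. ennreal (\<Phi> p (F p)) \<partial>M)"

definition lux :: "('p \<Rightarrow> real) \<Rightarrow> ennreal" where
  "lux F = Inf {ennreal \<tau> | \<tau>. \<tau> > 0 \<and> rho (\<lambda>p. F p / \<tau>) \<le> 1}"

lemma Phi_abs: "\<Phi> p \<bar>t\<bar> = \<Phi> p t"
  by (simp add: abs_if Phi_even)

lemma Phi_mono_abs: "\<bar>a\<bar> \<le> \<bar>b\<bar> \<Longrightarrow> \<Phi> p a \<le> \<Phi> p b"
  using Phi_mono[of "\<bar>a\<bar>" "\<bar>b\<bar>" p] by (simp add: Phi_abs)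

lemma Phi_nonneg: "0 \<le> \<Phi> p t"
  using Phi_mono_abs[of 0 t p] by (simp add: Phi_zero)

lemma Phi_add: "\<Phi> p (a + b) \<le> \<Phi> p (2 * a) + \<Phi> p (2 * b)"
proof (cases "\<bar>a\<bar> \<le> \<bar>b\<bar>")
  case True
  then have "\<Phi> p (a + b) \<le> \<Phi> p (2 * b)"
    by (intro Phi_mono_abs) linarith
  then show ?thesis
    using Phi_nonneg[of p "2 * a"] by linarith
next
  case False
  then have "\<Phi> p (a + b) \<le> \<Phi> p (2 * a)"
    by (intro Phi_mono_abs) linarith
  then show ?thesis
    using Phi_nonneg[of p "2 * b"] by linarith
qed

lemma Phi_scale_bound:
  obtains K where "0 \<le> K" "\<And>p t. \<Phi> p (c * t) \<le> K * \<Phi> p t"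
proof -
  obtain k where k: "\<bar>c\<bar> < 2 ^ k"
    using real_arch_pow[of 2 "\<bar>c\<bar>"] by auto
  have pow: "\<Phi> p (2 ^ k * t) \<le> C ^ k * \<Phi> p t" for p t
  proof (induction k)
    case (Suc k)
    have "\<Phi> p (2 * (2 ^ k * t)) \<le> C * \<Phi> p (2 ^ k * t)"
      by (rule Phi_doubling)
    also have "\<dots> \<le> C * (C ^ k * \<Phi> p t)"
      using Suc C_nonneg by (rule mult_left_mono)
    finally show ?case
      by (simp add: mult_ac)
  qed simp
  have "\<Phi> p (c * t) \<le> C ^ k * \<Phi> p t" for p t
  proof -
    have "\<bar>c * t\<bar> \<le> \<bar>2 ^ k * t\<bar>"
      using k by (auto simp: abs_mult intro!: mult_right_mono)
    from Phi_mono_abs[OF this] pow show ?thesis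
      by (rule order_trans)
  qed
  then show thesis
    using C_nonneg by (intro that[of "C ^ k"]) auto
qed

lemma measurable_rho:
  "F \<in> borel_measurable M \<Longrightarrow> (\<lambda>p. ennreal (\<Phi> p (F p))) \<in> borel_measurable M"
  using measurable_Phi by simp

lemma rho_mono_AE: "(AE p in M. \<bar>F p\<bar> \<le> \<bar>G p\<bar>) \<Longrightarrow> rho F \<le> rho G"
  unfolding rho_def by (rule nn_integral_mono_AE) (auto intro!: ennreal_leI Phi_mono_abs)

lemma rho_mono: "(\<And>p. \<bar>F p\<bar> \<le> \<bar>G p\<bar>) \<Longrightarrow> rho F \<le> rho G"
  by (rule rho_mono_AE) simp

lemma rho_cong_AE: "(AE p in M. F p = G p) \<Longrightarrow> rho F = rho G"
  unfolding rho_def by (rule nn_integral_cong_AE) auto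

lemma rho_even: "rho (\<lambda>p. - F p) = rho F"
  by (simp add: rho_def Phi_even)

lemma rho_add:
  assumes "F \<in> borel_measurable M" "G \<in> borel_measurable M"
  shows "rho (\<lambda>p. F p + G p) \<le> rho (\<lambda>p. 2 * F p) + rho (\<lambda>p. 2 * G p)"
proof -
  have "rho (\<lambda>p. F p + G p) \<le> (\<integral>\<^sup>+p. ennreal (\<Phi> p (2 * F p)) + ennreal (\<Phi> p (2 * G p)) \<partial>M)"
    unfolding rho_def by (intro nn_integral_mono) (simp add: Phi_add Phi_nonneg flip: ennreal_plus)
  also have "\<dots> = rho (\<lambda>p. 2 * F p) + rho (\<lambda>p. 2 * G p)"
    unfolding rho_def using assms by (intro nn_integral_add measurable_rho) auto
  finally show ?thesis .
qed

lemma rho_linear_combination: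
  assumes "F \<in> borel_measurable M" "G \<in> borel_measurable M"
  shows "(\<integral>\<^sup>+p. ennreal a * ennreal (\<Phi> p (F p)) + ennreal b * ennreal (\<Phi> p (G p)) \<partial>M)
    = ennreal a * rho F + ennreal b * rho G"
proof -
  note [measurable] = measurable_rho[OF assms(1)] measurable_rho[OF assms(2)]
  show ?thesis
    unfolding rho_def by (subst nn_integral_add) (simp_all add: nn_integral_cmult)
qed

lemma rho_scale_bound:
  obtains K :: real where "0 \<le> K"
    "\<And>F. F \<in> borel_measurable M \<Longrightarrow> rho (\<lambda>p. c * F p) \<le> ennreal K * rho F"
proof -
  obtain K where K: "0 \<le> K" "\<And>p t. \<Phi> p (c * t) \<le> K * \<Phi> p t"
    using Phi_scale_bound[of c] by blast
  have "rho (\<lambda>p. c * F p) \<le> ennreal K * rho F" if "F \<in> borel_measurable M" for F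
  proof -
    have "rho (\<lambda>p. c * F p) \<le> (\<integral>\<^sup>+p. ennreal K * ennreal (\<Phi> p (F p)) \<partial>M)"
      unfolding rho_def
      by (intro nn_integral_mono) (simp add: K Phi_nonneg ennreal_leI flip: ennreal_mult)
    also have "\<dots> = ennreal K * rho F"
      unfolding rho_def using that by (intro nn_integral_cmult measurable_rho)
    finally show ?thesis .
  qed
  then show thesis
    using K(1) that by blast
qed

lemma rho_finite_scale:
  assumes "F \<in> borel_measurable M" "rho F < \<infinity>"
  shows "rho (\<lambda>p. c * F p) < \<infinity>"
proof -
  obtain K :: real where "rho (\<lambda>p. c * F p) \<le> ennreal K * rho F"
    using rho_scale_bound[of c] assms(1) by metis
  also have "\<dots> < \<infinity>"
    using assms(2) by (simp add: ennreal_mult_less_top)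
  finally show ?thesis .
qed

lemma rho_finite_add:
  assumes "F \<in> borel_measurable M" "rho F < \<infinity>" "G \<in> borel_measurable M" "rho G < \<infinity>"
  shows "rho (\<lambda>p. F p + G p) < \<infinity>"
  using rho_add[OF assms(1,3)] rho_finite_scale[OF assms(1,2), of 2] rho_finite_scale[OF assms(3,4), of 2]
  by (metis ennreal_add_less_top infinity_ennreal_def le_less_trans)

lemma rho_dominated_convergence:
  assumes F [measurable]: "\<And>n. F n \<in> borel_measurable M" and D [measurable]: "D \<in> borel_measurable M"
    and lim: "AE p in M. (\<lambda>n. F n p) \<longlonglongrightarrow> 0"
    and dom: "\<And>n. AE p in M. \<bar>F n p\<bar> \<le> \<bar>D p\<bar>" and fin: "rho D < \<infinity>"
  shows "(\<lambda>n. rho (\<lambda>p. c * F n p)) \<longlonglongrightarrow> 0"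
proof -
  have "(\<lambda>n. \<integral>\<^sup>+p. ennreal (\<Phi> p (c * F n p)) \<partial>M) \<longlonglongrightarrow> (\<integral>\<^sup>+p. 0 \<partial>M)"
  proof (rule nn_integral_dominated_convergence)
    show "AE p in M. ennreal (\<Phi> p (c * F n p)) \<le> ennreal (\<Phi> p (c * D p))" for n
      using dom[of n]
      by eventually_elim (auto intro!: ennreal_leI Phi_mono_abs mult_left_mono simp: abs_mult)
    show "(\<integral>\<^sup>+p. ennreal (\<Phi> p (c * D p)) \<partial>M) < \<infinity>"
      using rho_finite_scale[OF D fin, of c] by (simp add: rho_def)
    show "AE p in M. (\<lambda>n. ennreal (\<Phi> p (c * F n p))) \<longlonglongrightarrow> 0"
      using lim
    proof eventually_elim
      case (elim p)
      then have "(\<lambda>n. \<Phi> p (c * F n p)) \<longlonglongrightarrow> \<Phi> p (c * 0)"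
        by (intro isCont_tendsto_compose[OF Phi_cont] tendsto_mult tendsto_const)
      then show ?case
        using tendsto_ennrealI by (fastforce simp: Phi_zero)
    qed
  qed (auto intro!: measurable_rho)
  then show ?thesis
    by (simp add: rho_def)
qed

lemma lux_le: "\<tau> > 0 \<Longrightarrow> rho (\<lambda>p. F p / \<tau>) \<le> 1 \<Longrightarrow> lux F \<le> ennreal \<tau>"
  unfolding lux_def by (rule Inf_lower) blast

lemma lux_less_imp_rho:
  assumes "lux F < ennreal \<tau>"
  shows "\<tau> > 0" "rho (\<lambda>p. F p / \<tau>) \<le> 1"
proof -
  show "\<tau> > 0"
    using assms by (metis ennreal_neg linorder_not_less not_less_zero)
  obtain \<sigma> where \<sigma>: "\<sigma> > 0" "rho (\<lambda>p. F p / \<sigma>) \<le> 1" "ennreal \<sigma> < ennreal \<tau>"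
    using assms unfolding lux_def Inf_less_iff by blast
  then have "\<sigma> < \<tau>"
    using ennreal_less_iff[of \<sigma> \<tau>] by simp
  then have "rho (\<lambda>p. F p / \<tau>) \<le> rho (\<lambda>p. F p / \<sigma>)"
    using \<sigma>(1) \<open>\<tau> > 0\<close> by (intro rho_mono) (auto simp: abs_divide intro!: divide_left_mono)
  then show "rho (\<lambda>p. F p / \<tau>) \<le> 1"
    using \<sigma>(2) by (rule order_trans)
qed

lemma lux_cong_AE:
  assumes "AE p in M. F p = G p"
  shows "lux F = lux G"
proof -
  have "rho (\<lambda>p. F p / \<tau>) = rho (\<lambda>p. G p / \<tau>)" for \<tau>
    using assms by (intro rho_cong_AE) (auto elim: eventually_mono)
  then show ?thesis
    by (simp add: lux_def)
qed

lemma lux_zero: "lux (\<lambda>p. 0) = 0"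
proof -
  have "rho (\<lambda>p. 0 / \<tau>) \<le> 1" for \<tau>
    by (simp add: rho_def Phi_zero)
  then have "lux (\<lambda>p. 0) \<le> ennreal e" if "e > 0" for e
    using that by (intro lux_le)
  then have "lux (\<lambda>p. 0) \<le> 0 + ennreal e" if "e > 0" for e
    using that by simp
  then have "lux (\<lambda>p. 0) \<le> 0"
    using ennreal_leI_epsilon by blast
  then show ?thesis
    by simp
qed

text \<open>
  Doubling turns smallness of the modular at one scale into finiteness at all scales; conversely the
  modulars of \<open>F / n\<close> tend to \<open>0\<close> by dominated convergence.
\<close>

lemma lux_finite_iff:
  assumes F: "F \<in> borel_measurable M"
  shows "lux F < \<infinity> \<longleftrightarrow> rho F < \<infinity>"
proof
  assume "lux F < \<infinity>"
  then obtain \<tau> where "lux F < ennreal \<tau>"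
    by (metis ennreal_Ex_less_of_nat ennreal_of_nat_eq_real_of_nat infinity_ennreal_def)
  then have \<tau>: "\<tau> > 0" "rho (\<lambda>p. F p / \<tau>) \<le> 1"
    by (rule lux_less_imp_rho)+
  have "rho (\<lambda>p. \<tau> * (F p / \<tau>)) < \<infinity>"
    using F by (intro rho_finite_scale le_less_trans[OF \<tau>(2)]) auto
  then show "rho F < \<infinity>"
    using \<tau>(1) by simp
next
  assume fin: "rho F < \<infinity>"
  have "(\<lambda>n. rho (\<lambda>p. 1 * (F p / real (Suc n)))) \<longlonglongrightarrow> 0"
  proof (rule rho_dominated_convergence[OF _ F _ _ fin])
    show "AE p in M. (\<lambda>n. F p / real (Suc n)) \<longlonglongrightarrow> 0"
      using LIMSEQ_Suc[OF lim_const_over_n] by auto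
    show "AE p in M. \<bar>F p / real (Suc n)\<bar> \<le> \<bar>F p\<bar>" for n
      by (auto simp: field_simps intro!: AE_I2 mult_right_le_one_le)
  qed (use F in auto)
  then have "\<forall>\<^sub>F n in sequentially. rho (\<lambda>p. F p / real (Suc n)) < 1"
    by (intro order_tendstoD(2)) auto
  then obtain n where "rho (\<lambda>p. F p / real (Suc n)) < 1"
    by (auto simp: eventually_sequentially)
  then have "lux F \<le> ennreal (real (Suc n))"
    by (intro lux_le) auto
  then show "lux F < \<infinity>"
    using le_less_trans by fastforce
qed

lemma lux_scale: "lux (\<lambda>p. c * F p) = ennreal \<bar>c\<bar> * lux F"
proof -
  have le: "ennreal (1 / \<bar>c\<bar>) * lux (\<lambda>p. c * F p) \<le> lux F" if "c \<noteq> 0" for c F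
    unfolding lux_def[of F]
  proof (rule Inf_greatest, clarify)
    fix \<tau> :: real
    assume \<tau>: "\<tau> > 0" "rho (\<lambda>p. F p / \<tau>) \<le> 1"
    have "rho (\<lambda>p. c * F p / (\<bar>c\<bar> * \<tau>)) = rho (\<lambda>p. F p / \<tau>)"
    proof (cases "c > 0")
      case False
      then have "(\<lambda>p. c * F p / (\<bar>c\<bar> * \<tau>)) = (\<lambda>p. - (F p / \<tau>))"
        using that by (auto simp: field_simps)
      then show ?thesis
        by (simp only: rho_even)
    qed simp
    then have "lux (\<lambda>p. c * F p) \<le> ennreal (\<bar>c\<bar> * \<tau>)"
      using \<tau> that by (intro lux_le) auto
    then have "ennreal (1 / \<bar>c\<bar>) * lux (\<lambda>p. c * F p) \<le> ennreal (1 / \<bar>c\<bar>) * ennreal (\<bar>c\<bar> * \<tau>)"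
      by (rule mult_left_mono) simp
    also have "\<dots> = ennreal \<tau>"
      using that \<tau> by (simp flip: ennreal_mult)
    finally show "ennreal (1 / \<bar>c\<bar>) * lux (\<lambda>p. c * F p) \<le> ennreal \<tau>" .
  qed
  show ?thesis
  proof (cases "c = 0")
    case True
    then show ?thesis
      by (simp add: lux_zero)
  next
    case False
    have "lux (\<lambda>p. c * F p) = ennreal \<bar>c\<bar> * (ennreal (1 / \<bar>c\<bar>) * lux (\<lambda>p. c * F p))"
      using False by (simp add: mult.assoc[symmetric] flip: ennreal_mult)
    also have "\<dots> \<le> ennreal \<bar>c\<bar> * lux F"
      using le[OF False] by (rule mult_left_mono) simp
    finally have "lux (\<lambda>p. c * F p) \<le> ennreal \<bar>c\<bar> * lux F" .
    moreover have "ennreal \<bar>c\<bar> * lux F \<le> lux (\<lambda>p. c * F p)"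
      using le[of "1 / c" "\<lambda>p. c * F p"] False by simp
    ultimately show ?thesis
      by (rule antisym)
  qed
qed

text \<open>Lower semicontinuity of the Luxemburg functional, by Fatou's lemma.\<close>

lemma lux_Fatou:
  assumes F: "\<And>n. F n \<in> borel_measurable M"
    and lim: "AE p in M. (\<lambda>n. F n p) \<longlonglongrightarrow> G p"
    and le: "\<forall>\<^sub>F n in sequentially. lux (F n) \<le> b"
  shows "lux G \<le> b"
proof (rule ennreal_leI_epsilon)
  fix e :: real
  assume e: "e > 0" and "b < \<infinity>"
  then obtain t where t: "t \<ge> 0" "b = ennreal t"
    by (cases b) auto
  then have b: "b + ennreal e = ennreal (t + e)" "b < ennreal (t + e)"
    using e by (auto simp: ennreal_less_iff)
  have "rho (\<lambda>p. G p / (t + e)) \<le> (\<integral>\<^sup>+p. liminf (\<lambda>n. ennreal (\<Phi> p (F n p / (t + e)))) \<partial>M)"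
    unfolding rho_def
  proof (rule nn_integral_mono_AE)
    show "AE p in M. ennreal (\<Phi> p (G p / (t + e))) \<le> liminf (\<lambda>n. ennreal (\<Phi> p (F n p / (t + e))))"
      using lim
    proof eventually_elim
      case (elim p)
      then have "(\<lambda>n. ennreal (\<Phi> p (F n p / (t + e)))) \<longlonglongrightarrow> ennreal (\<Phi> p (G p / (t + e)))"
        using e t by (intro tendsto_ennrealI isCont_tendsto_compose[OF Phi_cont] tendsto_intros) auto
      then show ?case
        by (simp add: lim_imp_Liminf)
    qed
  qed
  also have "\<dots> \<le> liminf (\<lambda>n. rho (\<lambda>p. F n p / (t + e)))"
    unfolding rho_def using F by (intro nn_integral_liminf measurable_rho) auto
  also have "\<dots> \<le> liminf (\<lambda>n. 1)"
    by (rule Liminf_mono) (use le b(2) lux_less_imp_rho(2) in \<open>force elim!: eventually_mono\<close>)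
  finally have "rho (\<lambda>p. G p / (t + e)) \<le> 1"
    by (simp add: Liminf_const)
  then show "lux G \<le> b + ennreal e"
    unfolding b(1) using e t by (intro lux_le) auto
qed

end

locale convex_musielak = musielak +
  assumes Phi_convex: "convex_on UNIV (\<Phi> p)"
begin

lemma lux_add:
  assumes F: "F \<in> borel_measurable M" and G: "G \<in> borel_measurable M"
  shows "lux (\<lambda>p. F p + G p) \<le> lux F + lux G"
proof (rule ennreal_leI_epsilon)
  fix e :: real
  assume e: "e > 0" and fin: "lux F + lux G < \<infinity>"
  obtain f where f: "f \<ge> 0" "lux F = ennreal f"
    using fin by (cases "lux F") auto
  obtain g where g: "g \<ge> 0" "lux G = ennreal g"
    using fin by (cases "lux G") auto
  define a b where "a = f + e / 2" and "b = g + e / 2"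
  have ab: "a > 0" "b > 0"
    using e f g by (auto simp: a_def b_def)
  have rho: "rho (\<lambda>p. F p / a) \<le> 1" "rho (\<lambda>p. G p / b) \<le> 1"
    using e f g by (auto intro!: lux_less_imp_rho(2) simp: a_def b_def ennreal_less_iff)
  have "rho (\<lambda>p. (F p + G p) / (a + b))
      \<le> (\<integral>\<^sup>+p. ennreal (a / (a + b)) * ennreal (\<Phi> p (F p / a)) + ennreal (b / (a + b)) * ennreal (\<Phi> p (G p / b)) \<partial>M)"
    unfolding rho_def
  proof (rule nn_integral_mono)
    fix p
    have "(F p + G p) / (a + b) = (a / (a + b)) *\<^sub>R (F p / a) + (b / (a + b)) *\<^sub>R (G p / b)"
      using ab by (simp add: add_divide_distrib)
    moreover have "a / (a + b) + b / (a + b) = 1"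
      using ab by (simp flip: add_divide_distrib)
    ultimately have "\<Phi> p ((F p + G p) / (a + b))
        \<le> (a / (a + b)) * \<Phi> p (F p / a) + (b / (a + b)) * \<Phi> p (G p / b)"
      using Phi_convex[of p] ab unfolding convex_on_def by (metis UNIV_I add_pos_pos divide_nonneg_pos less_imp_le)
    then show "ennreal (\<Phi> p ((F p + G p) / (a + b)))
        \<le> ennreal (a / (a + b)) * ennreal (\<Phi> p (F p / a)) + ennreal (b / (a + b)) * ennreal (\<Phi> p (G p / b))"
      using ab by (simp add: Phi_nonneg ennreal_leI flip: ennreal_mult ennreal_plus)
  qed
  also have "\<dots> = ennreal (a / (a + b)) * rho (\<lambda>p. F p / a) + ennreal (b / (a + b)) * rho (\<lambda>p. G p / b)"
    using F G by (intro rho_linear_combination) auto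
  also have "\<dots> \<le> ennreal (a / (a + b)) * 1 + ennreal (b / (a + b)) * 1"
    by (intro add_mono mult_left_mono rho) auto
  also have "\<dots> = 1"
    using ab by (simp flip: ennreal_plus add_divide_distrib)
  finally have "lux (\<lambda>p. F p + G p) \<le> ennreal (a + b)"
    using ab by (intro lux_le) auto
  also have "\<dots> = lux F + lux G + ennreal e"
    using e f g by (simp add: a_def b_def flip: ennreal_plus)
  finally show "lux (\<lambda>p. F p + G p) \<le> lux F + lux G + ennreal e" .
qed

text \<open>
  Almost everywhere convergence upgrades to modular convergence when no modular mass is gained in
  the limit. By convexity the functions \<open>(\<Phi>(F\<^sub>n) + \<Phi>(F)) / 2 - \<Phi>((F\<^sub>n - F) / 2)\<close> are nonnegative,
  and they converge to \<open>\<Phi>(F)\<close>. If the modulars of \<open>(F\<^sub>n - F) / 2\<close> stayed above \<open>\<delta>\<close>, Fatou's lemma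
  would bound the modular of \<open>F\<close> by itself minus \<open>\<delta>\<close>.
\<close>

lemma rho_half_diff_small:
  assumes F [measurable]: "\<And>n. F n \<in> borel_measurable M" and G [measurable]: "G \<in> borel_measurable M"
    and lim: "AE p in M. (\<lambda>n. F n p) \<longlonglongrightarrow> G p"
    and le: "\<And>n. rho (F n) \<le> rho G" and fin: "rho G < \<infinity>" and "\<delta> > 0"
  shows "\<exists>n. rho (\<lambda>p. (1 / 2) * (F n p - G p)) \<le> ennreal \<delta>"
proof (rule ccontr)
  assume "\<not> ?thesis"
  then have big: "rho (\<lambda>p. (1 / 2) * (F n p - G p)) \<ge> ennreal \<delta>" for n
    by (auto simp: not_le intro: less_imp_le)
  define f where "f n p = \<Phi> p (F n p) / 2 + \<Phi> p (G p) / 2" for n p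
  define d where "d n p = \<Phi> p ((1 / 2) * (F n p - G p))" for n p
  have meas: "(\<lambda>p. f n p) \<in> borel_measurable M" "(\<lambda>p. d n p) \<in> borel_measurable M" for n
    unfolding f_def d_def
    using measurable_Phi[OF F, of n] measurable_Phi[OF G] measurable_Phi[of "\<lambda>p. (1 / 2) * (F n p - G p)"]
    by auto
  have d0: "0 \<le> d n p" for n p
    by (simp add: d_def Phi_nonneg)
  have df: "d n p \<le> f n p" for n p
  proof -
    have "\<Phi> p ((1 - 1 / 2) *\<^sub>R F n p + (1 / 2) *\<^sub>R (- G p)) \<le> (1 - 1 / 2) * \<Phi> p (F n p) + (1 / 2) * \<Phi> p (- G p)"
      by (rule convex_onD[OF Phi_convex]) auto
    then show ?thesis
      by (simp add: d_def f_def Phi_even algebra_simps)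
  qed
  obtain I where I: "I \<ge> 0" "rho G = ennreal I"
    using fin by (cases "rho G") auto
  have int_f: "(\<integral>\<^sup>+p. ennreal (f n p) \<partial>M) \<le> ennreal I" for n
  proof -
    have half: "ennreal (a / 2 + b / 2) = ennreal (1 / 2) * ennreal a + ennreal (1 / 2) * ennreal b"
      if "0 \<le> a" "0 \<le> b" for a b
      using that ennreal_mult[of "1 / 2" a] ennreal_mult[of "1 / 2" b] ennreal_plus[of "a / 2" "b / 2"] by simp
    have "(\<integral>\<^sup>+p. ennreal (f n p) \<partial>M)
        = (\<integral>\<^sup>+p. ennreal (1 / 2) * ennreal (\<Phi> p (F n p)) + ennreal (1 / 2) * ennreal (\<Phi> p (G p)) \<partial>M)"
    proof (intro nn_integral_cong)
      show "ennreal (f n p) = ennreal (1 / 2) * ennreal (\<Phi> p (F n p)) + ennreal (1 / 2) * ennreal (\<Phi> p (G p))" for p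
        unfolding f_def by (rule half) (rule Phi_nonneg)+
    qed
    also have "\<dots> = ennreal (1 / 2) * rho (F n) + ennreal (1 / 2) * rho G"
      by (rule rho_linear_combination[OF F G])
    also have "\<dots> \<le> ennreal (1 / 2) * ennreal I + ennreal (1 / 2) * ennreal I"
      using le[of n] by (intro add_mono mult_left_mono) (auto simp: I)
    also have "\<dots> = ennreal I"
      using half[OF I(1) I(1)] by simp
    finally show ?thesis .
  qed
  have int_diff: "(\<integral>\<^sup>+p. ennreal (f n p - d n p) \<partial>M) + ennreal \<delta> \<le> ennreal I" for n
  proof -
    have "(\<integral>\<^sup>+p. ennreal (f n p - d n p) \<partial>M) + ennreal \<delta>
        \<le> (\<integral>\<^sup>+p. ennreal (f n p - d n p) \<partial>M) + (\<integral>\<^sup>+p. ennreal (d n p) \<partial>M)"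
      using big[of n] by (intro add_left_mono) (simp add: rho_def d_def)
    also have "\<dots> = (\<integral>\<^sup>+p. ennreal (f n p - d n p) + ennreal (d n p) \<partial>M)"
      using meas by (intro nn_integral_add[symmetric]) auto
    also have "\<dots> = (\<integral>\<^sup>+p. ennreal (f n p) \<partial>M)"
      using d0 df by (intro nn_integral_cong) (simp flip: ennreal_plus)
    finally show ?thesis
      using int_f[of n] by (rule order_trans)
  qed
  have diff_le: "(\<integral>\<^sup>+p. ennreal (f n p - d n p) \<partial>M) \<le> ennreal I - ennreal \<delta>" for n
    using int_diff[of n] by (simp add: ennreal_le_minus_iff)
  have "ennreal I = (\<integral>\<^sup>+p. ennreal (\<Phi> p (G p)) \<partial>M)"
    using I by (simp add: rho_def)
  also have "\<dots> \<le> (\<integral>\<^sup>+p. liminf (\<lambda>n. ennreal (f n p - d n p)) \<partial>M)"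
  proof (rule nn_integral_mono_AE)
    show "AE p in M. ennreal (\<Phi> p (G p)) \<le> liminf (\<lambda>n. ennreal (f n p - d n p))"
      using lim
    proof eventually_elim
      case (elim p)
      have "(\<lambda>n. f n p - d n p) \<longlonglongrightarrow> (\<Phi> p (G p) / 2 + \<Phi> p (G p) / 2) - \<Phi> p ((1 / 2) * (G p - G p))"
        unfolding f_def d_def
        by (intro tendsto_diff tendsto_add tendsto_divide tendsto_const isCont_tendsto_compose[OF Phi_cont]
            tendsto_mult elim) auto
      then have "(\<lambda>n. ennreal (f n p - d n p)) \<longlonglongrightarrow> ennreal (\<Phi> p (G p))"
        using tendsto_ennrealI by (fastforce simp: Phi_zero)
      then show ?case
        by (simp add: lim_imp_Liminf)
    qed
  qed
  also have "\<dots> \<le> liminf (\<lambda>n. \<integral>\<^sup>+p. ennreal (f n p - d n p) \<partial>M)"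
    using meas by (intro nn_integral_liminf) auto
  also have "\<dots> \<le> liminf (\<lambda>n::nat. ennreal I - ennreal \<delta>)"
    by (rule Liminf_mono) (use diff_le in auto)
  also have "\<dots> = ennreal (I - \<delta>)"
    using \<open>\<delta> > 0\<close> by (simp add: Liminf_const ennreal_minus)
  finally have "I \<le> I - \<delta> \<or> I = 0"
    using I(1) by (cases "I - \<delta> \<ge> 0") (auto simp: ennreal_neg)
  then have "I = 0"
    using \<open>\<delta> > 0\<close> by auto
  then show False
    using int_diff[of 0] \<open>\<delta> > 0\<close> by (auto simp: ennreal_eq_0_iff add_eq_0_iff_both_eq_0)
qed

text \<open>
  Doubling carries the smallness from the factor \<open>1 / 2\<close> to an arbitrary factor.
\<close>

lemma rho_diff_small:
  assumes F: "\<And>n. F n \<in> borel_measurable M" and G: "G \<in> borel_measurable M"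
    and lim: "AE p in M. (\<lambda>n. F n p) \<longlonglongrightarrow> G p"
    and le: "\<And>n. rho (F n) \<le> rho G" and fin: "rho G < \<infinity>" and \<delta>: "\<delta> > 0"
  shows "\<exists>n\<ge>m. rho (\<lambda>p. c * (F n p - G p)) \<le> ennreal \<delta>"
proof -
  obtain K :: real where K: "0 \<le> K"
    "\<And>F. F \<in> borel_measurable M \<Longrightarrow> rho (\<lambda>p. (2 * c) * F p) \<le> ennreal K * rho F"
    using rho_scale_bound[of "2 * c"] by blast
  have "\<exists>n. rho (\<lambda>p. (1 / 2) * (F (n + m) p - G p)) \<le> ennreal (\<delta> / (K + 1))"
  proof (rule rho_half_diff_small[OF F G _ le fin])
    show "AE p in M. (\<lambda>n. F (n + m) p) \<longlonglongrightarrow> G p"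
      using lim by eventually_elim (rule LIMSEQ_ignore_initial_segment)
  qed (use K \<delta> in auto)
  then obtain n where n: "rho (\<lambda>p. (1 / 2) * (F (n + m) p - G p)) \<le> ennreal (\<delta> / (K + 1))"
    by blast
  have "rho (\<lambda>p. (2 * c) * ((1 / 2) * (F (n + m) p - G p)))
      \<le> ennreal K * rho (\<lambda>p. (1 / 2) * (F (n + m) p - G p))"
    using F G by (intro K(2)) auto
  also have "\<dots> \<le> ennreal K * ennreal (\<delta> / (K + 1))"
    using n by (rule mult_left_mono) simp
  also have "\<dots> \<le> ennreal \<delta>"
    using K(1) \<delta> by (simp add: field_simps ennreal_leI flip: ennreal_mult)
  finally show ?thesis
    by (intro exI[of _ "n + m"]) simp
qed

end

section \<open>Growth of the generalized N-function\<close>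

locale fractional_orlicz =
  fixes h H :: "'a::euclidean_space \<Rightarrow> 'a \<Rightarrow> real \<Rightarrow> real"
    and s h1 h2 :: real
  assumes s: "0 < s" "s < 1"
    and H_def: "\<And>x y t. H x y t = integral {0..\<bar>t\<bar>} (\<lambda>r. h x y r * r)"
    and N_fun: "generalized_N_function H"
    and loc_int: "locally_integrable_N H"
    and i_C1: "\<And>x y. h x y C1_differentiable_on {0<..}"
    and ii_const: "1 < h1" "h1 < h2" "h2 < real DIM('a)"
    and ii_lower: "\<And>x y t. t \<noteq> 0 \<Longrightarrow> h1 \<le> h x y \<bar>t\<bar> * \<bar>t\<bar>\<^sup>2 / H x y \<bar>t\<bar>"
    and ii_upper: "\<And>x y t. t \<noteq> 0 \<Longrightarrow> h x y \<bar>t\<bar> * \<bar>t\<bar>\<^sup>2 / H x y \<bar>t\<bar> \<le> h2"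
    and iii_sup: "bdd_above (range (\<lambda>(x, y). H x y 1))"
    and iv: "\<And>x. \<exists>b>0.
      (\<integral>\<^sup>+t\<in>{0..b}. ennreal ((t / H x x t) powr (s / (real DIM('a) - s))) \<partial>lborel) < \<infinity>"
    and v: "\<And>x y z t. 0 \<le> t \<Longrightarrow> H (x - z) (y - z) t = H x y t"
begin

lemma H_even: "H x y (- t) = H x y t"
  and H_zero: "H x y 0 = 0"
  and H_convex: "convex_on UNIV (H x y)"
  and H_isCont: "isCont (H x y) t"
  and H_nonneg: "0 \<le> H x y t"
  and H_pos: "t \<noteq> 0 \<Longrightarrow> 0 < H x y t"
proof -
  have *: "0 \<le> H x y t" "continuous_on UNIV (H x y)" "H x y (- t) = H x y t"
      "convex_on UNIV (H x y)" "H x y t = 0 \<longleftrightarrow> t = 0" for x y t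
    using N_fun unfolding generalized_N_function_def by blast+
  then show "H x y (- t) = H x y t" "H x y 0 = 0" "convex_on UNIV (H x y)" "0 \<le> H x y t"
    by auto
  show "isCont (H x y) t"
    using *(2) by (simp add: continuous_on_eq_continuous_at)
  show "0 < H x y t" if "t \<noteq> 0"
    using *(1)[of x y t] *(5)[of x y t] that by linarith
qed

lemma H_abs: "H x y \<bar>t\<bar> = H x y t"
  by (simp add: abs_if H_even)

lemma H_mono:
  assumes "0 \<le> a" "a \<le> b"
  shows "H x y a \<le> H x y b"
proof (cases "b = 0")
  case False
  then have b: "b > 0"
    using assms by simp
  have "H x y ((1 - a / b) *\<^sub>R 0 + (a / b) *\<^sub>R b) \<le> (1 - a / b) * H x y 0 + (a / b) * H x y b"
    using assms b by (intro convex_onD[OF H_convex]) auto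
  also have "\<dots> \<le> 1 * H x y b"
    unfolding H_zero using assms b H_nonneg[of x y b]
    by (simp only: mult_zero_right add_0) (intro mult_right_mono, auto)
  finally show ?thesis
    using b by simp
qed (use assms in simp)

lemma H_translate: "H (x + w) (y + w) t = H x y t"
  using v[of "\<bar>t\<bar>" x "- w" y] by (simp add: H_abs)

lemma H_diagonal: "H x x t = H 0 0 t"
  using H_translate[of 0 x 0 t] by simp

lemma H_has_derivative:
  assumes "t > 0"
  shows "(H x y has_real_derivative h x y t * t) (at t)"
proof -
  let ?f = "\<lambda>r. h x y r * r"
  have "?f integrable_on {0..t + 1}"
    using H_def[of x y "t + 1"] H_pos[of "t + 1" x y] not_integrable_integral[of ?f "{0..t + 1}"] assms
    by (cases "?f integrable_on {0..t + 1}") auto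
  moreover have "isCont (h x y) t"
    using C1_differentiable_imp_continuous_on[OF i_C1[of x y]] assms
    by (simp add: continuous_on_eq_continuous_at)
  then have "continuous (at t within {0..t + 1}) ?f"
    by (rule continuous_at_imp_continuous_at_within[OF continuous_mult]) simp
  ultimately have "((\<lambda>u. integral {0..u} ?f) has_vector_derivative ?f t) (at t within {0..t + 1} - {})"
    using assms by (intro integral_has_vector_derivative_continuous_at) auto
  then have "((\<lambda>u. integral {0..u} ?f) has_real_derivative ?f t) (at t)"
    using assms by (simp add: has_real_derivative_iff_has_vector_derivative at_within_interior[of t "{0..t + 1}"])
  then show ?thesis
    by (rule has_field_derivative_transform_within_open[of _ _ _ "{0<..}"]) (use assms in \<open>auto simp: H_def\<close>)
qed

text \<open>
  The two bounds on \<open>h x y t * t\<^sup>2 / H x y t\<close> say that \<open>H x y t / t powr p\<close> is nonincreasing for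
  \<open>p = h2\<close> and nondecreasing for \<open>p = h1\<close>.
\<close>

lemma H_div_powr_derivative:
  assumes "t > 0"
  shows "((\<lambda>r. H x y r * r powr (- p)) has_real_derivative
    (h x y t * t\<^sup>2 - p * H x y t) * t powr (- p - 1)) (at t)"
proof -
  have "((\<lambda>r. H x y r * r powr (- p)) has_real_derivative
    h x y t * t * t powr (- p) + (- p * t powr (- p - 1)) * H x y t) (at t)"
    by (rule DERIV_mult[OF H_has_derivative has_real_derivative_powr]) (use assms in auto)
  moreover have "t powr (- p) = t * t powr (- p - 1)"
    using assms by (simp add: powr_diff)
  ultimately show ?thesis
    by (simp add: power2_eq_square algebra_simps)
qed

lemma H_scale_upper:
  assumes "1 \<le> c"
  shows "H x y (c * t) \<le> c powr h2 * H x y t"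
proof -
  have *: "H x y (c * t) \<le> c powr h2 * H x y t" if t: "t > 0" for t
  proof -
    have "H x y (c * t) * (c * t) powr (- h2) \<le> H x y t * t powr (- h2)"
    proof (rule DERIV_nonpos_imp_nonincreasing[where f = "\<lambda>r. H x y r * r powr (- h2)"])
      show "t \<le> c * t"
        using assms t by simp
      fix r assume "t \<le> r" "r \<le> c * t"
      then have r: "r > 0"
        using t by simp
      have "h x y r * r\<^sup>2 \<le> h2 * H x y r"
        using ii_upper[of r x y] H_pos[of r x y] r by (simp add: divide_le_eq)
      then have "(h x y r * r\<^sup>2 - h2 * H x y r) * r powr (- h2 - 1) \<le> 0"
        by (intro mult_nonpos_nonneg) auto
      then show "\<exists>y'. DERIV (\<lambda>r. H x y r * r powr (- h2)) r :> y' \<and> y' \<le> 0"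
        using H_div_powr_derivative[OF r] by blast
    qed
    also have "(c * t) powr (- h2) = t powr (- h2) / c powr h2"
      using assms t by (simp add: powr_mult powr_minus[of c] divide_inverse mult.commute)
    finally have "(H x y (c * t) / c powr h2) * t powr (- h2) \<le> H x y t * t powr (- h2)"
      by simp
    then have "H x y (c * t) / c powr h2 \<le> H x y t"
      using t by (simp only: mult_le_cancel_right_pos powr_gt_zero)
    then show ?thesis
      using assms by (simp add: divide_le_eq mult.commute)
  qed
  show ?thesis
  proof (cases "t = 0")
    case True
    then show ?thesis
      by (simp add: H_zero)
  next
    case False
    then show ?thesis
      using *[of "\<bar>t\<bar>"] assms H_abs[of x y "c * t"] H_abs[of x y t] by (simp add: abs_mult)
  qed
qed

lemma H_scale_lower:
  assumes "1 \<le> c" "t > 0"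
  shows "c powr h1 * H x y t \<le> H x y (c * t)"
proof -
  have "H x y t * t powr (- h1) \<le> H x y (c * t) * (c * t) powr (- h1)"
  proof (rule DERIV_nonneg_imp_nondecreasing[where f = "\<lambda>r. H x y r * r powr (- h1)"])
    show "t \<le> c * t"
      using assms by simp
    fix r assume "t \<le> r" "r \<le> c * t"
    then have r: "r > 0"
      using assms by simp
    have "h x y r * r\<^sup>2 \<ge> h1 * H x y r"
      using ii_lower[of r x y] H_pos[of r x y] r by (simp add: le_divide_eq)
    then have "(h x y r * r\<^sup>2 - h1 * H x y r) * r powr (- h1 - 1) \<ge> 0"
      by (intro mult_nonneg_nonneg) auto
    then show "\<exists>y'. DERIV (\<lambda>r. H x y r * r powr (- h1)) r :> y' \<and> y' \<ge> 0"
      using H_div_powr_derivative[OF r] by blast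
  qed
  also have "(c * t) powr (- h1) = t powr (- h1) / c powr h1"
    using assms by (simp add: powr_mult powr_minus[of c] divide_inverse mult.commute)
  finally have "H x y t * t powr (- h1) \<le> (H x y (c * t) / c powr h1) * t powr (- h1)"
    by simp
  then have "H x y t \<le> H x y (c * t) / c powr h1"
    using assms(2) by (simp only: mult_le_cancel_right_pos powr_gt_zero)
  then show ?thesis
    using assms by (simp add: le_divide_eq mult.commute)
qed

lemma H_upper_bound:
  obtains b where "b > 0" "\<And>x y t. 0 \<le> t \<Longrightarrow> H x y t \<le> b * (t powr h1 + t powr h2)"
proof -
  obtain b where b: "\<And>x y. H x y 1 \<le> b"
    using iii_sup unfolding bdd_above_def by auto
  have b0: "b > 0"
    using b[of 0 0] H_pos[of 1 0 0] by simp
  have "H x y t \<le> b * (t powr h1 + t powr h2)" if t: "0 \<le> t" for x y t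
  proof -
    consider "t = 0" | "0 < t" "t \<le> 1" | "1 \<le> t"
      using t by linarith
    then show ?thesis
    proof cases
      case 1
      then show ?thesis
        by (simp add: H_zero)
    next
      case 2
      have "(1 / t) powr h1 * H x y t \<le> H x y 1"
        using H_scale_lower[of "1 / t" t x y] 2 by simp
      then have "H x y t \<le> H x y 1 * t powr h1"
        using 2 by (simp add: powr_divide field_simps)
      also have "\<dots> \<le> b * (t powr h1 + t powr h2)"
        using b b0 by (intro mult_mono) (auto intro: H_nonneg)
      finally show ?thesis .
    next
      case 3
      have "H x y t \<le> t powr h2 * H x y 1"
        using H_scale_upper[OF 3, of x y 1] by simp
      also have "\<dots> \<le> (t powr h1 + t powr h2) * b"
        using b b0 by (intro mult_mono) (auto intro: H_nonneg)
      finally show ?thesis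
        by (simp add: mult.commute)
    qed
  qed
  with b0 show thesis
    by (rule that)
qed

section \<open>The Sobolev conjugate\<close>

lemma s_less_dim: "s < real DIM('a)"
  using s ii_const by linarith

text \<open>
  The integrand in the definition of \<open>G_fun\<close>; by translation invariance it may be taken at the origin.
\<close>

definition weight :: "real \<Rightarrow> real" where
  "weight r = (r / H 0 0 r) powr (s / (real DIM('a) - s))"

lemma weight_nonneg: "0 \<le> weight r"
  by (simp add: weight_def)

lemma weight_pos: "r > 0 \<Longrightarrow> 0 < weight r"
  using H_pos[of r 0 0] by (simp add: weight_def)

lemma weight_isCont: "r > 0 \<Longrightarrow> isCont weight r"
  unfolding weight_def using H_pos[of r 0 0] by (intro continuous_intros H_isCont) auto

lemma weight_integrable: "weight integrable_on {0..t}"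
proof -
  obtain b where b: "b > 0" "(\<integral>\<^sup>+t\<in>{0..b}. ennreal (weight t) \<partial>lborel) < \<infinity>"
    using iv[of 0] unfolding weight_def by blast
  have meas: "weight \<in> borel_measurable borel"
  proof -
    have [measurable]: "H 0 0 \<in> borel_measurable borel"
      by (intro borel_measurable_continuous_onI continuous_at_imp_continuous_on ballI H_isCont)
    show ?thesis
      unfolding weight_def[abs_def] by measurable
  qed
  have "integrable lborel (\<lambda>t. indicator {0..b} t *\<^sub>R weight t)"
  proof (rule integrableI_nonneg)
    have "(\<integral>\<^sup>+t. ennreal (indicator {0..b} t *\<^sub>R weight t) \<partial>lborel) = (\<integral>\<^sup>+t\<in>{0..b}. ennreal (weight t) \<partial>lborel)"
      by (intro nn_integral_cong) (auto simp: indicator_def)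
    then show "(\<integral>\<^sup>+t. ennreal (indicator {0..b} t *\<^sub>R weight t) \<partial>lborel) < \<infinity>"
      using b(2) by simp
  qed (use meas weight_nonneg in auto)
  then have 0: "weight integrable_on {0..b}"
    using set_borel_integral_eq_integral(1)[of "{0..b}" weight] by (simp add: set_integrable_def)
  show ?thesis
  proof (cases "t \<le> b")
    case True
    then show ?thesis
      using integrable_subinterval_real[OF 0, of 0 t] by simp
  next
    case False
    have "weight integrable_on {b..t}"
      by (intro integrable_continuous_interval continuous_at_imp_continuous_on ballI weight_isCont) (use b in auto)
    then show ?thesis
      using b(1) False by (intro Henstock_Kurzweil_Integration.integrable_combine[OF _ _ 0]) auto
  qed
qed

definition weight_int :: "real \<Rightarrow> real" where
  "weight_int t = integral {0..t} weight"

lemma weight_int_zero: "weight_int 0 = 0"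
  by (simp add: weight_int_def)

lemma weight_int_strict_mono:
  assumes "0 \<le> a" "a < b"
  shows "weight_int a < weight_int b"
proof -
  define c where "c = (a + b) / 2"
  have c: "a < c" "c < b" "0 < c"
    using assms by (auto simp: c_def)
  have int: "weight integrable_on {c..b}"
    by (rule integrable_subinterval_real[OF weight_integrable[of b]]) (use c assms in auto)
  have eq: "weight_int b = weight_int c + integral {c..b} weight"
    unfolding weight_int_def using c weight_integrable by (intro Henstock_Kurzweil_Integration.integral_combine[symmetric]) auto
  have mono: "weight_int a \<le> weight_int c"
    unfolding weight_int_def using c assms
    by (intro integral_subset_le weight_integrable) (auto simp: weight_nonneg)
  have "continuous_on {c..b} weight"
    by (intro continuous_at_imp_continuous_on ballI weight_isCont) (use c in auto)
  then have "integral {c..b} weight \<noteq> 0"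
    using integral_eq_0_iff[of c b weight] c weight_nonneg weight_pos[of b] by force
  moreover have "integral {c..b} weight \<ge> 0"
    by (intro integral_nonneg int) (simp add: weight_nonneg)
  ultimately show ?thesis
    using eq mono by linarith
qed

lemma weight_int_continuous: "continuous_on {0..} weight_int"
proof -
  have *: "continuous_on {0..b} weight_int" for b
    unfolding weight_int_def[abs_def] by (intro indefinite_integral_continuous_1 weight_integrable)
  show ?thesis
    unfolding continuous_on_eq_continuous_within
  proof
    fix t :: real assume "t \<in> {0..}"
    then have "continuous (at t within {0..t + 1}) weight_int"
      using *[of "t + 1"] by (auto simp: continuous_on_eq_continuous_within)
    moreover have "at t within {0..t + 1} = at t within {0..}"
      by (rule at_within_nhd[of _ "{..<t + 1}"]) auto
    ultimately show "continuous (at t within {0..}) weight_int"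
      by simp
  qed
qed

definition conj_exp :: real where
  "conj_exp = 1 + (1 - h2) * (s / (real DIM('a) - s))"

text \<open>This is where the subcriticality \<open>s * h2 < N\<close> enters.\<close>

lemma conj_exp_pos: "conj_exp > 0"
proof -
  have "s * h2 \<le> 1 * h2"
    using s ii_const by (intro mult_right_mono) auto
  then have "s * h2 < real DIM('a)"
    using ii_const by linarith
  then have "(h2 - 1) * s < real DIM('a) - s"
    by (simp add: algebra_simps)
  then have "(h2 - 1) * s / (real DIM('a) - s) < 1"
    using s_less_dim by simp
  then show ?thesis
    unfolding conj_exp_def by (simp add: diff_divide_distrib left_diff_distrib)
qed

text \<open>
  Substituting \<open>c * r\<close> for \<open>r\<close> gives one factor \<open>c\<close>, and the growth bound \<open>H_scale_upper\<close> bounds the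
  weight from below. Since the resulting exponent is positive, this single estimate makes \<open>G\<close> unbounded
  and its inverse doubling.
\<close>

lemma weight_int_scale:
  assumes c: "1 \<le> c" and t: "0 \<le> t"
  shows "c powr conj_exp * weight_int t \<le> weight_int (c * t)"
proof -
  let ?e = "s / (real DIM('a) - s)"
  have e: "?e > 0"
    using s s_less_dim by simp
  have w: "c powr ((1 - h2) * ?e) * weight r \<le> weight (c * r)" if r: "r > 0" for r
  proof -
    have "c powr (1 - h2) * (r / H 0 0 r) = c * r / (c powr h2 * H 0 0 r)"
      using c by (simp add: powr_diff)
    also have "\<dots> \<le> c * r / H 0 0 (c * r)"
      using c r H_scale_upper[OF c, of 0 0 r] H_pos[of "c * r" 0 0] by (intro divide_left_mono) auto
    finally have "(c powr (1 - h2) * (r / H 0 0 r)) powr ?e \<le> (c * r / H 0 0 (c * r)) powr ?e"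
      using e r H_pos[of r 0 0] by (intro powr_mono2) auto
    moreover have "(c powr (1 - h2) * (r / H 0 0 r)) powr ?e = c powr ((1 - h2) * ?e) * weight r"
      unfolding weight_def powr_powr[symmetric] by (rule powr_mult)
    ultimately show ?thesis
      by (simp add: weight_def)
  qed
  have img: "(\<lambda>x. x / c) ` {0..c * t} = {0..t}"
    using c by (auto simp: image_iff field_simps intro!: bexI[of _ "_ * c"])
  have stretch: "((\<lambda>r. weight (c * r)) has_integral (1 / \<bar>c\<bar>) * weight_int (c * t)) {0..t}"
    using has_integral_stretch_real[OF integrable_integral[OF weight_integrable[of "c * t"]], of c] c
    by (simp add: img weight_int_def)
  have "((\<lambda>r. c powr ((1 - h2) * ?e) * weight r) has_integral c powr ((1 - h2) * ?e) * weight_int t) {0..t}"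
    unfolding weight_int_def by (intro has_integral_mult_right integrable_integral weight_integrable)
  then have "c powr ((1 - h2) * ?e) * weight_int t \<le> (1 / \<bar>c\<bar>) * weight_int (c * t)"
  proof (rule has_integral_le[OF _ stretch])
    show "c powr ((1 - h2) * ?e) * weight r \<le> weight (c * r)" if "r \<in> {0..t}" for r
      using w[of r] that by (cases "r = 0") (auto simp: weight_def)
  qed
  then have "c * (c powr ((1 - h2) * ?e) * weight_int t) \<le> weight_int (c * t)"
    using c by (simp add: field_simps)
  moreover have "c powr conj_exp = c * c powr ((1 - h2) * ?e)"
    using c by (simp add: conj_exp_def powr_add)
  ultimately show ?thesis
    by (simp add: mult_ac)
qed

abbreviation (input) "G \<equiv> G_fun H s 0"

lemma G_fun_eq: "G_fun H s x t = weight_int t powr ((real DIM('a) - s) / real DIM('a))"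
proof -
  have "(\<lambda>r. (r / H x x r) powr (s / (real DIM('a) - s))) = weight"
    by (rule ext) (simp add: weight_def H_diagonal[of x])
  then show ?thesis
    by (simp add: G_fun_def weight_int_def)
qed

lemma G_exponent_pos: "(real DIM('a) - s) / real DIM('a) > 0"
  using s_less_dim by simp

lemma G_zero: "G 0 = 0"
  by (simp add: G_fun_eq weight_int_zero)

lemma weight_int_nonneg: "0 \<le> t \<Longrightarrow> 0 \<le> weight_int t"
  using weight_int_strict_mono[of 0 t] by (cases "t = 0") (auto simp: weight_int_zero)

lemma G_strict_mono: "0 \<le> a \<Longrightarrow> a < b \<Longrightarrow> G a < G b"
  unfolding G_fun_eq using G_exponent_pos
  by (intro powr_less_mono2 weight_int_strict_mono weight_int_nonneg) auto

lemma G_inj: "inj_on G {0..}"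
proof (rule inj_onI)
  fix a b assume "a \<in> {0..}" "b \<in> {0..}" "G a = G b"
  then show "a = b"
    using G_strict_mono[of a b] G_strict_mono[of b a] by (cases a b rule: linorder_cases) auto
qed

lemma G_scale:
  assumes "1 \<le> c" "0 \<le> t"
  shows "c powr (conj_exp * ((real DIM('a) - s) / real DIM('a))) * G t \<le> G (c * t)"
proof -
  have "(c powr conj_exp * weight_int t) powr ((real DIM('a) - s) / real DIM('a)) \<le> G (c * t)"
    unfolding G_fun_eq using G_exponent_pos weight_int_scale[OF assms] weight_int_nonneg[OF assms(2)]
    by (intro powr_mono2) auto
  then show ?thesis
    using weight_int_nonneg[OF assms(2)] by (simp add: G_fun_eq powr_mult powr_powr)
qed

lemma G_doubling:
  obtains c where "c \<ge> 1" "\<And>K t. 1 \<le> K \<Longrightarrow> 0 \<le> t \<Longrightarrow> K * G t \<le> G (K powr c * t)"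
proof -
  define e where "e = conj_exp * ((real DIM('a) - s) / real DIM('a))"
  have e: "e > 0"
    unfolding e_def using conj_exp_pos G_exponent_pos by (rule mult_pos_pos)
  have "K * G t \<le> G (K powr (max 1 (1 / e)) * t)" if K: "1 \<le> K" and t: "0 \<le> t" for K t
  proof -
    have G0: "0 \<le> G t"
      by (simp add: G_fun_eq)
    have "1 \<le> max 1 (1 / e) * e"
      using e by (auto simp: max_def field_simps)
    then have "K powr 1 \<le> (K powr max 1 (1 / e)) powr e"
      using K unfolding powr_powr by (intro powr_mono) auto
    then have "K * G t \<le> (K powr max 1 (1 / e)) powr e * G t"
      using K G0 by (intro mult_right_mono) auto
    also have "\<dots> \<le> G (K powr (max 1 (1 / e)) * t)"
      unfolding e_def[symmetric] using K t
      by (subst e_def, intro G_scale) (auto intro!: ge_one_powr_ge_zero)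
    finally show ?thesis .
  qed
  then show thesis
    by (intro that[of "max 1 (1 / e)"]) auto
qed

lemma G_surj:
  assumes "0 \<le> y"
  shows "\<exists>t\<ge>0. G t = y"
proof -
  obtain c where c: "\<And>K t. 1 \<le> K \<Longrightarrow> 0 \<le> t \<Longrightarrow> K * G t \<le> G (K powr c * t)"
    using G_doubling by metis
  have G1: "G 1 > 0"
    using G_strict_mono[of 0 1] by (simp add: G_zero)
  define K where "K = max 1 (y / G 1)"
  have "y \<le> K * G 1"
    using G1 by (auto simp: K_def max_def field_simps)
  also have "\<dots> \<le> G (K powr c)"
    using c[of K 1] by (simp add: K_def)
  finally have y: "y \<le> G (K powr c)" .
  have "continuous_on {0..} G"
    unfolding G_fun_eq[abs_def] using G_exponent_pos
    by (intro continuous_on_powr' weight_int_continuous continuous_on_const) (auto simp: weight_int_nonneg)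
  then have "continuous_on {0..K powr c} G"
    by (rule continuous_on_subset) auto
  then show ?thesis
    using IVT'[of G 0 y "K powr c"] y assms by (auto simp: G_zero)
qed

definition G_inv :: "real \<Rightarrow> real" where
  "G_inv = inv_into {0..} G"

lemma G_inv:
  assumes "0 \<le> y"
  shows "0 \<le> G_inv y" "G (G_inv y) = y"
proof -
  have y: "y \<in> G ` {0..}"
    using G_surj[OF assms] by force
  show "0 \<le> G_inv y" "G (G_inv y) = y"
    using inv_into_into[OF y] f_inv_into_f[OF y] by (simp_all add: G_inv_def)
qed

lemma G_inv_G: "0 \<le> t \<Longrightarrow> G_inv (G t) = t"
  unfolding G_inv_def by (rule inv_into_f_f[OF G_inj]) simp

lemma G_mono: "0 \<le> a \<Longrightarrow> a \<le> b \<Longrightarrow> G a \<le> G b"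
  using G_strict_mono[of a b] by (cases "a = b") auto

lemma G_inv_le_iff: "0 \<le> y \<Longrightarrow> 0 \<le> t \<Longrightarrow> G_inv y \<le> t \<longleftrightarrow> y \<le> G t"
  using G_inv[of y] G_mono[of "G_inv y" t] G_strict_mono[of t "G_inv y"] by force

lemma G_inv_mono: "0 \<le> a \<Longrightarrow> a \<le> b \<Longrightarrow> G_inv a \<le> G_inv b"
  using G_inv_le_iff[of a "G_inv b"] G_inv[of b] by simp

lemma G_inv_zero: "G_inv 0 = 0"
  using G_inv_G[of 0] by (simp add: G_zero)

lemma H_star_eq: "H_star H s x t = H 0 0 (G_inv \<bar>t\<bar>)"
proof -
  have "G_fun H s x = G"
    by (rule ext) (simp add: G_fun_eq)
  then show ?thesis
    by (simp add: H_star_def G_inv_def H_diagonal[of x])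
qed

text \<open>
  The odd extension of the inverse of \<open>G\<close> is a monotone surjection of the real line, hence
  continuous; since \<open>H 0 0\<close> is even, composing with it gives the Sobolev conjugate.
\<close>

lemma H_star_isCont: "isCont (H_star H s x) t"
proof -
  define J where "J t = (if 0 \<le> t then G_inv t else - G_inv (- t))" for t
  have "continuous_on UNIV J"
  proof (rule continuous_onI_mono)
    have "y \<in> range J" for y
    proof (cases "0 \<le> y")
      case True
      then have "J (G y) = y"
        using G_inv_G[of y] G_mono[of 0 y] by (simp add: J_def G_zero)
      then show ?thesis
        by (metis rangeI)
    next
      case False
      then have "0 < G (- y)"
        using G_strict_mono[of 0 "- y"] by (simp add: G_zero)
      then have "J (- G (- y)) = y"
        using False by (simp add: J_def G_inv_G)
      then show ?thesis
        by (metis rangeI)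
    qed
    then have "range J = UNIV"
      by blast
    then show "open (range J)"
      by simp
    show "J a \<le> J b" if "a \<le> b" for a b
      using that G_inv_mono[of a b] G_inv_mono[of "- b" "- a"] G_inv[of b] G_inv[of "- a"]
      by (auto simp: J_def)
  qed
  then have "isCont J t"
    by (simp add: continuous_on_eq_continuous_at)
  then have "isCont (\<lambda>t. H 0 0 (J t)) t"
    by (rule isCont_o2[OF _ H_isCont])
  moreover have "H_star H s x = (\<lambda>t. H 0 0 (J t))"
    by (auto simp: H_star_eq J_def H_even)
  ultimately show ?thesis
    by simp
qed

lemma H_star_mono: "0 \<le> a \<Longrightarrow> a \<le> b \<Longrightarrow> H_star H s x a \<le> H_star H s x b"
  unfolding H_star_eq using G_inv[of a] by (intro H_mono G_inv_mono) auto

lemma H_star_pos: "t \<noteq> 0 \<Longrightarrow> 0 < H_star H s x t"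
  unfolding H_star_eq using G_inv(2)[of "\<bar>t\<bar>"] by (intro H_pos) (auto simp: G_zero)

lemma H_star_doubling:
  obtains C where "C \<ge> 0" "\<And>x t. H_star H s x (2 * t) \<le> C * H_star H s x t"
proof -
  obtain c where c: "c \<ge> 1" "\<And>K t. 1 \<le> K \<Longrightarrow> 0 \<le> t \<Longrightarrow> K * G t \<le> G (K powr c * t)"
    using G_doubling by metis
  define K :: real where "K = 2 powr c"
  have K: "1 \<le> K"
    unfolding K_def using c(1) by (intro ge_one_powr_ge_zero) auto
  have "H_star H s x (2 * t) \<le> K powr h2 * H_star H s x t" for x t
  proof -
    have "2 * \<bar>t\<bar> \<le> G (K * G_inv \<bar>t\<bar>)"
      using c(2)[of 2 "G_inv \<bar>t\<bar>"] G_inv[of "\<bar>t\<bar>"] by (simp add: K_def)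
    then have "G_inv (2 * \<bar>t\<bar>) \<le> K * G_inv \<bar>t\<bar>"
      using K G_inv[of "\<bar>t\<bar>"] by (subst G_inv_le_iff) auto
    then have "H 0 0 (G_inv (2 * \<bar>t\<bar>)) \<le> H 0 0 (K * G_inv \<bar>t\<bar>)"
      using G_inv[of "2 * \<bar>t\<bar>"] by (intro H_mono) auto
    also have "\<dots> \<le> K powr h2 * H 0 0 (G_inv \<bar>t\<bar>)"
      by (rule H_scale_upper[OF K])
    finally show ?thesis
      by (simp add: H_star_eq abs_mult)
  qed
  then show thesis
    by (intro that[of "K powr h2"]) auto
qed

end

section \<open>Measurability on the product space\<close>

lemma lebesgue_null_preserving:
  fixes f :: "'b::euclidean_space \<Rightarrow> 'a::euclidean_space"
  assumes f: "f \<in> borel_measurable borel"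
    and null: "\<And>N. N \<in> null_sets lborel \<Longrightarrow> f -` N \<in> null_sets lborel"
  shows "f \<in> lebesgue \<rightarrow>\<^sub>M lebesgue"
    and "(AE x in lebesgue. P x) \<Longrightarrow> (AE y in lebesgue. P (f y))"
proof -
  have f': "f \<in> lebesgue \<rightarrow>\<^sub>M lborel"
    using f by (intro measurable_completion) simp
  show "f \<in> lebesgue \<rightarrow>\<^sub>M lebesgue"
  proof (rule completion.measurable_completion2[OF f'])
    show "null_sets lborel \<subseteq> null_sets (distr lebesgue lborel f)"
    proof
      fix N :: "'a set" assume N: "N \<in> null_sets lborel"
      then have "f -` N \<inter> space lebesgue \<in> null_sets lebesgue"
        using null_sets_completionI[OF null[OF N]] by simp
      then show "N \<in> null_sets (distr lebesgue lborel f)"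
        unfolding null_sets_distr_iff[OF f'] using N by blast
    qed
  qed
  assume "AE x in lebesgue. P x"
  then obtain N where N: "N \<in> null_sets lborel" "{x. \<not> P x} \<subseteq> N"
    unfolding AE_completion_iff by (auto simp: eventually_ae_filter)
  then have "{y. \<not> P (f y)} \<subseteq> f -` N"
    by auto
  then show "AE y in lebesgue. P (f y)"
    using null_sets_completionI[OF null[OF N(1)]] by (intro AE_I') auto
qed

lemma null_sets_fst_snd:
  fixes N :: "'a::euclidean_space set"
  assumes "N \<in> null_sets lborel"
  shows "(fst :: 'a \<times> 'a \<Rightarrow> 'a) -` N \<in> null_sets lborel" "(snd :: 'a \<times> 'a \<Rightarrow> 'a) -` N \<in> null_sets lborel"
proof -
  have N: "N \<in> sets lborel" "emeasure lborel N = 0"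
    using assms by auto
  have "emeasure (lborel \<Otimes>\<^sub>M lborel) (N \<times> UNIV) = 0" "emeasure (lborel \<Otimes>\<^sub>M lborel) (UNIV \<times> N) = 0"
    using N by (simp_all add: lborel.emeasure_pair_measure_Times)
  moreover have "N \<times> UNIV \<in> sets (lborel \<Otimes>\<^sub>M lborel)" "UNIV \<times> N \<in> sets (lborel \<Otimes>\<^sub>M lborel)"
    using N by auto
  moreover have "(fst :: 'a \<times> 'a \<Rightarrow> 'a) -` N = N \<times> UNIV" "(snd :: 'a \<times> 'a \<Rightarrow> 'a) -` N = UNIV \<times> N"
    by auto
  ultimately show "(fst :: 'a \<times> 'a \<Rightarrow> 'a) -` N \<in> null_sets lborel" "(snd :: 'a \<times> 'a \<Rightarrow> 'a) -` N \<in> null_sets lborel"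
    unfolding lborel_prod by (auto intro!: null_setsI)
qed

lemma borel_measurable_fst_snd:
  "(fst :: 'a::euclidean_space \<times> 'a \<Rightarrow> 'a) \<in> borel_measurable borel"
  "(snd :: 'a::euclidean_space \<times> 'a \<Rightarrow> 'a) \<in> borel_measurable borel"
  by (intro borel_measurable_continuous_onI continuous_intros)+

lemma lebesgue_fst:
  shows "(fst :: 'a::euclidean_space \<times> 'a \<Rightarrow> 'a) \<in> lebesgue \<rightarrow>\<^sub>M lebesgue"
    and "(AE x::'a in lebesgue. P x) \<Longrightarrow> (AE p::'a \<times> 'a in lebesgue. P (fst p))"
  using lebesgue_null_preserving[OF borel_measurable_fst_snd(1) null_sets_fst_snd(1)] by blast+

lemma lebesgue_snd:
  shows "(snd :: 'a::euclidean_space \<times> 'a \<Rightarrow> 'a) \<in> lebesgue \<rightarrow>\<^sub>M lebesgue"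
    and "(AE x::'a in lebesgue. P x) \<Longrightarrow> (AE p::'a \<times> 'a in lebesgue. P (snd p))"
  using lebesgue_null_preserving[OF borel_measurable_fst_snd(2) null_sets_fst_snd(2)] by blast+

lemma nn_integral_lborel_translate:
  fixes f :: "'b::euclidean_space \<Rightarrow> ennreal"
  assumes "f \<in> borel_measurable borel"
  shows "(\<integral>\<^sup>+x. f (c + x) \<partial>lborel) = (\<integral>\<^sup>+x. f x \<partial>lborel)"
proof -
  have "(\<integral>\<^sup>+x. f x \<partial>lborel) = (\<integral>\<^sup>+x. f x \<partial>distr lborel borel ((+) c))"
    by (simp add: lborel_distr_plus)
  also have "\<dots> = (\<integral>\<^sup>+x. f (c + x) \<partial>lborel)"
    using assms by (intro nn_integral_distr) auto
  finally show ?thesis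
    by simp
qed

lemma AE_lborel_translate:
  fixes c :: "'b::euclidean_space"
  assumes "AE x in lborel. P x"
  shows "AE x in lborel. P (c + x)"
  using AE_distrD[of "(+) c" lborel borel P] assms unfolding lborel_distr_plus by simp

lemma nn_integral_lebesgue_translate:
  fixes f :: "'b::euclidean_space \<Rightarrow> ennreal"
  assumes "f \<in> borel_measurable lebesgue"
  shows "(\<integral>\<^sup>+x. f (c + x) \<partial>lebesgue) = (\<integral>\<^sup>+x. f x \<partial>lebesgue)"
proof -
  obtain g where g: "g \<in> borel_measurable lborel" "AE x in lborel. f x = g x"
    using completion_ex_borel_measurable[OF assms] by blast
  have "(\<integral>\<^sup>+x. f (c + x) \<partial>lborel) = (\<integral>\<^sup>+x. g (c + x) \<partial>lborel)"
    by (intro nn_integral_cong_AE AE_lborel_translate[OF g(2)])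
  also have "\<dots> = (\<integral>\<^sup>+x. g x \<partial>lborel)"
    using g(1) by (intro nn_integral_lborel_translate) simp
  also have "\<dots> = (\<integral>\<^sup>+x. f x \<partial>lborel)"
    using g(2) by (intro nn_integral_cong_AE) auto
  finally show ?thesis
    by (simp add: nn_integral_completion)
qed

text \<open>
  A Caratheodory function is determined by its values at the positive rationals, so its
  superpositions are measurable as soon as its sections at these points are.
\<close>

lemma caratheodory_measurable:
  fixes K :: "'p \<Rightarrow> real \<Rightarrow> real"
  assumes sec: "\<And>q. q \<in> \<rat> \<Longrightarrow> q > 0 \<Longrightarrow> (\<lambda>p. K p q) \<in> borel_measurable M"
    and F: "F \<in> borel_measurable M"
    and even: "\<And>p t. K p (- t) = K p t" and zero: "\<And>p. K p 0 = 0"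
    and mono: "\<And>p a b. 0 \<le> a \<Longrightarrow> a \<le> b \<Longrightarrow> K p a \<le> K p b"
    and cont: "\<And>p t. isCont (K p) t"
  shows "(\<lambda>p. K p (F p)) \<in> borel_measurable M"
  unfolding borel_measurable_iff_greater
proof
  fix a :: real
  have abs: "K p \<bar>t\<bar> = K p t" for p t
    by (simp add: abs_if even)
  have nonneg: "0 \<le> K p t" for p t
    using mono[of 0 "\<bar>t\<bar>" p] by (simp add: abs zero)
  show "{p \<in> space M. a < K p (F p)} \<in> sets M"
  proof (cases "a < 0")
    case True
    then have "{p \<in> space M. a < K p (F p)} = space M"
      using nonneg order_less_le_trans by blast
    then show ?thesis
      by simp
  next
    case False
    have "{p \<in> space M. a < K p (F p)}
        = (\<Union>q\<in>{q \<in> \<rat>. q > 0}. {p \<in> space M. q < \<bar>F p\<bar>} \<inter> {p \<in> space M. a < K p q})"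
    proof (intro equalityI subsetI)
      fix p assume p: "p \<in> {p \<in> space M. a < K p (F p)}"
      then have a: "a < K p \<bar>F p\<bar>"
        by (simp add: abs)
      then have F0: "\<bar>F p\<bar> > 0"
        using False zero[of p] by (cases "F p = 0") auto
      have "\<forall>\<^sub>F t in at \<bar>F p\<bar>. a < K p t"
        using order_tendstoD(1)[OF cont[unfolded isCont_def] a] .
      then obtain d where d: "d > 0" "\<And>t. t \<noteq> \<bar>F p\<bar> \<Longrightarrow> dist t \<bar>F p\<bar> < d \<Longrightarrow> a < K p t"
        unfolding eventually_at by auto
      have "max 0 (\<bar>F p\<bar> - d) < \<bar>F p\<bar>"
        using d(1) F0 by simp
      then obtain q where q: "q \<in> \<rat>" "max 0 (\<bar>F p\<bar> - d) < q" "q < \<bar>F p\<bar>"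
        using Rats_dense_in_real by blast
      then have "a < K p q"
        by (intro d(2)) (auto simp: dist_real_def)
      with q p show "p \<in> (\<Union>q\<in>{q \<in> \<rat>. q > 0}. {p \<in> space M. q < \<bar>F p\<bar>} \<inter> {p \<in> space M. a < K p q})"
        by auto
    next
      fix p assume "p \<in> (\<Union>q\<in>{q \<in> \<rat>. q > 0}. {p \<in> space M. q < \<bar>F p\<bar>} \<inter> {p \<in> space M. a < K p q})"
      then obtain q where q: "q > 0" "p \<in> space M" "q < \<bar>F p\<bar>" "a < K p q"
        by auto
      then show "p \<in> {p \<in> space M. a < K p (F p)}"
        using mono[of q "\<bar>F p\<bar>" p] by (simp add: abs)
    qed
    moreover have "{p \<in> space M. q < \<bar>F p\<bar>} \<inter> {p \<in> space M. a < K p q} \<in> sets M" if "q \<in> \<rat>" "q > 0" for q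
      using F sec[OF that] by measurable
    then have "(\<Union>q\<in>{q \<in> \<rat>. q > 0}. {p \<in> space M. q < \<bar>F p\<bar>} \<inter> {p \<in> space M. a < K p q}) \<in> sets M"
      by (intro sets.countable_UN' countable_subset[OF _ countable_rat]) auto
    ultimately show ?thesis
      by simp
  qed
qed

section \<open>The energy of a function\<close>

definition difference :: "('a \<Rightarrow> real) \<Rightarrow> 'a \<times> 'a \<Rightarrow> real" where
  "difference u p = u (fst p) - u (snd p)"

lemma difference_add: "difference (\<lambda>x. u x + v x) = (\<lambda>p. difference u p + difference v p)"
  and difference_diff: "difference (\<lambda>x. u x - v x) = (\<lambda>p. difference u p - difference v p)"
  and difference_scale: "difference (\<lambda>x. c * u x) = (\<lambda>p. c * difference u p)"
  and difference_zero: "difference (\<lambda>x. 0) = (\<lambda>p. 0)"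
  by (auto simp: difference_def algebra_simps)

lemma difference_measurable:
  assumes "u \<in> borel_measurable lebesgue"
  shows "difference u \<in> borel_measurable lebesgue"
  unfolding difference_def
  using measurable_compose[OF lebesgue_fst(1) assms] measurable_compose[OF lebesgue_snd(1) assms]
  by simp

lemma difference_AE:
  assumes "AE x in lebesgue. u x = v x"
  shows "AE p in lebesgue. difference u p = difference v p"
  using lebesgue_fst(2)[OF assms] lebesgue_snd(2)[OF assms]
  by eventually_elim (simp add: difference_def)

lemma difference_tendsto_AE:
  assumes "AE x in lebesgue. (\<lambda>n. u n x) \<longlonglongrightarrow> v x"
  shows "AE p in lebesgue. (\<lambda>n. difference (u n) p) \<longlonglongrightarrow> difference v p"
  using lebesgue_fst(2)[OF assms] lebesgue_snd(2)[OF assms]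
  by eventually_elim (auto simp: difference_def intro: tendsto_diff)

context fractional_orlicz
begin

text \<open>
  The integrand of the Gagliardo functional at the pair \<open>p\<close> as a function of the increment \<open>t\<close>. On the
  diagonal, which is a null set, it vanishes because division by \<open>0\<close> gives \<open>0\<close>.
\<close>

definition gag_Phi :: "'a \<times> 'a \<Rightarrow> real \<Rightarrow> real" where
  "gag_Phi p t = H (fst p) (snd p) (t / norm (fst p - snd p) powr s) / norm (fst p - snd p) ^ DIM('a)"

text \<open>
  Local integrability gives measurability on all compact squares, and these exhaust the space.
\<close>

lemma H_section_measurable: "(\<lambda>p. H (fst p) (snd p) t) \<in> borel_measurable lebesgue"
proof -
  have pos: "(\<lambda>p. H (fst p) (snd p) t) \<in> borel_measurable lebesgue" if "t > 0" for t
  proof (rule borel_measurable_LIMSEQ_real)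
    fix n :: nat
    have "set_integrable lebesgue (cball (0::'a) (real n) \<times> cball 0 (real n)) (\<lambda>(x, y). H x y t)"
      using loc_int that compact_cball unfolding locally_integrable_N_def by blast
    then show "(\<lambda>p. indicator (cball (0::'a) (real n) \<times> cball 0 (real n)) p *\<^sub>R (case p of (x, y) \<Rightarrow> H x y t))
        \<in> borel_measurable lebesgue"
      unfolding set_integrable_def by (rule borel_measurable_integrable)
  next
    fix p :: "'a \<times> 'a"
    obtain n0 where n0: "norm (fst p) \<le> real n0" "norm (snd p) \<le> real n0"
      using real_arch_simple[of "max (norm (fst p)) (norm (snd p))"] by auto
    have "\<forall>\<^sub>F n in sequentially. H (fst p) (snd p) t
        = indicator (cball (0::'a) (real n) \<times> cball 0 (real n)) p *\<^sub>R (case p of (x, y) \<Rightarrow> H x y t)"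
      using eventually_ge_at_top[of n0]
    proof eventually_elim
      case (elim n)
      then have "p \<in> cball 0 (real n) \<times> cball 0 (real n)"
        using n0 by (auto simp: mem_Times_iff)
      then show ?case
        by (simp add: case_prod_unfold)
    qed
    then show "(\<lambda>n. indicator (cball (0::'a) (real n) \<times> cball 0 (real n)) p *\<^sub>R (case p of (x, y) \<Rightarrow> H x y t))
        \<longlonglongrightarrow> H (fst p) (snd p) t"
      by (rule Lim_transform_eventually[OF tendsto_const])
  qed
  consider "t > 0" | "t = 0" | "- t > 0"
    by linarith
  then show ?thesis
    using pos[of t] pos[of "- t"] by cases (auto simp: H_zero H_even)
qed

lemma gag_Phi_even: "gag_Phi p (- t) = gag_Phi p t"
  using H_even[of _ _ "t / norm (fst p - snd p) powr s"] by (simp add: gag_Phi_def)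

lemma gag_Phi_zero: "gag_Phi p 0 = 0"
  by (simp add: gag_Phi_def H_zero)

lemma gag_Phi_mono: "0 \<le> a \<Longrightarrow> a \<le> b \<Longrightarrow> gag_Phi p a \<le> gag_Phi p b"
  unfolding gag_Phi_def by (intro divide_right_mono H_mono) auto

lemma gag_Phi_isCont: "isCont (gag_Phi p) t"
proof -
  have "isCont (\<lambda>t. H (fst p) (snd p) (t * inverse (norm (fst p - snd p) powr s))) t"
    by (rule isCont_o2[OF _ H_isCont]) simp
  then have "isCont (\<lambda>t. H (fst p) (snd p) (t * inverse (norm (fst p - snd p) powr s))
      * inverse (norm (fst p - snd p) ^ DIM('a))) t"
    by (rule continuous_mult) simp
  then show ?thesis
    by (simp add: gag_Phi_def[abs_def] divide_inverse)
qed

lemma gag_Phi_convex: "convex_on UNIV (gag_Phi p)"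
proof (rule convex_onI)
  fix c a b :: real
  assume c: "0 < c" "c < 1"
  let ?r = "norm (fst p - snd p) powr s" and ?d = "norm (fst p - snd p) ^ DIM('a)"
  have "H (fst p) (snd p) ((1 - c) *\<^sub>R (a / ?r) + c *\<^sub>R (b / ?r))
      \<le> (1 - c) * H (fst p) (snd p) (a / ?r) + c * H (fst p) (snd p) (b / ?r)"
    using c by (intro convex_onD[OF H_convex]) auto
  then have "H (fst p) (snd p) ((1 - c) *\<^sub>R (a / ?r) + c *\<^sub>R (b / ?r)) / ?d
      \<le> ((1 - c) * H (fst p) (snd p) (a / ?r) + c * H (fst p) (snd p) (b / ?r)) / ?d"
    by (intro divide_right_mono) auto
  then show "gag_Phi p ((1 - c) *\<^sub>R a + c *\<^sub>R b) \<le> (1 - c) * gag_Phi p a + c * gag_Phi p b"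
    by (simp add: gag_Phi_def add_divide_distrib)
qed simp

lemma gag_Phi_measurable:
  assumes "F \<in> borel_measurable lebesgue"
  shows "(\<lambda>p. gag_Phi p (F p)) \<in> borel_measurable lebesgue"
proof -
  have "(\<lambda>p::'a \<times> 'a. norm (fst p - snd p)) \<in> borel_measurable borel"
    by (intro borel_measurable_continuous_onI continuous_intros)
  then have [measurable]: "(\<lambda>p::'a \<times> 'a. norm (fst p - snd p)) \<in> borel_measurable lebesgue"
    by (intro measurable_completion) simp
  have "(\<lambda>p. H (fst p) (snd p) (F p / norm (fst p - snd p) powr s)) \<in> borel_measurable lebesgue"
  proof (rule caratheodory_measurable[where K = "\<lambda>p. H (fst p) (snd p)"])
    show "(\<lambda>p. F p / norm (fst p - snd p) powr s) \<in> borel_measurable lebesgue"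
      using assms by measurable
  qed (rule H_section_measurable H_even H_zero H_mono H_isCont | assumption)+
  then show ?thesis
    unfolding gag_Phi_def by measurable
qed

sublocale gag: convex_musielak lebesgue gag_Phi "2 powr h2"
proof
  show "gag_Phi p (2 * t) \<le> 2 powr h2 * gag_Phi p t" for p t
  proof -
    have "H (fst p) (snd p) (2 * t / norm (fst p - snd p) powr s)
        \<le> 2 powr h2 * H (fst p) (snd p) (t / norm (fst p - snd p) powr s)"
      using H_scale_upper[of 2 "fst p" "snd p" "t / norm (fst p - snd p) powr s"] by simp
    from divide_right_mono[OF this, of "norm (fst p - snd p) ^ DIM('a)"] show ?thesis
      by (simp add: gag_Phi_def)
  qed
qed (rule gag_Phi_measurable gag_Phi_even gag_Phi_zero gag_Phi_mono gag_Phi_isCont gag_Phi_convex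
    powr_ge_zero | assumption)+

definition star_const :: real where
  "star_const = (SOME C. C \<ge> 0 \<and> (\<forall>x t. H_star H s x (2 * t) \<le> C * H_star H s x t))"

sublocale star: musielak lebesgue "H_star H s" star_const
proof
  have ex: "\<exists>C. C \<ge> 0 \<and> (\<forall>x t. H_star H s x (2 * t) \<le> C * H_star H s x t)"
    using H_star_doubling by metis
  show "0 \<le> star_const" "H_star H s p (2 * t) \<le> star_const * H_star H s p t" for p t
    using someI_ex[OF ex] by (auto simp: star_const_def)
  show "(\<lambda>p. H_star H s p (F p)) \<in> borel_measurable lebesgue" if "F \<in> borel_measurable lebesgue" for F :: "'a \<Rightarrow> real"
  proof -
    have "H_star H s 0 \<in> borel_measurable borel"
      by (intro borel_measurable_continuous_onI continuous_at_imp_continuous_on ballI H_star_isCont)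
    then have "(\<lambda>p. H_star H s 0 (F p)) \<in> borel_measurable lebesgue"
      using that by measurable
    then show ?thesis
      by (simp add: H_star_eq)
  qed
  show "H_star H s p (- t) = H_star H s p t" for p t
    by (simp add: H_star_eq)
  show "H_star H s p 0 = 0" for p
    by (simp add: H_star_eq G_inv_zero H_zero)
qed (rule H_star_mono H_star_isCont | assumption)+

lemma gagliardo_eq_lux: "gagliardo H s u = gag.lux (difference u)"
proof -
  have "(\<integral>\<^sup>+(x, y). ennreal (H x y (\<bar>u x - u y\<bar> / (\<tau> * norm (x - y) powr s))
          / norm (x - y) ^ DIM('a)) \<partial>(lebesgue :: ('a \<times> 'a) measure))
      = gag.rho (\<lambda>p. difference u p / \<tau>)" if "\<tau> > 0" for \<tau>
    unfolding gag.rho_def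
  proof (rule nn_integral_cong)
    fix p :: "'a \<times> 'a"
    have "\<bar>u (fst p) - u (snd p)\<bar> / (\<tau> * norm (fst p - snd p) powr s)
        = \<bar>difference u p / \<tau> / norm (fst p - snd p) powr s\<bar>"
      using that by (simp add: difference_def abs_divide)
    then show "(case p of (x, y) \<Rightarrow> ennreal (H x y (\<bar>u x - u y\<bar> / (\<tau> * norm (x - y) powr s)) / norm (x - y) ^ DIM('a)))
        = ennreal (gag_Phi p (difference u p / \<tau>))"
      unfolding case_prod_unfold gag_Phi_def by (simp only: H_abs)
  qed
  then show ?thesis
    unfolding gagliardo_def gag.lux_def by (intro arg_cong[of _ _ Inf] Collect_cong) auto
qed

lemma L_star_norm_eq_lux: "L_star_norm H s u = star.lux u"
proof -
  have "H_star H s x (\<bar>u x\<bar> / \<tau>) = H_star H s x (u x / \<tau>)" if "\<tau> > 0" for x \<tau>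
    using that star.Phi_abs[of x "u x / \<tau>"] by (simp add: abs_divide)
  then show ?thesis
    unfolding L_star_norm_def star.lux_def star.rho_def
    by (intro arg_cong[of _ _ Inf] Collect_cong) auto
qed

definition energy :: "('a \<Rightarrow> real) \<Rightarrow> ennreal" where
  "energy u = gag.rho (difference u) + star.rho u"

lemma energy_finite_iff: "energy u < \<infinity> \<longleftrightarrow> gag.rho (difference u) < \<infinity> \<and> star.rho u < \<infinity>"
  by (simp add: energy_def ennreal_add_less_top)

lemma W_fun_iff: "u \<in> W_fun H s \<longleftrightarrow> u \<in> borel_measurable lebesgue \<and> energy u < \<infinity>"
proof (cases "u \<in> borel_measurable lebesgue")
  case True
  have "(\<exists>\<tau>>0. (\<integral>\<^sup>+x. ennreal (H_star H s x (\<tau> * \<bar>u x\<bar>)) \<partial>lebesgue) < \<infinity>) \<longleftrightarrow> star.rho u < \<infinity>"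
  proof
    assume "\<exists>\<tau>>0. (\<integral>\<^sup>+x. ennreal (H_star H s x (\<tau> * \<bar>u x\<bar>)) \<partial>lebesgue) < \<infinity>"
    then obtain \<tau> where \<tau>: "\<tau> > 0" "star.rho (\<lambda>x. \<tau> * \<bar>u x\<bar>) < \<infinity>"
      by (auto simp: star.rho_def)
    have "star.rho (\<lambda>x. 1 / \<tau> * (\<tau> * \<bar>u x\<bar>)) < \<infinity>"
      using True by (intro star.rho_finite_scale \<tau>) measurable
    then show "star.rho u < \<infinity>"
      using \<tau>(1) by (simp add: star.rho_def star.Phi_abs)
  next
    assume "star.rho u < \<infinity>"
    then show "\<exists>\<tau>>0. (\<integral>\<^sup>+x. ennreal (H_star H s x (\<tau> * \<bar>u x\<bar>)) \<partial>lebesgue) < \<infinity>"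
      by (intro exI[of _ 1]) (simp add: star.rho_def star.Phi_abs)
  qed
  then show ?thesis
    using True gag.lux_finite_iff[OF difference_measurable[OF True]]
    unfolding W_fun_def L_star_def gagliardo_eq_lux energy_finite_iff by blast
qed (simp add: W_fun_def L_star_def)

lemma energy_cong_AE:
  assumes "AE x in lebesgue. u x = v x"
  shows "energy u = energy v"
  using star.rho_cong_AE[OF assms] gag.rho_cong_AE[OF difference_AE[OF assms]] by (simp add: energy_def)

lemma energy_add:
  assumes "u \<in> borel_measurable lebesgue" "v \<in> borel_measurable lebesgue"
  shows "energy (\<lambda>x. u x + v x) \<le> energy (\<lambda>x. 2 * u x) + energy (\<lambda>x. 2 * v x)"
  using add_mono[OF gag.rho_add[OF difference_measurable[OF assms(1)] difference_measurable[OF assms(2)]]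
      star.rho_add[OF assms]]
  unfolding energy_def difference_add difference_scale by (simp add: ac_simps)

lemma energy_scale_finite:
  assumes "u \<in> borel_measurable lebesgue" "energy u < \<infinity>"
  shows "energy (\<lambda>x. c * u x) < \<infinity>"
  using assms difference_measurable[OF assms(1)]
  unfolding energy_finite_iff difference_scale
  using gag.rho_finite_scale[of "difference u" c] star.rho_finite_scale[of u c] by blast

lemma energy_dominated_convergence:
  assumes w: "\<And>n. w n \<in> borel_measurable lebesgue"
    and lim: "AE x in lebesgue. (\<lambda>n. w n x) \<longlonglongrightarrow> 0"
    and D: "D \<in> borel_measurable lebesgue" "gag.rho D < \<infinity>"
      "\<And>n. AE p in lebesgue. \<bar>difference (w n) p\<bar> \<le> \<bar>D p\<bar>"
    and E: "E \<in> borel_measurable lebesgue" "star.rho E < \<infinity>"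
      "\<And>n. AE x in lebesgue. \<bar>w n x\<bar> \<le> \<bar>E x\<bar>"
  shows "(\<lambda>n. energy (\<lambda>x. c * w n x)) \<longlonglongrightarrow> 0"
proof -
  have "AE p in lebesgue. (\<lambda>n. difference (w n) p) \<longlonglongrightarrow> 0"
    using difference_tendsto_AE[of w "\<lambda>x. 0"] lim by (simp add: difference_zero)
  then have "(\<lambda>n. gag.rho (\<lambda>p. c * difference (w n) p)) \<longlonglongrightarrow> 0"
    by (intro gag.rho_dominated_convergence[OF difference_measurable[OF w] D(1) _ D(3,2)])
  moreover have "(\<lambda>n. star.rho (\<lambda>x. c * w n x)) \<longlonglongrightarrow> 0"
    by (rule star.rho_dominated_convergence[OF w E(1) lim E(3,2)])
  ultimately have "(\<lambda>n. gag.rho (\<lambda>p. c * difference (w n) p) + star.rho (\<lambda>x. c * w n x)) \<longlonglongrightarrow> 0 + 0"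
    by (rule tendsto_add)
  then show ?thesis
    by (simp add: energy_def difference_scale)
qed

text \<open>
  Approximation in both modulars at every scale \<open>c\<close>, which amounts to approximation in norm. In this
  form transitivity comes from \<open>energy_add\<close>, which rests on monotonicity of the modulars.
\<close>

definition approximable :: "('a \<Rightarrow> real) set \<Rightarrow> ('a \<Rightarrow> real) \<Rightarrow> bool" where
  "approximable A u \<longleftrightarrow> (\<forall>c. \<forall>\<delta>>0. \<exists>v\<in>A. energy (\<lambda>x. c * (u x - v x)) \<le> ennreal \<delta>)"

lemma approximable_trans:
  assumes u: "u \<in> borel_measurable lebesgue" and A: "A \<subseteq> borel_measurable lebesgue"
    and B: "B \<subseteq> borel_measurable lebesgue"
    and uA: "approximable A u" and AB: "\<And>v. v \<in> A \<Longrightarrow> approximable B v"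
  shows "approximable B u"
  unfolding approximable_def
proof (intro allI impI)
  fix c \<delta> :: real
  assume \<delta>: "\<delta> > 0"
  obtain v where v: "v \<in> A" "energy (\<lambda>x. (2 * c) * (u x - v x)) \<le> ennreal (\<delta> / 2)"
    using uA \<delta> unfolding approximable_def by (meson half_gt_zero)
  obtain w where w: "w \<in> B" "energy (\<lambda>x. (2 * c) * (v x - w x)) \<le> ennreal (\<delta> / 2)"
    using AB[OF v(1)] \<delta> unfolding approximable_def by (meson half_gt_zero)
  have [measurable]: "v \<in> borel_measurable lebesgue" "w \<in> borel_measurable lebesgue"
    using v w A B by auto
  note [measurable] = u
  have "energy (\<lambda>x. c * (u x - w x)) = energy (\<lambda>x. c * (u x - v x) + c * (v x - w x))"
    by (simp flip: distrib_left)
  also have "\<dots> \<le> energy (\<lambda>x. 2 * (c * (u x - v x))) + energy (\<lambda>x. 2 * (c * (v x - w x)))"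
    by (intro energy_add) measurable
  also have "\<dots> \<le> ennreal (\<delta> / 2) + ennreal (\<delta> / 2)"
    using v(2) w(2) by (intro add_mono) (simp_all add: mult.assoc)
  also have "\<dots> = ennreal \<delta>"
    using \<delta> by (simp flip: ennreal_plus)
  finally show "\<exists>w\<in>B. energy (\<lambda>x. c * (u x - w x)) \<le> ennreal \<delta>"
    using w(1) by blast
qed

lemma approximableI_tendsto:
  assumes "\<And>n. v n \<in> A" and "\<And>c. (\<lambda>n. energy (\<lambda>x. c * (u x - v n x))) \<longlonglongrightarrow> 0"
  shows "approximable A u"
  unfolding approximable_def
proof (intro allI impI)
  fix c \<delta> :: real
  assume "\<delta> > 0"
  then have "\<forall>\<^sub>F n in sequentially. energy (\<lambda>x. c * (u x - v n x)) < ennreal \<delta>"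
    by (intro order_tendstoD(2)[OF assms(2)]) simp
  then obtain n where "energy (\<lambda>x. c * (u x - v n x)) < ennreal \<delta>"
    by (auto simp: eventually_sequentially)
  then show "\<exists>v\<in>A. energy (\<lambda>x. c * (u x - v x)) \<le> ennreal \<delta>"
    using assms(1) less_imp_le by blast
qed

end

section \<open>Truncation and cutoff\<close>

lemma nn_integral_covering_finite:
  fixes f :: "'a::euclidean_space \<Rightarrow> real"
  assumes cover: "\<And>z. z \<noteq> 0 \<Longrightarrow> f z \<le> 0 \<or> (\<exists>k::nat. norm z \<le> r k \<and> f z \<le> c k)"
    and r: "\<And>k. 0 \<le> r k" and c: "\<And>k. 0 \<le> c k"
    and sum: "summable (\<lambda>k. c k * r k ^ DIM('a))"
  shows "(\<integral>\<^sup>+z. ennreal (f z) \<partial>lborel) < \<infinity>"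
proof -
  have "(\<integral>\<^sup>+z. ennreal (f z) \<partial>lborel) \<le> (\<integral>\<^sup>+z. (\<Sum>k. ennreal (c k) * indicator (cball (0::'a) (r k)) z) \<partial>lborel)"
  proof (rule nn_integral_mono_AE)
    show "AE z in lborel. ennreal (f z) \<le> (\<Sum>k. ennreal (c k) * indicator (cball 0 (r k)) z)"
      using AE_lborel_singleton[of "0::'a"]
    proof eventually_elim
      case (elim z)
      consider "f z \<le> 0" | k where "norm z \<le> r k" "f z \<le> c k"
        using cover[OF elim] by blast
      then show ?case
      proof cases
        case (2 k)
        then have "ennreal (f z) \<le> ennreal (c k) * indicator (cball 0 (r k)) z"
          by (simp add: ennreal_leI)
        also have "\<dots> \<le> (\<Sum>k. ennreal (c k) * indicator (cball 0 (r k)) z)"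
          using ennreal_suminf_lessD[of "\<lambda>k. ennreal (c k) * indicator (cball 0 (r k)) z" _ k]
          by (meson linorder_not_less order_less_irrefl)
        finally show ?thesis .
      qed (simp add: ennreal_neg)
    qed
  qed
  also have "\<dots> = (\<Sum>k. \<integral>\<^sup>+z. ennreal (c k) * indicator (cball (0::'a) (r k)) z \<partial>lborel)"
    by (intro nn_integral_suminf borel_measurable_times_ennreal borel_measurable_const borel_measurable_indicator)
       simp
  also have "\<dots> = (\<Sum>k. ennreal (unit_ball_vol (real DIM('a)) * (c k * r k ^ DIM('a))))"
  proof (intro suminf_cong)
    fix k
    have "(\<integral>\<^sup>+z. ennreal (c k) * indicator (cball (0::'a) (r k)) z \<partial>lborel)
        = ennreal (c k) * ennreal (unit_ball_vol (real DIM('a)) * r k ^ DIM('a))"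
      using r[of k] by (simp add: nn_integral_cmult_indicator emeasure_cball)
    also have "\<dots> = ennreal (unit_ball_vol (real DIM('a)) * (c k * r k ^ DIM('a)))"
      using c[of k] by (simp add: mult_ac flip: ennreal_mult')
    finally show "(\<integral>\<^sup>+z. ennreal (c k) * indicator (cball (0::'a) (r k)) z \<partial>lborel)
        = ennreal (unit_ball_vol (real DIM('a)) * (c k * r k ^ DIM('a)))" .
  qed
  also have "\<dots> < \<infinity>"
  proof -
    have "summable (\<lambda>k. unit_ball_vol (real DIM('a)) * (c k * r k ^ DIM('a)))"
      using sum by (rule summable_mult)
    then show ?thesis
      using c r by (subst suminf_ennreal2) auto
  qed
  finally show ?thesis .
qed

text \<open>
  Shells of radii \<open>\<kappa> * \<beta> ^ k\<close>: with \<open>\<beta> = 1 / 2\<close> they exhaust a punctured ball, with \<open>\<beta> = 2\<close> the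
  complement of an open ball.
\<close>

definition shells :: "real \<Rightarrow> real \<Rightarrow> 'a::euclidean_space set" where
  "shells \<kappa> \<beta> = {z. \<exists>k::nat. \<kappa> * \<beta> ^ k / 2 \<le> norm z \<and> norm z \<le> \<kappa> * \<beta> ^ k}"

lemma shells_borel [measurable]: "shells \<kappa> \<beta> \<in> sets borel"
proof -
  have "closed {z::'a. \<kappa> * \<beta> ^ k / 2 \<le> norm z \<and> norm z \<le> \<kappa> * \<beta> ^ k}" for k
    by (intro closed_Collect_conj closed_Collect_le continuous_intros)
  moreover have "shells \<kappa> \<beta> = (\<Union>k. {z::'a. \<kappa> * \<beta> ^ k / 2 \<le> norm z \<and> norm z \<le> \<kappa> * \<beta> ^ k})"
    by (auto simp: shells_def)
  ultimately show ?thesis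
    by auto
qed

lemma powr_power_swap:
  assumes "(x::real) > 0"
  shows "(x ^ n) powr a = (x powr a) ^ n"
  using assms by (simp add: powr_realpow[symmetric] powr_powr powr_power mult.commute)

lemma nn_integral_shells_finite:
  assumes "\<kappa> > 0" "\<beta> > 0" "\<beta> powr a < 1"
  shows "(\<integral>\<^sup>+z. ennreal (indicator (shells \<kappa> \<beta>) z * (norm (z::'a::euclidean_space) powr a / norm z ^ DIM('a))) \<partial>lborel) < \<infinity>"
proof (rule nn_integral_covering_finite)
  define r where "r k = \<kappa> * \<beta> ^ k" for k
  define c where "c k = 2 powr \<bar>a\<bar> * r k powr a * (2 ^ DIM('a) / r k ^ DIM('a))" for k
  have r: "r k > 0" for k
    using assms by (simp add: r_def)
  show "0 \<le> r k" "0 \<le> c k" for k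
    using r[of k] by (auto simp: c_def)
  have "c k * r k ^ DIM('a) = (2 powr \<bar>a\<bar> * 2 ^ DIM('a) * \<kappa> powr a) * (\<beta> powr a) ^ k" for k
  proof -
    have "r k powr a = \<kappa> powr a * (\<beta> powr a) ^ k"
      using assms by (simp add: r_def powr_mult powr_power_swap)
    then show ?thesis
      using r[of k] by (simp add: c_def)
  qed
  then show "summable (\<lambda>k. c k * r k ^ DIM('a))"
    using assms by (simp add: summable_mult summable_geometric)
  fix z :: 'a assume z: "z \<noteq> 0"
  show "indicator (shells \<kappa> \<beta>) z * (norm z powr a / norm z ^ DIM('a)) \<le> 0
      \<or> (\<exists>k. norm z \<le> r k \<and> indicator (shells \<kappa> \<beta>) z * (norm z powr a / norm z ^ DIM('a)) \<le> c k)"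
  proof (cases "z \<in> shells \<kappa> \<beta>")
    case True
    then obtain k where k: "r k / 2 \<le> norm z" "norm z \<le> r k"
      by (auto simp: shells_def r_def)
    have "norm z powr a \<le> 2 powr \<bar>a\<bar> * r k powr a"
    proof (cases "a \<ge> 0")
      case True
      have "norm z powr a \<le> 1 * r k powr a"
        using k(2) True by (simp add: powr_mono2)
      also have "\<dots> \<le> 2 powr \<bar>a\<bar> * r k powr a"
        by (intro mult_right_mono ge_one_powr_ge_zero) auto
      finally show ?thesis .
    next
      case False
      have "norm z powr a \<le> (r k / 2) powr a"
        using k(1) False r[of k] by (intro powr_mono2') auto
      also have "\<dots> = 2 powr \<bar>a\<bar> * r k powr a"
        using False by (simp add: powr_divide powr_minus_divide)
      finally show ?thesis .
    qed
    moreover have "1 / norm z ^ DIM('a) \<le> 2 ^ DIM('a) / r k ^ DIM('a)"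
    proof -
      have "(r k / 2) ^ DIM('a) \<le> norm z ^ DIM('a)"
        using k(1) r[of k] by (intro power_mono) auto
      then have "1 / norm z ^ DIM('a) \<le> 1 / (r k / 2) ^ DIM('a)"
        using r[of k] z by (intro divide_left_mono) auto
      then show ?thesis
        by (simp add: power_divide)
    qed
    ultimately have "norm z powr a * (1 / norm z ^ DIM('a)) \<le> c k"
      unfolding c_def by (intro mult_mono) auto
    with True k(2) show ?thesis
      by (intro disjI2 exI[of _ k]) simp
  qed simp
qed

lemma dyadic_scale:
  assumes "1 \<le> (r::real)"
  obtains k :: nat where "2 ^ k \<le> r" "r < 2 * 2 ^ k"
proof -
  define n where "n = (LEAST n. r < 2 ^ n)"
  obtain m where "r < 2 ^ m"
    using real_arch_pow[of 2 r] by auto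
  then have n: "r < 2 ^ n"
    unfolding n_def by (rule LeastI)
  have "n \<noteq> 0"
  proof
    assume "n = 0"
    with n show False
      using assms by simp
  qed
  then obtain k where k: "n = Suc k"
    using not0_implies_Suc by blast
  have "\<not> r < 2 ^ k"
    using not_less_Least[of k "\<lambda>n. r < 2 ^ n"] k by (simp add: n_def)
  then show thesis
    using n k by (intro that[of k]) auto
qed

text \<open>
  The integrand behaves like \<open>norm z powr (q * (1 - s) - N)\<close> near the origin and like
  \<open>norm z powr (- q * s - N)\<close> at infinity; both are integrable, as summation over dyadic shells shows.
\<close>

lemma nn_integral_Lipschitz_kernel_finite:
  fixes s q :: real
  assumes "0 < s" "s < 1" "0 < q"
  shows "(\<integral>\<^sup>+z. ennreal ((min 1 (norm (z::'a::euclidean_space)) / norm z powr s) powr q / norm z ^ DIM('a)) \<partial>lborel) < \<infinity>"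
proof -
  let ?f = "\<lambda>z::'a. (min 1 (norm z) / norm z powr s) powr q / norm z ^ DIM('a)"
  let ?g = "\<lambda>\<kappa> \<beta> a (z::'a). ennreal (indicator (shells \<kappa> \<beta>) z * (norm z powr a / norm z ^ DIM('a)))"
  have "ennreal (?f z) \<le> ?g 1 (1 / 2) ((1 - s) * q) z + ?g 2 2 (- s * q) z" for z
  proof (cases "z = 0")
    case False
    then have r: "norm z > 0"
      by simp
    show ?thesis
    proof (cases "norm z \<le> 1")
      case True
      then have "1 \<le> 1 / norm z"
        using r by simp
      then obtain k where k: "2 ^ k \<le> 1 / norm z" "1 / norm z < 2 * 2 ^ k"
        by (rule dyadic_scale)
      have "z \<in> shells 1 (1 / 2)"
        unfolding shells_def using k r by (auto simp: power_one_over field_simps intro!: exI[of _ k])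
      moreover have "(norm z / norm z powr s) powr q = norm z powr ((1 - s) * q)"
        using r by (simp add: powr_powr powr_diff flip: powr_powr)
      ultimately have "ennreal (?f z) = ?g 1 (1 / 2) ((1 - s) * q) z"
        using True by (simp only: min_absorb2 indicator_simps mult_1)
      then show ?thesis
        by (simp only: add_increasing2 zero_le order_refl)
    next
      case False
      then obtain k where k: "2 ^ k \<le> norm z" "norm z < 2 * 2 ^ k"
        using dyadic_scale[of "norm z"] by auto
      have "z \<in> shells 2 2"
        unfolding shells_def using k by (auto intro!: exI[of _ k])
      moreover have "(1 / norm z powr s) powr q = norm z powr (- s * q)"
        using r by (simp add: powr_powr powr_minus_divide powr_divide)
      ultimately have "ennreal (?f z) = ?g 2 2 (- s * q) z"
        using False by (simp only: min_absorb1 linear indicator_simps mult_1 not_le less_imp_le)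
      then show ?thesis
        by (simp only: add_increasing zero_le order_refl)
    qed
  qed simp
  then have "(\<integral>\<^sup>+z. ennreal (?f z) \<partial>lborel) \<le> (\<integral>\<^sup>+z. ?g 1 (1 / 2) ((1 - s) * q) z + ?g 2 2 (- s * q) z \<partial>lborel)"
    by (intro nn_integral_mono)
  also have "\<dots> = (\<integral>\<^sup>+z. ?g 1 (1 / 2) ((1 - s) * q) z \<partial>lborel) + (\<integral>\<^sup>+z. ?g 2 2 (- s * q) z \<partial>lborel)"
    by (intro nn_integral_add) measurable
  also have "\<dots> < \<infinity>"
  proof -
    have "(1 / 2) powr ((1 - s) * q) < (1::real)"
      using assms powr01_less_one[of "1 / 2" "(1 - s) * q"] by simp
    moreover have "2 powr (- s * q) < (1::real)"
      using assms powr_less_mono[of "- s * q" 0 2] by simp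
    ultimately show ?thesis
      using nn_integral_shells_finite[of 1 "1 / 2" "(1 - s) * q", where 'a = 'a]
        nn_integral_shells_finite[of 2 2 "- s * q", where 'a = 'a]
      by (simp add: ennreal_add_less_top)
  qed
  finally show ?thesis .
qed

lemma nn_integral_convolution_kernel:
  fixes k :: "'a::euclidean_space \<Rightarrow> ennreal"
  assumes k [measurable]: "k \<in> borel_measurable borel" and even: "\<And>z. k (- z) = k z" and A [measurable]: "A \<in> sets borel"
  shows "(\<integral>\<^sup>+p. indicator A (snd p) * k (fst p - snd p) \<partial>(lborel :: ('a \<times> 'a) measure)) = emeasure lborel A * (\<integral>\<^sup>+z. k z \<partial>lborel)"
    and "(\<integral>\<^sup>+p. indicator A (fst p) * k (fst p - snd p) \<partial>(lborel :: ('a \<times> 'a) measure)) = emeasure lborel A * (\<integral>\<^sup>+z. k z \<partial>lborel)"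
proof -
  have trans: "(\<integral>\<^sup>+x. k (x - y) \<partial>lborel) = (\<integral>\<^sup>+z. k z \<partial>lborel)" for y
    using nn_integral_lborel_translate[OF k, of "- y"] by simp
  have trans': "(\<integral>\<^sup>+y. k (x - y) \<partial>lborel) = (\<integral>\<^sup>+z. k z \<partial>lborel)" for x
    using trans[of x] even[of "_ - x"] by simp
  have "(\<integral>\<^sup>+p. indicator A (snd p) * k (fst p - snd p) \<partial>(lborel \<Otimes>\<^sub>M lborel))
      = (\<integral>\<^sup>+y. \<integral>\<^sup>+x. indicator A y * k (x - y) \<partial>lborel \<partial>lborel)"
    by (subst lborel_pair.nn_integral_snd[symmetric]) simp_all
  also have "\<dots> = (\<integral>\<^sup>+y. indicator A y * (\<integral>\<^sup>+z. k z \<partial>lborel) \<partial>lborel)"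
    by (simp add: nn_integral_cmult trans)
  also have "\<dots> = emeasure lborel A * (\<integral>\<^sup>+z. k z \<partial>lborel)"
    by (simp add: nn_integral_multc)
  finally show "(\<integral>\<^sup>+p. indicator A (snd p) * k (fst p - snd p) \<partial>lborel) = emeasure lborel A * (\<integral>\<^sup>+z. k z \<partial>lborel)"
    by (simp add: lborel_prod)
  have "(\<integral>\<^sup>+p. indicator A (fst p) * k (fst p - snd p) \<partial>(lborel \<Otimes>\<^sub>M lborel))
      = (\<integral>\<^sup>+x. \<integral>\<^sup>+y. indicator A x * k (x - y) \<partial>lborel \<partial>lborel)"
    by (subst lborel.nn_integral_fst[symmetric]) simp_all
  also have "\<dots> = (\<integral>\<^sup>+x. indicator A x * (\<integral>\<^sup>+z. k z \<partial>lborel) \<partial>lborel)"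
    by (simp add: nn_integral_cmult trans')
  also have "\<dots> = emeasure lborel A * (\<integral>\<^sup>+z. k z \<partial>lborel)"
    by (simp add: nn_integral_multc)
  finally show "(\<integral>\<^sup>+p. indicator A (fst p) * k (fst p - snd p) \<partial>lborel) = emeasure lborel A * (\<integral>\<^sup>+z. k z \<partial>lborel)"
    by (simp add: lborel_prod)
qed

definition clamp_at :: "real \<Rightarrow> real \<Rightarrow> real" where
  "clamp_at b t = max (- b) (min b t)"

text \<open>
  Soft truncation: values of modulus at most \<open>a\<close> become \<open>0\<close>, and those of modulus above \<open>b\<close> are
  replaced by constants. Both this map and its difference from the identity are contractions, so that all quantities below are dominated by
  those of the original function.
\<close>

definition band :: "real \<Rightarrow> real \<Rightarrow> real \<Rightarrow> real" where
  "band a b t = clamp_at b t - clamp_at a t"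

lemma band_facts:
  assumes "0 \<le> a" "a \<le> b"
  shows "\<bar>band a b t - band a b r\<bar> \<le> \<bar>t - r\<bar>"
    and "\<bar>(t - band a b t) - (r - band a b r)\<bar> \<le> \<bar>t - r\<bar>"
    and "\<bar>band a b t\<bar> \<le> b" and "\<bar>t\<bar> \<le> a \<Longrightarrow> band a b t = 0"
    and "\<bar>t\<bar> \<le> b \<Longrightarrow> \<bar>t - band a b t\<bar> \<le> a"
    and "\<bar>band a b t\<bar> \<le> \<bar>t\<bar>" and "\<bar>t - band a b t\<bar> \<le> \<bar>t\<bar>"
  using assms by (auto simp: band_def clamp_at_def max_def min_def abs_if split: if_splits)

definition cutoff :: "real \<Rightarrow> 'a::real_normed_vector \<Rightarrow> real" where
  "cutoff R x = max 0 (min 1 (2 - norm x / R))"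

lemma cutoff_facts:
  assumes "1 \<le> R"
  shows "0 \<le> cutoff R x" "cutoff R x \<le> 1"
    and "\<bar>cutoff R x - cutoff R y\<bar> \<le> min 1 (norm (x - y))"
    and "2 * R \<le> norm x \<Longrightarrow> cutoff R x = 0" and "norm x \<le> R \<Longrightarrow> cutoff R x = 1"
proof -
  have "\<bar>norm x / R - norm y / R\<bar> \<le> \<bar>norm x - norm y\<bar>"
    using assms by (simp add: field_simps abs_mult flip: diff_divide_distrib)
       (metis abs_ge_zero mult.commute mult_left_mono mult_1)
  also have "\<dots> \<le> norm (x - y)"
    by (rule norm_triangle_ineq3)
  finally show "\<bar>cutoff R x - cutoff R y\<bar> \<le> min 1 (norm (x - y))"
    unfolding cutoff_def by (auto simp: max_def min_def abs_if split: if_splits)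
  show "0 \<le> cutoff R x" "cutoff R x \<le> 1"
    by (auto simp: cutoff_def)
  show "2 * R \<le> norm x \<Longrightarrow> cutoff R x = 0" "norm x \<le> R \<Longrightarrow> cutoff R x = 1"
    using assms by (auto simp: cutoff_def field_simps)
qed

lemma cutoff_continuous: "continuous_on UNIV (cutoff R)"
  unfolding cutoff_def by (cases "R = 0") (auto intro!: continuous_intros)

context fractional_orlicz
begin

text \<open>
  The Gagliardo modular of the increments of a bounded Lipschitz function, localized to points of \<open>A\<close>.
  By the growth bounds it is at most the measure of \<open>A\<close> times integrals of the kernel above for the
  exponents \<open>h1\<close> and \<open>h2\<close>. As \<open>H x y\<close> and \<open>H y x\<close> may differ, both coordinates have to be treated.
\<close>

lemma gag_Lipschitz_finite:
  fixes A :: "'a set"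
  assumes A [measurable]: "A \<in> sets borel" and fin: "emeasure lborel A < \<infinity>" and K: "0 < K"
  shows "gag.rho (\<lambda>p. K * indicator A (snd p) * min 1 (norm (fst p - snd p))) < \<infinity>" (is "gag.rho ?F2 < \<infinity>")
    and "gag.rho (\<lambda>p. K * indicator A (fst p) * min 1 (norm (fst p - snd p))) < \<infinity>" (is "gag.rho ?F1 < \<infinity>")
proof -
  obtain b where b: "b > 0" "\<And>x y t. 0 \<le> t \<Longrightarrow> H x y t \<le> b * (t powr h1 + t powr h2)"
    using H_upper_bound by blast
  define \<kappa> where "\<kappa> q z = (min 1 (norm z) / norm z powr s) powr q / norm z ^ DIM('a)" for q and z :: 'a
  define k where "k z = ennreal (b * K powr h1) * ennreal (\<kappa> h1 z) + ennreal (b * K powr h2) * ennreal (\<kappa> h2 z)" for z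
  have \<kappa>_meas [measurable]: "\<kappa> q \<in> borel_measurable borel" for q
    unfolding \<kappa>_def[abs_def] by measurable
  have k_meas: "k \<in> borel_measurable borel"
    unfolding k_def[abs_def] by measurable
  have k_even: "k (- z) = k z" for z
    by (simp add: k_def \<kappa>_def)
  have "(\<integral>\<^sup>+z. k z \<partial>lborel) = ennreal (b * K powr h1) * (\<integral>\<^sup>+z. ennreal (\<kappa> h1 z) \<partial>lborel)
      + ennreal (b * K powr h2) * (\<integral>\<^sup>+z. ennreal (\<kappa> h2 z) \<partial>lborel)"
    unfolding k_def by (subst nn_integral_add) (simp_all add: nn_integral_cmult)
  also have "\<dots> < \<infinity>"
    using nn_integral_Lipschitz_kernel_finite[OF s, of h1, where 'a = 'a]
      nn_integral_Lipschitz_kernel_finite[OF s, of h2, where 'a = 'a] ii_const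
    by (simp add: \<kappa>_def ennreal_add_less_top ennreal_mult_less_top)
  finally have k_fin: "(\<integral>\<^sup>+z. k z \<partial>lborel) < \<infinity>" .
  have bound: "ennreal (gag_Phi p (K * indicator A y * min 1 (norm (fst p - snd p)))) \<le> indicator A y * k (fst p - snd p)"
    for p and y :: 'a
  proof (cases "y \<in> A")
    case True
    let ?r = "norm (fst p - snd p)"
    let ?m = "min 1 ?r / ?r powr s"
    have m: "0 \<le> ?m"
      by simp
    have "H (fst p) (snd p) (K * min 1 ?r / ?r powr s) \<le> b * ((K * ?m) powr h1 + (K * ?m) powr h2)"
      using b(2)[of "K * ?m" "fst p" "snd p"] K by simp
    also have "\<dots> = b * K powr h1 * ?m powr h1 + b * K powr h2 * ?m powr h2"
      by (simp add: powr_mult[of K ?m] algebra_simps del: times_divide_eq_right)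
    finally have "gag_Phi p (K * min 1 ?r) \<le> (b * K powr h1 * ?m powr h1 + b * K powr h2 * ?m powr h2) / ?r ^ DIM('a)"
      unfolding gag_Phi_def by (intro divide_right_mono) auto
    also have "\<dots> = b * K powr h1 * \<kappa> h1 (fst p - snd p) + b * K powr h2 * \<kappa> h2 (fst p - snd p)"
      by (simp add: \<kappa>_def add_divide_distrib)
    finally have "ennreal (gag_Phi p (K * min 1 ?r))
        \<le> ennreal (b * K powr h1 * \<kappa> h1 (fst p - snd p) + b * K powr h2 * \<kappa> h2 (fst p - snd p))"
      by (rule ennreal_leI)
    also have "\<dots> = k (fst p - snd p)"
    proof -
      have "0 \<le> \<kappa> q z" for q z
        by (simp add: \<kappa>_def)
      then show ?thesis
        using b(1) by (simp add: k_def ennreal_mult)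
    qed
    finally show ?thesis
      using True by simp
  qed (simp add: gag_Phi_zero)
  have "gag.rho ?F2 \<le> (\<integral>\<^sup>+p. indicator A (snd p) * k (fst p - snd p) \<partial>lborel)"
    unfolding gag.rho_def nn_integral_completion by (intro nn_integral_mono bound)
  also have "\<dots> < \<infinity>"
    using nn_integral_convolution_kernel(1)[OF k_meas k_even A] fin k_fin by (simp add: ennreal_mult_less_top)
  finally show "gag.rho ?F2 < \<infinity>" .
  have "gag.rho ?F1 \<le> (\<integral>\<^sup>+p. indicator A (fst p) * k (fst p - snd p) \<partial>lborel)"
    unfolding gag.rho_def nn_integral_completion by (intro nn_integral_mono bound)
  also have "\<dots> < \<infinity>"
    using nn_integral_convolution_kernel(2)[OF k_meas k_even A] fin k_fin by (simp add: ennreal_mult_less_top)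
  finally show "gag.rho ?F1 < \<infinity>" .
qed

lemma Lipschitz_kernel_measurable:
  fixes A :: "'a set"
  assumes [measurable]: "A \<in> sets borel"
  shows "(\<lambda>p. K * indicator A (snd p) * min 1 (norm (fst p - snd p))) \<in> borel_measurable lebesgue"
    and "(\<lambda>p. K * indicator A (fst p) * min 1 (norm (fst p - snd p))) \<in> borel_measurable lebesgue"
proof -
  have [measurable]: "(\<lambda>p::'a \<times> 'a. norm (fst p - snd p)) \<in> borel_measurable borel"
    by (intro borel_measurable_continuous_onI continuous_intros)
  note [measurable] = borel_measurable_fst_snd
  show "(\<lambda>p. K * indicator A (snd p) * min 1 (norm (fst p - snd p))) \<in> borel_measurable lebesgue"
    "(\<lambda>p. K * indicator A (fst p) * min 1 (norm (fst p - snd p))) \<in> borel_measurable lebesgue"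
    by (intro measurable_completion; simp; measurable)+
qed

lemma star_rho_bounded_support:
  fixes E :: "'a \<Rightarrow> real"
  assumes "\<And>x. \<bar>E x\<bar> \<le> K" and "\<And>x. x \<notin> A \<Longrightarrow> E x = 0" and A: "A \<in> sets borel" "emeasure lborel A < \<infinity>"
  shows "star.rho E < \<infinity>"
proof -
  have K: "0 \<le> K"
    using assms(1)[of 0] by linarith
  have "star.rho E \<le> (\<integral>\<^sup>+x. ennreal (H_star H s 0 K) * indicator A x \<partial>lborel)"
    unfolding star.rho_def nn_integral_completion
  proof (rule nn_integral_mono)
    fix x
    show "ennreal (H_star H s x (E x)) \<le> ennreal (H_star H s 0 K) * indicator A x"
    proof (cases "x \<in> A")
      case True
      have "H_star H s x (E x) \<le> H_star H s x K"
        using assms(1)[of x] K by (intro star.Phi_mono_abs) simp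
      then show ?thesis
        using True by (simp add: H_star_eq ennreal_leI)
    qed (simp add: assms(2) star.Phi_zero)
  qed
  also have "\<dots> < \<infinity>"
    using A by (simp add: nn_integral_cmult_indicator ennreal_mult_less_top)
  finally show ?thesis .
qed

lemma superlevel_set_finite_measure:
  fixes u :: "'a \<Rightarrow> real"
  assumes u: "u \<in> borel_measurable borel" and fin: "star.rho u < \<infinity>" and a: "a > 0"
  shows "emeasure lborel {x. a < \<bar>u x\<bar>} < \<infinity>"
proof -
  have c: "H_star H s 0 a > 0"
    using a by (intro H_star_pos) auto
  have "ennreal (H_star H s 0 a) * emeasure lborel {x. a < \<bar>u x\<bar>}
      = (\<integral>\<^sup>+x. ennreal (H_star H s 0 a) * indicator {x. a < \<bar>u x\<bar>} x \<partial>lborel)"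
    using u by (intro nn_integral_cmult_indicator[symmetric]) simp
  also have "\<dots> \<le> star.rho u"
    unfolding star.rho_def nn_integral_completion
  proof (rule nn_integral_mono)
    fix x
    show "ennreal (H_star H s 0 a) * indicator {x. a < \<bar>u x\<bar>} x \<le> ennreal (H_star H s x (u x))"
      using star.Phi_mono_abs[of a "u x" x] a by (auto simp: indicator_def H_star_eq intro!: ennreal_leI)
  qed
  finally have "ennreal (H_star H s 0 a) * emeasure lborel {x. a < \<bar>u x\<bar>} < \<infinity>"
    using fin by (rule le_less_trans)
  then show ?thesis
    using c by (auto simp: ennreal_mult_less_top less_top ennreal_mult_eq_top_iff)
qed

definition bounded_finite_support :: "('a \<Rightarrow> real) set" where
  "bounded_finite_support = {v \<in> borel_measurable borel. energy v < \<infinity> \<and> (\<exists>K. \<forall>x. \<bar>v x\<bar> \<le> K)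
     \<and> emeasure lborel {x. v x \<noteq> 0} < \<infinity>}"

definition bounded_bounded_support :: "('a \<Rightarrow> real) set" where
  "bounded_bounded_support = {v \<in> borel_measurable borel. energy v < \<infinity> \<and> (\<exists>K. \<forall>x. \<bar>v x\<bar> \<le> K)
     \<and> (\<exists>r. \<forall>x. r \<le> norm x \<longrightarrow> v x = 0)}"

lemma borel_imp_lebesgue: "u \<in> borel_measurable borel \<Longrightarrow> u \<in> borel_measurable lebesgue"
  by (rule measurable_completion) simp

text \<open>
  Truncating the values, with dominated convergence in both modulars. The truncation vanishes where
  \<open>\<bar>u\<bar>\<close> is small, and the rest has finite measure by Chebyshev's inequality.
\<close>

lemma approximable_truncation:
  fixes u :: "'a \<Rightarrow> real"
  assumes u: "u \<in> borel_measurable borel" and fin: "energy u < \<infinity>"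
  shows "approximable bounded_finite_support u"
proof (rule approximableI_tendsto)
  define T where "T n t = band (1 / real (Suc n)) (real (Suc n)) t" for n t
  have *: "0 \<le> 1 / real (Suc n)" "1 / real (Suc n) \<le> real (Suc n)" for n
    by (auto simp: field_simps)
  note T = band_facts[OF *, folded T_def]
  have T_meas: "(\<lambda>x. T n (u x)) \<in> borel_measurable borel" for n
    unfolding T_def band_def clamp_at_def using u by measurable
  have finG: "gag.rho (difference u) < \<infinity>" and finS: "star.rho u < \<infinity>"
    using fin unfolding energy_finite_iff by blast+
  show "(\<lambda>x. T n (u x)) \<in> bounded_finite_support" for n
  proof -
    have "gag.rho (difference (\<lambda>x. T n (u x))) < \<infinity>"
      by (rule le_less_trans[OF gag.rho_mono finG]) (simp add: difference_def T(1))
    moreover have "star.rho (\<lambda>x. T n (u x)) < \<infinity>"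
      by (rule le_less_trans[OF star.rho_mono finS]) (rule T(6))
    ultimately have "energy (\<lambda>x. T n (u x)) < \<infinity>"
      unfolding energy_finite_iff by blast
    moreover have "emeasure lborel {x. T n (u x) \<noteq> 0} \<le> emeasure lborel {x. 1 / real (Suc n) < \<bar>u x\<bar>}"
      using u T(4)[of _ n] by (intro emeasure_mono) (auto simp: not_less[symmetric])
    then have "emeasure lborel {x. T n (u x) \<noteq> 0} < \<infinity>"
      using superlevel_set_finite_measure[OF u finS, of "1 / real (Suc n)"] by (auto intro: le_less_trans)
    ultimately show ?thesis
      using T_meas T(3) unfolding bounded_finite_support_def by blast
  qed
  show "(\<lambda>n. energy (\<lambda>x. c * (u x - T n (u x)))) \<longlonglongrightarrow> 0" for c
  proof (rule energy_dominated_convergence[where D = "difference u" and E = u])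
    show "(\<lambda>x. u x - T n (u x)) \<in> borel_measurable lebesgue" for n
      using u T_meas by (intro borel_imp_lebesgue) simp
    show "AE x in lebesgue. (\<lambda>n. u x - T n (u x)) \<longlonglongrightarrow> 0"
    proof (rule AE_I2)
      fix x :: 'a
      obtain m where m: "\<bar>u x\<bar> \<le> real m"
        using real_arch_simple by blast
      show "(\<lambda>n. u x - T n (u x)) \<longlonglongrightarrow> 0"
      proof (rule Lim_null_comparison)
        show "\<forall>\<^sub>F n in sequentially. norm (u x - T n (u x)) \<le> 1 / real (Suc n)"
          using eventually_ge_at_top[of m]
        proof eventually_elim
          case (elim n)
          then have "\<bar>u x\<bar> \<le> real (Suc n)"
            using m by linarith
          then show ?case
            using T(5) by (simp only: real_norm_def)
        qed
        show "(\<lambda>n. 1 / real (Suc n)) \<longlonglongrightarrow> 0"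
          using LIMSEQ_Suc[OF lim_const_over_n] by auto
      qed
    qed
    show "AE p in lebesgue. \<bar>difference (\<lambda>x. u x - T n (u x)) p\<bar> \<le> \<bar>difference u p\<bar>" for n
      by (rule AE_I2) (simp add: difference_def T(2))
    show "AE x in lebesgue. \<bar>u x - T n (u x)\<bar> \<le> \<bar>u x\<bar>" for n
      by (rule AE_I2) (rule T(7))
  qed (use u finG finS in \<open>auto intro: difference_measurable borel_imp_lebesgue\<close>)
qed

text \<open>
  Multiplication by a Lipschitz cutoff. The error is dominated by the increments of \<open>v\<close> and by
  those of the cutoff weighted with \<open>v\<close>. The latter form an integrable majorant because \<open>v\<close> is
  bounded with support of finite measure; this is the reason for truncating the values first.
\<close>

lemma approximable_cutoff:
  fixes v :: "'a \<Rightarrow> real"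
  assumes "v \<in> bounded_finite_support"
  shows "approximable bounded_bounded_support v"
proof (rule approximableI_tendsto)
  have v [measurable]: "v \<in> borel_measurable borel"
    and finG: "gag.rho (difference v) < \<infinity>" and finS: "star.rho v < \<infinity>"
    and supp: "emeasure lborel {x. v x \<noteq> 0} < \<infinity>"
    using assms unfolding bounded_finite_support_def energy_finite_iff by blast+
  obtain K0 where K0: "\<And>x. \<bar>v x\<bar> \<le> K0"
    using assms unfolding bounded_finite_support_def by blast
  define K where "K = K0 + 1"
  have K: "\<bar>v x\<bar> \<le> K" "K > 0" for x :: 'a
    using K0[of x] by (auto simp: K_def)
  define A where "A = {x. v x \<noteq> 0}"
  have A: "A \<in> sets borel" "emeasure lborel A < \<infinity>"
    using supp v by (auto simp: A_def)
  define L where "L p = K * indicator A (snd p) * min 1 (norm (fst p - snd p))" for p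
  define D where "D p = \<bar>difference v p\<bar> + L p" for p
  have L: "L \<in> borel_measurable lebesgue" "gag.rho L < \<infinity>"
    unfolding L_def[abs_def] using Lipschitz_kernel_measurable(1)[OF A(1)] gag_Lipschitz_finite(1)[OF A K(2)] by auto
  have dv: "difference v \<in> borel_measurable lebesgue"
    by (intro difference_measurable borel_imp_lebesgue v)
  have D: "D \<in> borel_measurable lebesgue" "gag.rho D < \<infinity>"
  proof -
    have "gag.rho (\<lambda>p. \<bar>difference v p\<bar>) < \<infinity>"
      using finG by (simp add: gag.rho_def gag.Phi_abs)
    then show "gag.rho D < \<infinity>"
      unfolding D_def[abs_def] using dv L by (intro gag.rho_finite_add) auto
    show "D \<in> borel_measurable lebesgue"
      unfolding D_def[abs_def] using dv L by measurable
  qed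
  have dom: "\<bar>difference (\<lambda>x. v x * \<zeta> x) p\<bar> \<le> \<bar>D p\<bar>"
    if \<zeta>: "\<And>x. 0 \<le> \<zeta> x" "\<And>x. \<zeta> x \<le> 1" "\<And>x y. \<bar>\<zeta> x - \<zeta> y\<bar> \<le> min 1 (norm (x - y))" for \<zeta> :: "'a \<Rightarrow> real" and p
  proof -
    have "\<bar>difference (\<lambda>x. v x * \<zeta> x) p\<bar>
        = \<bar>difference v p * \<zeta> (fst p) + v (snd p) * (\<zeta> (fst p) - \<zeta> (snd p))\<bar>"
      by (simp add: difference_def algebra_simps)
    also have "\<dots> \<le> \<bar>difference v p\<bar> * \<zeta> (fst p) + \<bar>v (snd p)\<bar> * \<bar>\<zeta> (fst p) - \<zeta> (snd p)\<bar>"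
      using \<zeta>(1)[of "fst p"] by (intro order_trans[OF abs_triangle_ineq]) (simp add: abs_mult)
    also have "\<dots> \<le> \<bar>difference v p\<bar> * 1 + L p"
    proof (intro add_mono mult_left_mono)
      show "\<bar>v (snd p)\<bar> * \<bar>\<zeta> (fst p) - \<zeta> (snd p)\<bar> \<le> L p"
      proof (cases "snd p \<in> A")
        case True
        then show ?thesis
          unfolding L_def using K(1)[of "snd p"] \<zeta>(3)[of "fst p" "snd p"]
          by (simp only: indicator_simps mult_1_right) (intro mult_mono, auto)
      qed (simp add: A_def L_def)
    qed (use \<zeta> in auto)
    finally show ?thesis
      by (simp add: D_def)
  qed
  define \<eta> where "\<eta> n = (cutoff (real (Suc n)) :: 'a \<Rightarrow> real)" for n
  have R: "1 \<le> real (Suc n)" for n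
    by simp
  note \<eta> = cutoff_facts[OF R, where 'a = 'a, folded \<eta>_def]
  have \<eta>_meas [measurable]: "\<eta> n \<in> borel_measurable borel" for n
    unfolding \<eta>_def by (intro borel_measurable_continuous_onI cutoff_continuous)
  have v\<eta>: "\<bar>v x * \<eta> n x\<bar> \<le> \<bar>v x\<bar>" for n x
    using \<eta>(1,2)[of n x] by (simp add: abs_mult mult_left_le)
  show "(\<lambda>x. v x * \<eta> n x) \<in> bounded_bounded_support" for n
  proof -
    have "gag.rho (difference (\<lambda>x. v x * \<eta> n x)) < \<infinity>"
      by (rule le_less_trans[OF gag.rho_mono D(2)]) (intro dom \<eta>(1,2,3))
    moreover have "star.rho (\<lambda>x. v x * \<eta> n x) < \<infinity>"
      by (rule le_less_trans[OF star.rho_mono finS]) (rule v\<eta>)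
    ultimately have "energy (\<lambda>x. v x * \<eta> n x) < \<infinity>"
      unfolding energy_finite_iff by blast
    moreover have "\<forall>x. \<bar>v x * \<eta> n x\<bar> \<le> K"
      using v\<eta> K(1) order_trans by blast
    moreover have "\<forall>x. 2 * real (Suc n) \<le> norm x \<longrightarrow> v x * \<eta> n x = 0"
      using \<eta>(4) by simp
    moreover have "(\<lambda>x. v x * \<eta> n x) \<in> borel_measurable borel"
      by measurable
    ultimately show ?thesis
      unfolding bounded_bounded_support_def by blast
  qed
  have eq: "v x - v x * \<eta> n x = v x * (1 - \<eta> n x)" for n x
    by (simp add: algebra_simps)
  show "(\<lambda>n. energy (\<lambda>x. c * (v x - v x * \<eta> n x))) \<longlonglongrightarrow> 0" for c
    unfolding eq
  proof (rule energy_dominated_convergence[where D = D and E = v])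
    show "(\<lambda>x. v x * (1 - \<eta> n x)) \<in> borel_measurable lebesgue" for n
      by (intro borel_imp_lebesgue) measurable
    show "AE x in lebesgue. (\<lambda>n. v x * (1 - \<eta> n x)) \<longlonglongrightarrow> 0"
    proof (rule AE_I2)
      fix x :: 'a
      obtain m where m: "norm x \<le> real m"
        using real_arch_simple by blast
      have "\<forall>\<^sub>F n in sequentially. 0 = v x * (1 - \<eta> n x)"
        using eventually_ge_at_top[of m] by eventually_elim (use m in \<open>simp add: \<eta>(5)\<close>)
      then show "(\<lambda>n. v x * (1 - \<eta> n x)) \<longlonglongrightarrow> 0"
        by (rule Lim_transform_eventually[OF tendsto_const])
    qed
    show "AE p in lebesgue. \<bar>difference (\<lambda>x. v x * (1 - \<eta> n x)) p\<bar> \<le> \<bar>D p\<bar>" for n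
    proof (intro AE_I2 dom)
      show "\<bar>(1 - \<eta> n x) - (1 - \<eta> n y)\<bar> \<le> min 1 (norm (x - y))" for x y
        using \<eta>(3)[of n x y] by (simp add: abs_minus_commute)
    qed (use \<eta>(1,2) in auto)
    show "AE x in lebesgue. \<bar>v x * (1 - \<eta> n x)\<bar> \<le> \<bar>v x\<bar>" for n
      by (rule AE_I2) (use \<eta>(1,2) in \<open>simp add: abs_mult mult_left_le\<close>)
  qed (use D finS v in \<open>auto intro: borel_imp_lebesgue\<close>)
qed

text \<open>
  A test function is bounded and Lipschitz, and its increments vanish unless one of the two points lies
  in its support.
\<close>

lemma Cc_inf_energy_finite:
  fixes \<phi> :: "'a \<Rightarrow> real"
  assumes "\<phi> \<in> Cc_inf"
  shows "energy \<phi> < \<infinity>"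
proof -
  obtain B where B: "B > 0" "\<And>x. \<bar>\<phi> x\<bar> \<le> B"
    using Cc_inf_bounded[OF assms] by blast
  obtain L where L: "L > 0" "\<And>x y. \<bar>\<phi> x - \<phi> y\<bar> \<le> L * norm (x - y)"
    using Cc_inf_Lipschitz[OF assms] by blast
  obtain r where r: "\<And>x. r \<le> norm x \<Longrightarrow> \<phi> x = 0"
    using assms unfolding Cc_inf_iff by blast
  define A :: "'a set" where "A = cball 0 r"
  define K where "K = max (2 * B) L"
  have K: "K > 0"
    using B by (simp add: K_def)
  have A: "A \<in> sets borel" "emeasure lborel A < \<infinity>"
    using emeasure_lborel_cball_finite by (auto simp: A_def)
  have out: "\<phi> x = 0" if "x \<notin> A" for x
    using that r by (simp add: A_def)
  let ?F1 = "\<lambda>p::'a \<times> 'a. K * indicator A (fst p) * min 1 (norm (fst p - snd p))"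
  let ?F2 = "\<lambda>p::'a \<times> 'a. K * indicator A (snd p) * min 1 (norm (fst p - snd p))"
  have "\<bar>difference \<phi> p\<bar> \<le> \<bar>?F1 p + ?F2 p\<bar>" for p
  proof (cases "fst p \<in> A \<or> snd p \<in> A")
    case True
    have "\<bar>difference \<phi> p\<bar> \<le> K * 1"
      using B(2)[of "fst p"] B(2)[of "snd p"] unfolding difference_def K_def by linarith
    moreover have "\<bar>difference \<phi> p\<bar> \<le> K * norm (fst p - snd p)"
      using L(2)[of "fst p" "snd p"] mult_right_mono[of L K "norm (fst p - snd p)"]
      unfolding difference_def K_def by simp
    ultimately have le: "\<bar>difference \<phi> p\<bar> \<le> K * min 1 (norm (fst p - snd p))"
      by (simp add: min_def)
    have nn: "0 \<le> K * min 1 (norm (fst p - snd p))"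
      using K by simp
    show ?thesis
      using True
    proof
      assume "fst p \<in> A"
      then show ?thesis
        using le nn by (cases "snd p \<in> A") auto
    next
      assume "snd p \<in> A"
      then show ?thesis
        using le nn by (cases "fst p \<in> A") auto
    qed
  qed (simp add: difference_def out)
  then have "gag.rho (difference \<phi>) \<le> gag.rho (\<lambda>p. ?F1 p + ?F2 p)"
    by (rule gag.rho_mono)
  also have "\<dots> < \<infinity>"
    by (intro gag.rho_finite_add Lipschitz_kernel_measurable gag_Lipschitz_finite A K)
  finally have "gag.rho (difference \<phi>) < \<infinity>" .
  moreover have "star.rho \<phi> < \<infinity>"
    by (rule star_rho_bounded_support[OF B(2) out A])
  ultimately show ?thesis
    unfolding energy_finite_iff by blast
qed

end

section \<open>Mollification\<close>

definition convolve :: "('a::euclidean_space \<Rightarrow> real) \<Rightarrow> ('a \<Rightarrow> real) \<Rightarrow> 'a \<Rightarrow> real" where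
  "convolve \<phi> v x = (\<integral>y. \<phi> (x - y) * v y \<partial>lborel)"

lemma lborel_distr_reflect: "distr lborel borel (\<lambda>w. x - w) = (lborel :: 'a::euclidean_space measure)"
  by (subst (2) lborel_affine[of "-1" x]) (simp_all add: density_1)

lemma convolve_integrable:
  fixes \<phi> v :: "'a::euclidean_space \<Rightarrow> real"
  assumes \<phi>: "\<phi> \<in> Cc_inf" and v: "v \<in> borel_measurable borel" "\<And>x. \<bar>v x\<bar> \<le> K" "\<And>x. r \<le> norm x \<Longrightarrow> v x = 0"
  shows "integrable lborel (\<lambda>y. \<phi> (x - y) * v y)"
proof -
  obtain B where B: "B > 0" "\<And>x. \<bar>\<phi> x\<bar> \<le> B"
    using Cc_inf_bounded[OF \<phi>] by blast
  note [measurable] = Cc_inf_borel[OF \<phi>] v(1)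
  have "(\<lambda>y. \<phi> (x - y) * v y) \<in> borel_measurable borel"
    by measurable
  moreover have "\<bar>\<phi> (x - y) * v y\<bar> \<le> B * K" for y
    using B v(2)[of y] by (simp add: abs_mult mult_mono)
  ultimately show ?thesis
    by (rule compact_support_integrable[where r = r]) (simp add: v(3))
qed

text \<open>
  The derivative falls on the smooth factor; the uniform Taylor expansion replaces differentiation under
  the integral sign.
\<close>

lemma convolve_has_derivative:
  fixes \<phi> v :: "'a::euclidean_space \<Rightarrow> real"
  assumes \<phi>: "\<phi> \<in> Cc_inf"
    and D: "\<And>x. (\<phi> has_derivative D x) (at x)" "\<And>w. (\<lambda>x. D x w) \<in> Cc_inf"
    and v: "v \<in> borel_measurable borel" "\<And>x. \<bar>v x\<bar> \<le> K" "\<And>x. r \<le> norm x \<Longrightarrow> v x = 0"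
  shows "(convolve \<phi> v has_derivative (\<lambda>w. convolve (\<lambda>x. D x w) v x)) (at x)"
  unfolding has_derivative_at_alt
proof (intro conjI allI impI)
  have int: "integrable lborel (\<lambda>y. D (x - y) w * v y)" for w
    by (rule convolve_integrable[OF D(2) v])
  have lin: "linear (D y)" for y
    using D(1) has_derivative_linear by blast
  have "linear (\<lambda>w. convolve (\<lambda>x. D x w) v x)"
    unfolding convolve_def
    by (rule linearI) (simp_all add: linear_add[OF lin] linear_scale[OF lin] distrib_right mult.assoc int)
  then show "bounded_linear (\<lambda>w. convolve (\<lambda>x. D x w) v x)"
    by (simp add: linear_conv_bounded_linear)
  fix e :: real
  assume e: "e > 0"
  have v_int: "integrable lborel v"
    using v by (rule compact_support_integrable)
  define I where "I = (\<integral>y. \<bar>v y\<bar> \<partial>lborel)"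
  have I: "0 \<le> I"
    unfolding I_def by (intro integral_nonneg_AE) auto
  obtain d where d: "d > 0" "\<And>x w. norm w < d \<Longrightarrow> \<bar>\<phi> (x + w) - \<phi> x - D x w\<bar> \<le> (e / (I + 1)) * norm w"
    using Cc_inf_uniform_Taylor[OF D, of "e / (I + 1)"] e I by auto
  show "\<exists>d>0. \<forall>y. norm (y - x) < d \<longrightarrow>
      norm (convolve \<phi> v y - convolve \<phi> v x - convolve (\<lambda>z. D z (y - x)) v x) \<le> e * norm (y - x)"
  proof (rule exI[of _ d], rule conjI[OF d(1)], rule allI, rule impI)
    fix x' assume x': "norm (x' - x) < d"
    let ?w = "x' - x"
    have "convolve \<phi> v x' - convolve \<phi> v x - convolve (\<lambda>x. D x ?w) v x
        = (\<integral>y. \<phi> (x' - y) * v y - \<phi> (x - y) * v y - D (x - y) ?w * v y \<partial>lborel)"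
      unfolding convolve_def using convolve_integrable[OF \<phi> v] int by simp
    also have "norm \<dots> \<le> (\<integral>y. (e / (I + 1) * norm ?w) * \<bar>v y\<bar> \<partial>lborel)"
    proof (rule Bochner_Integration.integral_norm_bound_integral)
      show "integrable lborel (\<lambda>y. \<phi> (x' - y) * v y - \<phi> (x - y) * v y - D (x - y) ?w * v y)"
        using convolve_integrable[OF \<phi> v] int by auto
      show "integrable lborel (\<lambda>y. (e / (I + 1) * norm ?w) * \<bar>v y\<bar>)"
        using v_int by (intro integrable_mult_right integrable_abs)
      fix y
      have "\<bar>\<phi> (x' - y) - \<phi> (x - y) - D (x - y) ?w\<bar> \<le> (e / (I + 1)) * norm ?w"
        using d(2)[OF x', of "x - y"] by (simp add: algebra_simps)
      then have "\<bar>\<phi> (x' - y) - \<phi> (x - y) - D (x - y) ?w\<bar> * \<bar>v y\<bar> \<le> (e / (I + 1) * norm ?w) * \<bar>v y\<bar>"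
        by (rule mult_right_mono) simp
      then show "norm (\<phi> (x' - y) * v y - \<phi> (x - y) * v y - D (x - y) ?w * v y) \<le> (e / (I + 1) * norm ?w) * \<bar>v y\<bar>"
        by (simp add: abs_mult[symmetric] left_diff_distrib)
    qed
    also have "\<dots> = (e / (I + 1) * norm ?w) * I"
      unfolding I_def by (rule integral_mult_right_zero)
    also have "\<dots> = (e * norm ?w) * (I / (I + 1))"
      by simp
    also have "\<dots> \<le> (e * norm ?w) * 1"
      using e I by (intro mult_left_mono) auto
    finally show "norm (convolve \<phi> v x' - convolve \<phi> v x - convolve (\<lambda>x. D x ?w) v x) \<le> e * norm ?w"
      by simp
  qed
qed

lemma C_k_convolve:
  fixes \<phi> v :: "'a::euclidean_space \<Rightarrow> real"
  assumes v: "v \<in> borel_measurable borel" "\<And>x. \<bar>v x\<bar> \<le> K" "\<And>x. r \<le> norm x \<Longrightarrow> v x = 0"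
  shows "\<phi> \<in> Cc_inf \<Longrightarrow> C_k k (convolve \<phi> v)"
proof (induction k arbitrary: \<phi>)
  case 0
  obtain D where "\<And>x. (\<phi> has_derivative D x) (at x)" "\<And>w. (\<lambda>x. D x w) \<in> Cc_inf"
    using Cc_inf_derivative[OF 0] by blast
  then have "(convolve \<phi> v has_derivative (\<lambda>w. convolve (\<lambda>x. D x w) v x)) (at x)" for x
    using convolve_has_derivative[OF 0 _ _ v] by blast
  then have "isCont (convolve \<phi> v) x" for x
    by (rule has_derivative_continuous)
  then show ?case
    by (simp add: continuous_on_eq_continuous_at)
next
  case (Suc k)
  obtain D where D: "\<And>x. (\<phi> has_derivative D x) (at x)" "\<And>w. (\<lambda>x. D x w) \<in> Cc_inf"
    using Cc_inf_derivative[OF Suc.prems] by blast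
  have "(convolve \<phi> v has_derivative (\<lambda>w. convolve (\<lambda>x. D x w) v x)) (at x)" for x
    using convolve_has_derivative[OF Suc.prems D v] by blast
  then show ?case
    by (rule C_k_SucI) (rule Suc.IH[OF D(2)])
qed

lemma convolve_support:
  assumes "\<And>x. \<rho> \<le> norm x \<Longrightarrow> \<phi> x = 0" "\<And>x. r \<le> norm x \<Longrightarrow> v x = 0" and "r + \<rho> \<le> norm x"
  shows "convolve \<phi> v x = 0"
proof -
  have "\<phi> (x - y) * v y = 0" for y
  proof (cases "r \<le> norm y")
    case False
    have "norm x \<le> norm (x - y) + norm y"
      using norm_triangle_sub[of x y] by linarith
    then have "\<rho> \<le> norm (x - y)"
      using assms(3) False by linarith
    then show ?thesis
      using assms(1) by simp
  qed (simp add: assms(2))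
  then have "(\<lambda>y. \<phi> (x - y) * v y) = (\<lambda>y. 0)"
    by blast
  then show ?thesis
    by (simp only: convolve_def) simp
qed

lemma convolve_Cc_inf:
  fixes \<phi> v :: "'a::euclidean_space \<Rightarrow> real"
  assumes \<phi>: "\<phi> \<in> Cc_inf" and v: "v \<in> borel_measurable borel" "\<And>x. \<bar>v x\<bar> \<le> K" "\<And>x. r \<le> norm x \<Longrightarrow> v x = 0"
  shows "convolve \<phi> v \<in> Cc_inf"
proof -
  obtain \<rho> where "\<And>x. \<rho> \<le> norm x \<Longrightarrow> \<phi> x = 0"
    using \<phi> unfolding Cc_inf_iff by blast
  then have "convolve \<phi> v x = 0" if "r + \<rho> \<le> norm x" for x
    using convolve_support v(3) that by blast
  with C_k_convolve[OF v \<phi>] show ?thesis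
    by (rule Cc_infI)
qed

lemma convolve_commute:
  fixes \<phi> v :: "'a::euclidean_space \<Rightarrow> real"
  assumes [measurable]: "\<phi> \<in> borel_measurable borel" "v \<in> borel_measurable borel"
  shows "convolve \<phi> v x = (\<integral>w. \<phi> w * v (x - w) \<partial>lborel)"
proof -
  have "convolve \<phi> v x = (\<integral>y. \<phi> (x - y) * v y \<partial>distr lborel borel (\<lambda>w. x - w))"
    by (simp add: convolve_def lborel_distr_reflect)
  also have "\<dots> = (\<integral>w. \<phi> (x - (x - w)) * v (x - w) \<partial>lborel)"
    by (rule integral_distr) measurable
  finally show ?thesis
    by simp
qed

definition mollifier :: "real \<Rightarrow> ('a::euclidean_space \<Rightarrow> real) \<Rightarrow> bool" where
  "mollifier \<delta> \<phi> \<longleftrightarrow> \<phi> \<in> Cc_inf \<and> (\<forall>x. 0 \<le> \<phi> x) \<and> (\<forall>x. \<delta> \<le> norm x \<longrightarrow> \<phi> x = 0)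
     \<and> (\<integral>x. \<phi> x \<partial>lborel) = 1"

lemma mollifierD:
  assumes "mollifier \<delta> \<phi>"
  shows "\<phi> \<in> Cc_inf" "0 \<le> \<phi> x" "\<delta> \<le> norm x \<Longrightarrow> \<phi> x = 0" "(\<integral>x. \<phi> x \<partial>lborel) = 1"
    "\<phi> \<in> borel_measurable borel" "integrable lborel \<phi>" "(\<integral>\<^sup>+x. ennreal (\<phi> x) \<partial>lborel) = 1"
proof -
  show *: "\<phi> \<in> Cc_inf" "0 \<le> \<phi> x" "\<delta> \<le> norm x \<Longrightarrow> \<phi> x = 0" "(\<integral>x. \<phi> x \<partial>lborel) = 1" for x
    using assms by (auto simp: mollifier_def)
  show "\<phi> \<in> borel_measurable borel" "integrable lborel \<phi>"
    using *(1) by (rule Cc_inf_borel Cc_inf_integrable)+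
  then show "(\<integral>\<^sup>+x. ennreal (\<phi> x) \<partial>lborel) = 1"
    using *(2,4) by (simp add: nn_integral_eq_integral)
qed

lemma Jensen_mollifier:
  fixes X :: "'a::euclidean_space \<Rightarrow> real"
  assumes \<phi>: "mollifier \<delta> \<phi>" and X: "X \<in> borel_measurable borel" "\<And>w. \<bar>X w\<bar> \<le> K"
    and q: "convex_on UNIV q" "continuous_on UNIV q" "\<And>t. 0 \<le> q t"
  shows "ennreal (q (\<integral>w. \<phi> w * X w \<partial>lborel)) \<le> (\<integral>\<^sup>+w. ennreal (\<phi> w) * ennreal (q (X w)) \<partial>lborel)"
proof -
  define M where "M = density lborel (\<lambda>w. ennreal (\<phi> w))"
  note [measurable] = mollifierD(5)[OF \<phi>] X(1) borel_measurable_continuous_onI[OF q(2)]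
  interpret prob_space M
    by (rule prob_spaceI) (simp add: M_def emeasure_density mollifierD(7)[OF \<phi>])
  have "compact (q ` {- K..K})"
    by (rule compact_continuous_image[OF continuous_on_subset[OF q(2)]]) auto
  then have "bounded (q ` {- K..K})"
    by (rule compact_imp_bounded)
  then obtain B where B: "\<And>t. t \<in> {- K..K} \<Longrightarrow> norm (q t) \<le> B"
    unfolding bounded_iff by blast
  have meas: "X \<in> borel_measurable M" "(\<lambda>w. q (X w)) \<in> borel_measurable M"
    by (simp_all add: M_def)
  have X_int: "integrable M X"
    by (rule integrable_const_bound[where B = K]) (use X meas in auto)
  have qX_int: "integrable M (\<lambda>w. q (X w))"
  proof (rule integrable_const_bound[where B = B])
    show "AE w in M. norm (q (X w)) \<le> B"
      using X(2) by (intro AE_I2 B) (auto simp: abs_le_iff minus_le_iff)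
  qed (use meas in auto)
  have "q (expectation X) \<le> expectation (\<lambda>w. q (X w))"
    using X_int _ _ qX_int q(1) by (rule jensens_inequality[where I = UNIV]) auto
  moreover have "expectation X = (\<integral>w. \<phi> w * X w \<partial>lborel)"
    unfolding M_def using mollifierD(2)[OF \<phi>] by (subst integral_density) auto
  ultimately have "ennreal (q (\<integral>w. \<phi> w * X w \<partial>lborel)) \<le> ennreal (expectation (\<lambda>w. q (X w)))"
    by (simp add: ennreal_leI)
  also have "\<dots> = (\<integral>\<^sup>+w. ennreal (q (X w)) \<partial>M)"
    using qX_int q(3) by (simp add: nn_integral_eq_integral)
  also have "\<dots> = (\<integral>\<^sup>+w. ennreal (\<phi> w) * ennreal (q (X w)) \<partial>lborel)"
    unfolding M_def by (subst nn_integral_density) auto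
  finally show ?thesis .
qed

lemma mollifier_times_bounded:
  fixes v :: "'a::euclidean_space \<Rightarrow> real"
  assumes \<phi>: "mollifier \<delta> \<phi>" and v: "v \<in> borel_measurable borel" "\<And>x. \<bar>v x\<bar> \<le> K"
  shows "norm (\<phi> w * v (x - w)) \<le> K * \<phi> w" "integrable lborel (\<lambda>w. \<phi> w * v (x - w))"
proof -
  note [measurable] = mollifierD(5)[OF \<phi>] v(1)
  show bound: "norm (\<phi> w * v (x - w)) \<le> K * \<phi> w" for w
    using mult_right_mono[OF v(2)[of "x - w"] mollifierD(2)[OF \<phi>, of w]] mollifierD(2)[OF \<phi>, of w]
    by (simp add: abs_mult mult.commute)
  show "integrable lborel (\<lambda>w. \<phi> w * v (x - w))"
  proof (rule Bochner_Integration.integrable_bound)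
    show "integrable lborel (\<lambda>w. K * \<phi> w)"
      by (rule integrable_mult_right[OF mollifierD(6)[OF \<phi>]])
    show "AE w in lborel. norm (\<phi> w * v (x - w)) \<le> norm (K * \<phi> w)"
      using bound by (intro AE_I2) (auto intro: order_trans[OF _ abs_ge_self])
  qed measurable
qed

lemma convolve_bounded:
  fixes v :: "'a::euclidean_space \<Rightarrow> real"
  assumes \<phi>: "mollifier \<delta> \<phi>" and v: "v \<in> borel_measurable borel" "\<And>x. \<bar>v x\<bar> \<le> K"
  shows "\<bar>convolve \<phi> v x\<bar> \<le> K"
proof -
  have "norm (\<integral>w. \<phi> w * v (x - w) \<partial>lborel) \<le> (\<integral>w. K * \<phi> w \<partial>lborel)"
    by (intro Bochner_Integration.integral_norm_bound_integral mollifier_times_bounded[OF \<phi> v]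
        integrable_mult_right mollifierD(6)[OF \<phi>])
  then show ?thesis
    using mollifierD(4)[OF \<phi>] convolve_commute[OF mollifierD(5)[OF \<phi>] v(1)] by simp
qed

text \<open>
  Translation is continuous in \<open>L\<^sup>1\<close>: this is clear for continuous functions with bounded support,
  and these approximate in \<open>L\<^sup>1\<close>.
\<close>

lemma L1_continuous_approximation:
  fixes v :: "'a::euclidean_space \<Rightarrow> real"
  assumes v [measurable]: "v \<in> borel_measurable borel" and K: "\<And>x. \<bar>v x\<bar> \<le> K"
    and r: "\<And>x. r \<le> norm x \<Longrightarrow> v x = 0" and "1 \<le> r" "e > 0"
  obtains g where "continuous_on UNIV g" "\<And>x. 2 * r \<le> norm x \<Longrightarrow> g x = 0"
    "(\<integral>\<^sup>+x. ennreal \<bar>v x - g x\<bar> \<partial>lborel) \<le> ennreal e"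
proof -
  have K0: "0 \<le> K"
    using K[of 0] by linarith
  have "v measurable_on UNIV"
  proof -
    have "v \<in> borel_measurable lebesgue"
      by (rule measurable_completion) simp
    then show ?thesis
      using measurable_on_iff_borel_measurable[of UNIV v] by (simp only: lebesgue_on_UNIV_eq) simp
  qed
  then obtain N f where N: "negligible N" and f: "\<And>n. continuous_on UNIV (f n)"
    "\<And>x. x \<notin> N \<Longrightarrow> (\<lambda>n. f n x) \<longlonglongrightarrow> v x"
    unfolding measurable_on_def by auto
  define g where "g n x = clamp_at K (f n x) * cutoff r x" for n :: nat and x
  note \<eta> = cutoff_facts[OF \<open>1 \<le> r\<close>, where 'a = 'a]
  have g_cont: "continuous_on UNIV (g n)" for n
    unfolding g_def clamp_at_def using f(1) by (intro continuous_intros cutoff_continuous)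
  have [measurable]: "g n \<in> borel_measurable borel" for n
    by (rule borel_measurable_continuous_onI[OF g_cont])
  have g_supp: "g n x = 0" if "2 * r \<le> norm x" for n x
    using \<eta>(4)[OF that] by (simp add: g_def)
  have "\<bar>clamp_at K t\<bar> \<le> K" for t
    using K0 by (auto simp: clamp_at_def)
  then have g_le: "\<bar>g n x\<bar> \<le> K * 1" for n x
    unfolding g_def abs_mult using \<eta>(1,2)[of x] K0 by (intro mult_mono) auto
  have g_bound: "\<bar>v x - g n x\<bar> \<le> 2 * K" for n x
    using K[of x] abs_triangle_ineq4[of "v x" "g n x"] g_le[of n x] by linarith
  have "(\<lambda>n. \<integral>\<^sup>+x. ennreal \<bar>v x - g n x\<bar> \<partial>lborel) \<longlonglongrightarrow> (\<integral>\<^sup>+x. 0 \<partial>(lborel :: 'a measure))"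
  proof (rule nn_integral_dominated_convergence)
    show "AE x in lborel. ennreal \<bar>v x - g n x\<bar> \<le> ennreal (2 * K) * indicator (cball 0 (2 * r)) x" for n
    proof (rule AE_I2)
      fix x
      show "ennreal \<bar>v x - g n x\<bar> \<le> ennreal (2 * K) * indicator (cball 0 (2 * r)) x"
        using g_bound[of x n] r[of x] g_supp[of x n] \<open>1 \<le> r\<close>
        by (cases "norm x \<le> 2 * r") (auto intro: ennreal_leI)
    qed
    show "(\<integral>\<^sup>+x. ennreal (2 * K) * indicator (cball (0::'a) (2 * r)) x \<partial>lborel) < \<infinity>"
      using emeasure_lborel_cball_finite[of "0::'a" "2 * r"]
      by (simp add: nn_integral_cmult_indicator ennreal_mult_less_top)
    have "AE x in lebesgue. x \<notin> N"
      using N by (auto simp: negligible_iff_null_sets intro!: AE_not_in)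
    then have "AE x in lborel. x \<notin> N"
      by (simp add: AE_completion_iff)
    then show "AE x in lborel. (\<lambda>n. ennreal \<bar>v x - g n x\<bar>) \<longlonglongrightarrow> 0"
    proof eventually_elim
      case (elim x)
      have "(\<lambda>n. clamp_at K (f n x)) \<longlonglongrightarrow> clamp_at K (v x)"
        unfolding clamp_at_def by (intro tendsto_intros f(2) elim)
      moreover have "clamp_at K (v x) = v x"
        using K[of x] by (auto simp: clamp_at_def abs_le_iff)
      ultimately have "(\<lambda>n. g n x) \<longlonglongrightarrow> v x * cutoff r x"
        unfolding g_def by (intro tendsto_mult tendsto_const) simp
      moreover have "v x * cutoff r x = v x"
        using r[of x] \<eta>(5)[of x] by (cases "norm x \<le> r") auto
      ultimately have "(\<lambda>n. \<bar>v x - g n x\<bar>) \<longlonglongrightarrow> \<bar>v x - v x\<bar>"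
        by (intro tendsto_intros) simp
      then show ?case
        using tendsto_ennrealI by fastforce
    qed
  qed (auto intro!: borel_measurable_times_ennreal borel_measurable_indicator)
  then have "\<forall>\<^sub>F n in sequentially. (\<integral>\<^sup>+x. ennreal \<bar>v x - g n x\<bar> \<partial>lborel) < ennreal e"
    using \<open>e > 0\<close> by (intro order_tendstoD(2)) auto
  then obtain n where "(\<integral>\<^sup>+x. ennreal \<bar>v x - g n x\<bar> \<partial>lborel) < ennreal e"
    by (auto simp: eventually_sequentially)
  then show thesis
    using g_cont g_supp by (intro that[of "g n"]) auto
qed

lemma L1_translation_continuous:
  fixes v :: "'a::euclidean_space \<Rightarrow> real"
  assumes v [measurable]: "v \<in> borel_measurable borel" and K: "\<And>x. \<bar>v x\<bar> \<le> K"
    and r: "\<And>x. r \<le> norm x \<Longrightarrow> v x = 0" and "e > 0"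
  obtains d where "d > 0" "\<And>w. norm w < d \<Longrightarrow> (\<integral>\<^sup>+x. ennreal \<bar>v (x - w) - v x\<bar> \<partial>lborel) \<le> ennreal e"
proof -
  define R where "R = max 1 r"
  have R: "1 \<le> R" "\<And>x. R \<le> norm x \<Longrightarrow> v x = 0"
    using r by (auto simp: R_def)
  obtain g where g: "continuous_on UNIV g" "\<And>x. 2 * R \<le> norm x \<Longrightarrow> g x = 0"
    "(\<integral>\<^sup>+x. ennreal \<bar>v x - g x\<bar> \<partial>lborel) \<le> ennreal (e / 3)"
    using L1_continuous_approximation[OF v K R(2,1), of "e / 3"] \<open>e > 0\<close> by auto
  have [measurable]: "g \<in> borel_measurable borel"
    by (rule borel_measurable_continuous_onI[OF g(1)])
  define V where "V = measure lborel (cball (0::'a) (2 * R + 1))"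
  have V: "0 \<le> V" "emeasure lborel (cball (0::'a) (2 * R + 1)) = ennreal V"
    unfolding V_def using emeasure_lborel_cball_finite[of "0::'a" "2 * R + 1"]
    by (auto simp: emeasure_eq_ennreal_measure less_top)
  define e' where "e' = e / (3 * (V + 1))"
  have e': "e' > 0"
    using \<open>e > 0\<close> V by (simp add: e'_def)
  obtain d where d: "d > 0" "\<And>x y. norm (x - y) < d \<Longrightarrow> \<bar>g x - g y\<bar> < e'"
    using uniformly_continuous_bounded_support[OF g(1,2) e'] by blast
  have "(\<integral>\<^sup>+x. ennreal \<bar>v (x - w) - v x\<bar> \<partial>lborel) \<le> ennreal e" if w: "norm w < min d 1" for w
  proof -
    have "(\<integral>\<^sup>+x. ennreal \<bar>v (x - w) - v x\<bar> \<partial>lborel)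
        \<le> (\<integral>\<^sup>+x. (ennreal \<bar>v (x - w) - g (x - w)\<bar> + ennreal \<bar>v x - g x\<bar>) + ennreal \<bar>g (x - w) - g x\<bar> \<partial>lborel)"
      by (intro nn_integral_mono) (simp add: ennreal_leI flip: ennreal_plus)
    also have "\<dots> = (\<integral>\<^sup>+x. ennreal \<bar>v (x - w) - g (x - w)\<bar> \<partial>lborel) + (\<integral>\<^sup>+x. ennreal \<bar>v x - g x\<bar> \<partial>lborel)
        + (\<integral>\<^sup>+x. ennreal \<bar>g (x - w) - g x\<bar> \<partial>lborel)"
      by (simp add: nn_integral_add)
    also have "(\<integral>\<^sup>+x. ennreal \<bar>v (x - w) - g (x - w)\<bar> \<partial>lborel) = (\<integral>\<^sup>+x. ennreal \<bar>v x - g x\<bar> \<partial>lborel)"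
      using nn_integral_lborel_translate[of "\<lambda>x. ennreal \<bar>v x - g x\<bar>" "- w"] by simp
    also have "(\<integral>\<^sup>+x. ennreal \<bar>g (x - w) - g x\<bar> \<partial>lborel) \<le> (\<integral>\<^sup>+x. ennreal e' * indicator (cball (0::'a) (2 * R + 1)) x \<partial>lborel)"
    proof (rule nn_integral_mono)
      fix x
      show "ennreal \<bar>g (x - w) - g x\<bar> \<le> ennreal e' * indicator (cball 0 (2 * R + 1)) x"
      proof (cases "norm x \<le> 2 * R + 1")
        case True
        then show ?thesis
          using d(2)[of "x - w" x] w by (simp add: ennreal_leI less_imp_le)
      next
        case False
        have "norm x \<le> norm (x - w) + norm w"
          using norm_triangle_sub[of x w] by linarith
        then have "2 * R \<le> norm (x - w)" "2 * R \<le> norm x"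
          using False w by linarith+
        then show ?thesis
          by (simp add: g(2))
      qed
    qed
    also have "(\<integral>\<^sup>+x. ennreal e' * indicator (cball (0::'a) (2 * R + 1)) x \<partial>lborel) = ennreal (e' * V)"
      using e' V by (simp add: nn_integral_cmult_indicator ennreal_mult)
    also have "(\<integral>\<^sup>+x. ennreal \<bar>v x - g x\<bar> \<partial>lborel) + (\<integral>\<^sup>+x. ennreal \<bar>v x - g x\<bar> \<partial>lborel) + ennreal (e' * V)
        \<le> ennreal (e / 3) + ennreal (e / 3) + ennreal (e / 3)"
    proof (intro add_mono g(3) ennreal_leI)
      have "e' * V = (e / 3) * (V / (V + 1))"
        by (simp add: e'_def)
      also have "\<dots> \<le> (e / 3) * 1"
        using \<open>e > 0\<close> V by (intro mult_left_mono) auto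
      finally show "e' * V \<le> e / 3"
        by simp
    qed
    also have "\<dots> = ennreal e"
      using \<open>e > 0\<close> by (simp flip: ennreal_plus)
    finally show ?thesis
      by (simp add: add_mono)
  qed
  then show thesis
    using d(1) by (intro that[of "min d 1"]) auto
qed

text \<open>
  By Tonelli's theorem the distance is at most an average of the \<open>L\<^sup>1\<close> distances of \<open>v\<close> from its
  translates by vectors of the support of \<open>\<phi>\<close>.
\<close>

lemma convolve_L1_close:
  fixes v :: "'a::euclidean_space \<Rightarrow> real"
  assumes \<phi>: "mollifier d \<phi>" and v [measurable]: "v \<in> borel_measurable borel"
    and K: "\<And>x. \<bar>v x\<bar> \<le> K"
    and d: "\<And>w. norm w < d \<Longrightarrow> (\<integral>\<^sup>+x. ennreal \<bar>v (x - w) - v x\<bar> \<partial>lborel) \<le> ennreal e"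
  shows "(\<integral>\<^sup>+x. ennreal \<bar>convolve \<phi> v x - v x\<bar> \<partial>lborel) \<le> ennreal e"
proof -
  note [measurable] = mollifierD(5)[OF \<phi>]
  have int: "integrable lborel (\<lambda>w. \<phi> w * v (x - w))" for x
    by (rule mollifier_times_bounded(2)[OF \<phi> v K])
  have pt: "ennreal \<bar>convolve \<phi> v x - v x\<bar> \<le> (\<integral>\<^sup>+w. ennreal (\<phi> w) * ennreal \<bar>v (x - w) - v x\<bar> \<partial>lborel)" for x
  proof -
    have "convolve \<phi> v x - v x = (\<integral>w. \<phi> w * v (x - w) - \<phi> w * v x \<partial>lborel)"
      using int[of x] mollifierD(4,6)[OF \<phi>] by (simp add: convolve_commute)
    moreover have "integrable lborel (\<lambda>w. \<phi> w * v (x - w) - \<phi> w * v x)"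
      using int[of x] mollifierD(6)[OF \<phi>] by simp
    ultimately have "ennreal \<bar>convolve \<phi> v x - v x\<bar> \<le> (\<integral>\<^sup>+w. ennreal (norm (\<phi> w * v (x - w) - \<phi> w * v x)) \<partial>lborel)"
      using integral_norm_bound_ennreal[of lborel "\<lambda>w. \<phi> w * v (x - w) - \<phi> w * v x"] by simp
    also have "\<dots> = (\<integral>\<^sup>+w. ennreal (\<phi> w) * ennreal \<bar>v (x - w) - v x\<bar> \<partial>lborel)"
      using mollifierD(2)[OF \<phi>]
      by (intro nn_integral_cong) (simp add: abs_mult flip: right_diff_distrib ennreal_mult)
    finally show ?thesis .
  qed
  have "(\<integral>\<^sup>+x. ennreal \<bar>convolve \<phi> v x - v x\<bar> \<partial>lborel)
      \<le> (\<integral>\<^sup>+x. \<integral>\<^sup>+w. ennreal (\<phi> w) * ennreal \<bar>v (x - w) - v x\<bar> \<partial>lborel \<partial>lborel)"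
    by (intro nn_integral_mono pt)
  also have "\<dots> = (\<integral>\<^sup>+w. \<integral>\<^sup>+x. ennreal (\<phi> w) * ennreal \<bar>v (x - w) - v x\<bar> \<partial>lborel \<partial>lborel)"
    by (rule lborel_pair.Fubini') measurable
  also have "\<dots> \<le> (\<integral>\<^sup>+w. ennreal (\<phi> w) * ennreal e \<partial>lborel)"
  proof (rule nn_integral_mono)
    fix w
    have "(\<integral>\<^sup>+x. ennreal (\<phi> w) * ennreal \<bar>v (x - w) - v x\<bar> \<partial>lborel)
        = ennreal (\<phi> w) * (\<integral>\<^sup>+x. ennreal \<bar>v (x - w) - v x\<bar> \<partial>lborel)"
      by (rule nn_integral_cmult) measurable
    also have "\<dots> \<le> ennreal (\<phi> w) * ennreal e"
      using d[of w] mollifierD(3)[OF \<phi>, of w] by (cases "norm w < d") (auto intro: mult_left_mono)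
    finally show "(\<integral>\<^sup>+x. ennreal (\<phi> w) * ennreal \<bar>v (x - w) - v x\<bar> \<partial>lborel) \<le> ennreal (\<phi> w) * ennreal e" .
  qed
  also have "\<dots> = ennreal e"
    using mollifierD(7)[OF \<phi>] by (simp add: nn_integral_multc)
  finally show ?thesis .
qed

lemma convolve_AE_subsequence:
  fixes v :: "'a::euclidean_space \<Rightarrow> real"
  assumes v: "v \<in> borel_measurable borel" "\<And>x. \<bar>v x\<bar> \<le> K" "\<And>x. r \<le> norm x \<Longrightarrow> v x = 0"
    and \<phi>: "\<And>n. mollifier (1 / real (Suc n)) (\<phi> n)"
  obtains \<sigma> :: "nat \<Rightarrow> nat" where "AE x in lborel. (\<lambda>n. convolve (\<phi> (\<sigma> n)) v x) \<longlonglongrightarrow> v x"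
proof -
  define u where "u n x = convolve (\<phi> n) v x - v x" for n x
  have u_int: "integrable lborel (u n)" for n
    unfolding u_def using Cc_inf_integrable[OF convolve_Cc_inf[OF mollifierD(1)[OF \<phi>] v]]
      compact_support_integrable[OF v] by (rule Bochner_Integration.integrable_diff)
  have "(\<lambda>n. \<integral>x. norm (u n x) \<partial>lborel) \<longlonglongrightarrow> 0"
  proof (rule LIMSEQ_I)
    fix e :: real assume e: "e > 0"
    obtain d where d: "d > 0" "\<And>w. norm w < d \<Longrightarrow> (\<integral>\<^sup>+x. ennreal \<bar>v (x - w) - v x\<bar> \<partial>lborel) \<le> ennreal (e / 2)"
      using L1_translation_continuous[OF v half_gt_zero[OF e]] by blast
    obtain n0 where n0: "1 / real (Suc n0) < d"
      using nat_approx_posE[OF d(1)] by (metis One_nat_def)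
    have "norm ((\<integral>x. norm (u n x) \<partial>lborel) - 0) < e" if "n \<ge> n0" for n
    proof -
      have "1 / real (Suc n) \<le> 1 / real (Suc n0)"
        using that by (simp add: field_simps)
      then have "(\<integral>\<^sup>+x. ennreal \<bar>convolve (\<phi> n) v x - v x\<bar> \<partial>lborel) \<le> ennreal (e / 2)"
        using n0 by (intro convolve_L1_close[OF \<phi> v(1,2)] d(2)) auto
      moreover have "(\<integral>\<^sup>+x. ennreal \<bar>convolve (\<phi> n) v x - v x\<bar> \<partial>lborel) = ennreal (\<integral>x. norm (u n x) \<partial>lborel)"
        using nn_integral_eq_integral[OF integrable_norm[OF u_int[of n]]] by (simp add: u_def)
      ultimately have "(\<integral>x. norm (u n x) \<partial>lborel) \<le> e / 2"
        using e by (simp add: ennreal_le_iff)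
      moreover have "0 \<le> (\<integral>x. norm (u n x) \<partial>lborel)"
        by (intro integral_nonneg_AE) auto
      ultimately show ?thesis
        using e by simp
    qed
    then show "\<exists>n0. \<forall>n\<ge>n0. norm ((\<integral>x. norm (u n x) \<partial>lborel) - 0) < e"
      by blast
  qed
  from tendsto_L1_AE_subseq[OF u_int this]
  obtain \<sigma> :: "nat \<Rightarrow> nat" where "AE x in lborel. (\<lambda>n. u (\<sigma> n) x) \<longlonglongrightarrow> 0"
    by blast
  then have "AE x in lborel. (\<lambda>n. convolve (\<phi> (\<sigma> n)) v x) \<longlonglongrightarrow> v x"
    by eventually_elim (simp add: u_def LIM_zero_iff)
  then show thesis
    by (rule that)
qed

context fractional_orlicz
begin

lemma gag_rho_translate:
  fixes v :: "'a \<Rightarrow> real"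
  assumes "v \<in> borel_measurable lebesgue"
  shows "gag.rho (difference (\<lambda>x. v (x - w))) = gag.rho (difference v)"
proof -
  let ?g = "\<lambda>p. ennreal (gag_Phi p (difference v p))"
  have "?g ((- w, - w) + p) = ennreal (gag_Phi p (difference (\<lambda>x. v (x - w)) p))" for p
    using H_translate[of "fst p" "- w" "snd p"] by (simp add: gag_Phi_def difference_def)
  moreover have "(\<integral>\<^sup>+p. ?g ((- w, - w) + p) \<partial>lebesgue) = (\<integral>\<^sup>+p. ?g p \<partial>lebesgue)"
    by (rule nn_integral_lebesgue_translate)
       (intro gag.measurable_rho difference_measurable assms)
  ultimately show ?thesis
    by (simp add: gag.rho_def)
qed

text \<open>
  \<open>H\<close> is Lebesgue measurable, whereas Tonelli's theorem is applied to products of Borel measures. A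
  single null set \<open>N\<close> takes care of this: off \<open>N\<close>, \<open>gag_Phi\<close> agrees at all positive rational times
  with Borel functions, and on \<open>N\<close> it is replaced by \<open>0\<close>, which keeps it even, monotone and continuous
  in time, as \<open>caratheodory_measurable\<close> asks.
\<close>

lemma gag_Phi_Borel_version:
  obtains N where "N \<in> null_sets lborel"
    "\<And>q. q \<in> \<rat> \<Longrightarrow> q > 0 \<Longrightarrow> (\<lambda>p. if p \<in> N then 0 else gag_Phi p q) \<in> borel_measurable borel"
proof -
  have "\<exists>f\<in>borel_measurable lborel. AE p in lborel. gag_Phi p q = f p" for q
    by (rule completion_ex_borel_measurable_real) (rule gag_Phi_measurable, simp)
  then obtain f where f: "\<And>q. f q \<in> borel_measurable lborel" "\<And>q. AE p in lborel. gag_Phi p q = f q p"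
    by metis
  have "AE p in lborel. \<forall>q\<in>\<rat>. gag_Phi p q = f q p"
    using f(2) countable_rat by (subst AE_ball_countable) auto
  then obtain N where N: "{p \<in> space lborel. \<not> (\<forall>q\<in>\<rat>. gag_Phi p q = f q p)} \<subseteq> N"
    "emeasure lborel N = 0" "N \<in> sets lborel"
    by (rule AE_E)
  have "(\<lambda>p. if p \<in> N then 0 else gag_Phi p q) \<in> borel_measurable borel" if "q \<in> \<rat>" for q
  proof -
    have "(\<lambda>p. if p \<in> N then 0 else gag_Phi p q) = (\<lambda>p. if p \<in> N then 0 else f q p)"
    proof
      fix p
      have "p \<in> N \<or> gag_Phi p q = f q p"
        using N(1) that unfolding space_lborel space_borel by blast
      then show "(if p \<in> N then 0 else gag_Phi p q) = (if p \<in> N then 0 else f q p)"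
        by auto
    qed
    also have "\<dots> \<in> borel_measurable borel"
      using f(1)[of q] N(3) by (intro measurable_If_set) auto
    finally show ?thesis .
  qed
  then show thesis
    using N by (intro that[of N]) auto
qed

text \<open>
  The increments of the mollified function are averages of the increments of the translates of \<open>v\<close>.
  Jensen's inequality bounds the integrand by the average of the integrands of the translates, and
  these all have the same modular.
\<close>

lemma gag_rho_convolve_le:
  fixes v :: "'a \<Rightarrow> real"
  assumes \<phi>: "mollifier \<delta> \<phi>"
    and v: "v \<in> borel_measurable borel" "\<And>x. \<bar>v x\<bar> \<le> K" "\<And>x. r \<le> norm x \<Longrightarrow> v x = 0"
  shows "gag.rho (difference (convolve \<phi> v)) \<le> gag.rho (difference v)"
proof -
  note [measurable] = mollifierD(5)[OF \<phi>] v(1)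
  obtain N where N: "N \<in> null_sets lborel"
    "\<And>q. q \<in> \<rat> \<Longrightarrow> q > 0 \<Longrightarrow> (\<lambda>p. if p \<in> N then 0 else gag_Phi p q) \<in> borel_measurable borel"
    using gag_Phi_Borel_version by blast
  define P where "P p t = (if p \<in> N then 0 else gag_Phi p t)" for p t
  have AE_N: "AE p in lborel. p \<notin> N"
    using N(1) by (rule AE_not_in)
  have P_eq: "AE p in lborel. ennreal (gag_Phi p (F p)) = ennreal (P p (F p))" for F
    using AE_N by eventually_elim (simp add: P_def)
  define D where "D w p = v (fst p - w) - v (snd p - w)" for w and p :: "'a \<times> 'a"
  have D_borel: "(\<lambda>z. D (snd z) (fst z)) \<in> borel_measurable (borel :: (('a \<times> 'a) \<times> 'a) measure)"
  proof -
    have "(\<lambda>z::('a \<times> 'a) \<times> 'a. fst (fst z) - snd z) \<in> borel_measurable borel"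
      "(\<lambda>z::('a \<times> 'a) \<times> 'a. snd (fst z) - snd z) \<in> borel_measurable borel"
      by (intro borel_measurable_continuous_onI continuous_intros)+
    from this[THEN measurable_compose, OF v(1)] show ?thesis
      unfolding D_def by (rule borel_measurable_diff)
  qed
  have D_w: "(\<lambda>w. D w p) \<in> borel_measurable borel" for p
    unfolding D_def by measurable
  have fst_snd: "(fst :: ('a \<times> 'a) \<times> 'a \<Rightarrow> 'a \<times> 'a) \<in> borel_measurable borel"
    "(snd :: ('a \<times> 'a) \<times> 'a \<Rightarrow> 'a) \<in> borel_measurable borel"
    by (intro borel_measurable_continuous_onI continuous_intros)+
  have "(\<lambda>z. P (fst z) (D (snd z) (fst z))) \<in> borel_measurable (borel :: (('a \<times> 'a) \<times> 'a) measure)"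
  proof (rule caratheodory_measurable[OF _ D_borel])
    show "(\<lambda>z. P (fst z) q) \<in> borel_measurable (borel :: (('a \<times> 'a) \<times> 'a) measure)" if "q \<in> \<rat>" "q > 0" for q
      using measurable_compose[OF fst_snd(1) N(2)[OF that]] by (simp add: P_def)
    show "isCont (P p) t" for p t
      unfolding P_def using gag_Phi_isCont by (cases "p \<in> N") simp_all
  qed (auto simp: P_def gag_Phi_even gag_Phi_zero intro: gag_Phi_mono)
  then have "(\<lambda>z. ennreal (\<phi> (snd z)) * ennreal (P (fst z) (D (snd z) (fst z))))
      \<in> borel_measurable (borel :: (('a \<times> 'a) \<times> 'a) measure)"
    using measurable_compose[OF fst_snd(2) mollifierD(5)[OF \<phi>]] by simp
  then have meas: "(\<lambda>(p, w). ennreal (\<phi> w) * ennreal (P p (D w p)))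
      \<in> borel_measurable (lborel \<Otimes>\<^sub>M (lborel :: 'a measure))"
    by (simp add: case_prod_unfold lborel_prod)
  have Jensen: "ennreal (gag_Phi p (difference (convolve \<phi> v) p))
      \<le> (\<integral>\<^sup>+w. ennreal (\<phi> w) * ennreal (gag_Phi p (D w p)) \<partial>lborel)" for p
  proof -
    have int: "integrable lborel (\<lambda>w. \<phi> w * v (x - w))" for x
      by (rule mollifier_times_bounded(2)[OF \<phi> v(1,2)])
    have eq: "difference (convolve \<phi> v) p = (\<integral>w. \<phi> w * D w p \<partial>lborel)"
      using int by (simp add: difference_def convolve_commute D_def right_diff_distrib)
    have bound: "\<bar>D w p\<bar> \<le> 2 * K" for w
      using v(2)[of "fst p - w"] v(2)[of "snd p - w"] by (simp add: D_def)
    have cont: "continuous_on UNIV (gag_Phi p)"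
      using gag_Phi_isCont by (simp add: continuous_at_imp_continuous_on)
    show ?thesis
      unfolding eq by (rule Jensen_mollifier[OF \<phi> D_w bound gag_Phi_convex cont gag.Phi_nonneg])
  qed
  have "gag.rho (difference (convolve \<phi> v)) = (\<integral>\<^sup>+p. ennreal (gag_Phi p (difference (convolve \<phi> v) p)) \<partial>lborel)"
    by (simp add: gag.rho_def nn_integral_completion)
  also have "\<dots> \<le> (\<integral>\<^sup>+p. \<integral>\<^sup>+w. ennreal (\<phi> w) * ennreal (P p (D w p)) \<partial>lborel \<partial>lborel)"
  proof (rule nn_integral_mono_AE)
    show "AE p in lborel. ennreal (gag_Phi p (difference (convolve \<phi> v) p))
        \<le> (\<integral>\<^sup>+w. ennreal (\<phi> w) * ennreal (P p (D w p)) \<partial>lborel)"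
      using AE_N by eventually_elim (use Jensen in \<open>simp add: P_def\<close>)
  qed
  also have "\<dots> = (\<integral>\<^sup>+w. \<integral>\<^sup>+p. ennreal (\<phi> w) * ennreal (P p (D w p)) \<partial>lborel \<partial>lborel)"
    by (rule lborel_pair.Fubini'[OF meas, symmetric])
  also have "\<dots> = (\<integral>\<^sup>+w. ennreal (\<phi> w) * gag.rho (difference v) \<partial>lborel)"
  proof (rule nn_integral_cong)
    fix w :: 'a
    have D_eq: "D w = difference (\<lambda>x. v (x - w))"
      by (auto simp: D_def difference_def)
    have vw: "(\<lambda>x. v (x - w)) \<in> borel_measurable lebesgue"
      by (rule borel_imp_lebesgue) measurable
    have "(\<integral>\<^sup>+p. ennreal (\<phi> w) * ennreal (P p (D w p)) \<partial>lborel)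
        = (\<integral>\<^sup>+p. ennreal (\<phi> w) * ennreal (gag_Phi p (D w p)) \<partial>lborel)"
      using P_eq[of "D w"] by (intro nn_integral_cong_AE) (auto elim: eventually_mono)
    also have "\<dots> = (\<integral>\<^sup>+p. ennreal (\<phi> w) * ennreal (gag_Phi p (D w p)) \<partial>lebesgue)"
      by (simp add: nn_integral_completion)
    also have "\<dots> = ennreal (\<phi> w) * gag.rho (D w)"
      unfolding gag.rho_def D_eq
      by (intro nn_integral_cmult gag.measurable_rho difference_measurable vw)
    also have "gag.rho (D w) = gag.rho (difference v)"
      unfolding D_eq by (rule gag_rho_translate[OF borel_imp_lebesgue[OF v(1)]])
    finally show "(\<integral>\<^sup>+p. ennreal (\<phi> w) * ennreal (P p (D w p)) \<partial>lborel) = ennreal (\<phi> w) * gag.rho (difference v)" .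
  qed
  also have "\<dots> = gag.rho (difference v)"
    using mollifierD(7)[OF \<phi>] by (simp add: nn_integral_multc)
  finally show ?thesis .
qed

text \<open>
  The Sobolev part converges by domination, as all mollifications are bounded by the same constant and
  supported in the same ball. The Gagliardo part has no majorant and is handled by \<open>rho_diff_small\<close>,
  whose hypothesis on the modulars is \<open>gag_rho_convolve_le\<close>.
\<close>

lemma approximable_mollification:
  assumes "v \<in> bounded_bounded_support"
  shows "approximable Cc_inf v"
  unfolding approximable_def
proof (intro allI impI)
  fix c \<delta> :: real
  assume \<delta>: "\<delta> > 0"
  have v: "v \<in> borel_measurable borel"
    and finG: "gag.rho (difference v) < \<infinity>" and finS: "star.rho v < \<infinity>"
    using assms unfolding bounded_bounded_support_def energy_finite_iff by blast+
  obtain K where K: "\<And>x. \<bar>v x\<bar> \<le> K"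
    using assms unfolding bounded_bounded_support_def by blast
  obtain r where r: "\<And>x. r \<le> norm x \<Longrightarrow> v x = 0"
    using assms unfolding bounded_bounded_support_def by blast
  have "\<exists>\<phi> :: 'a \<Rightarrow> real. mollifier (1 / real (Suc n)) \<phi>" for n
    using mollifier_exists[of "1 / real (Suc n)"] unfolding mollifier_def by (metis of_nat_0_less_iff zero_less_Suc zero_less_divide_1_iff)
  then obtain \<phi> :: "nat \<Rightarrow> 'a \<Rightarrow> real" where \<phi>: "\<And>n. mollifier (1 / real (Suc n)) (\<phi> n)"
    by metis
  obtain \<sigma> :: "nat \<Rightarrow> nat" where \<sigma>: "AE x in lborel. (\<lambda>n. convolve (\<phi> (\<sigma> n)) v x) \<longlonglongrightarrow> v x"
    using convolve_AE_subsequence[OF v K r \<phi>] by blast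
  define F where "F n = convolve (\<phi> (\<sigma> n)) v" for n
  have F: "F n \<in> Cc_inf" for n
    unfolding F_def by (rule convolve_Cc_inf[OF mollifierD(1)[OF \<phi>] v K r])
  have F_meas: "F n \<in> borel_measurable lebesgue" for n
    by (rule borel_imp_lebesgue[OF Cc_inf_borel[OF F]])
  have F_lim: "AE x in lebesgue. (\<lambda>n. F n x) \<longlonglongrightarrow> v x"
    unfolding F_def using \<sigma> by (rule AE_completion)
  define E where "E x = 2 * K * indicator (cball 0 (r + 1)) x" for x :: 'a
  have K0: "0 \<le> K"
    using K[of 0] by linarith
  have "(\<lambda>n. star.rho (\<lambda>x. (- c) * (F n x - v x))) \<longlonglongrightarrow> 0"
  proof (rule star.rho_dominated_convergence[where D = E])
    show "(\<lambda>x. F n x - v x) \<in> borel_measurable lebesgue" for n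
      using F_meas borel_imp_lebesgue[OF v] by (rule borel_measurable_diff)
    show "E \<in> borel_measurable lebesgue"
      unfolding E_def by (intro borel_imp_lebesgue borel_measurable_times borel_measurable_indicator) auto
    show "AE x in lebesgue. (\<lambda>n. F n x - v x) \<longlonglongrightarrow> 0"
      using F_lim by eventually_elim (simp add: LIM_zero_iff)
    show "AE x in lebesgue. \<bar>F n x - v x\<bar> \<le> \<bar>E x\<bar>" for n
    proof (rule AE_I2)
      fix x :: 'a
      have b: "\<bar>F n x - v x\<bar> \<le> 2 * K"
        using convolve_bounded[OF \<phi> v K, of "\<sigma> n" x] K[of x] unfolding F_def by linarith
      show "\<bar>F n x - v x\<bar> \<le> \<bar>E x\<bar>"
      proof (cases "x \<in> cball 0 (r + 1)")
        case False
        have "1 / real (Suc (\<sigma> n)) \<le> 1"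
          by simp
        then have "r + 1 / real (Suc (\<sigma> n)) \<le> norm x"
          using False by (simp only: mem_cball dist_0_norm not_le)
        then have "F n x = 0"
          unfolding F_def using mollifierD(3)[OF \<phi>] r
          by (intro convolve_support[of "1 / real (Suc (\<sigma> n))" "\<phi> (\<sigma> n)" r v x]) blast+
        moreover have "v x = 0"
          using False by (intro r) auto
        ultimately show ?thesis
          by simp
      qed (use b K0 in \<open>simp add: E_def\<close>)
    qed
    show "star.rho E < \<infinity>"
      using emeasure_lborel_cball_finite[of "0::'a" "r + 1"] K0
      by (intro star_rho_bounded_support[of E "2 * K" "cball 0 (r + 1)"]) (auto simp: E_def indicator_def)
  qed
  then have "\<forall>\<^sub>F n in sequentially. star.rho (\<lambda>x. (- c) * (F n x - v x)) < ennreal (\<delta> / 2)"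
    using \<delta> by (intro order_tendstoD(2)) auto
  then obtain m where m: "\<And>n. n \<ge> m \<Longrightarrow> star.rho (\<lambda>x. (- c) * (F n x - v x)) < ennreal (\<delta> / 2)"
    by (auto simp: eventually_sequentially)
  have "\<exists>n\<ge>m. gag.rho (\<lambda>p. (- c) * (difference (F n) p - difference v p)) \<le> ennreal (\<delta> / 2)"
  proof (rule gag.rho_diff_small)
    show "gag.rho (difference (F n)) \<le> gag.rho (difference v)" for n
      unfolding F_def by (rule gag_rho_convolve_le[OF \<phi> v K r])
  qed (use F_meas v \<delta> finG F_lim in \<open>auto intro: difference_measurable borel_imp_lebesgue difference_tendsto_AE\<close>)
  then obtain n where n: "n \<ge> m" "gag.rho (\<lambda>p. (- c) * (difference (F n) p - difference v p)) \<le> ennreal (\<delta> / 2)"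
    by blast
  have "(\<lambda>x. c * (v x - F n x)) = (\<lambda>x. (- c) * (F n x - v x))"
    by (auto simp: algebra_simps)
  then have "energy (\<lambda>x. c * (v x - F n x)) = gag.rho (\<lambda>p. (- c) * (difference (F n) p - difference v p))
      + star.rho (\<lambda>x. (- c) * (F n x - v x))"
    by (simp only: energy_def difference_scale difference_diff)
  also have "\<dots> \<le> ennreal (\<delta> / 2) + ennreal (\<delta> / 2)"
    using n m[of n] by (intro add_mono) auto
  also have "\<dots> = ennreal \<delta>"
    using \<delta> by (simp flip: ennreal_plus)
  finally show "\<exists>w\<in>Cc_inf. energy (\<lambda>x. c * (v x - w x)) \<le> ennreal \<delta>"
    using F by blast
qed

lemma approximable_Cc_inf:
  fixes u :: "'a \<Rightarrow> real"
  assumes u: "u \<in> borel_measurable lebesgue" and fin: "energy u < \<infinity>"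
  shows "approximable Cc_inf u"
proof -
  obtain u' where u': "u' \<in> borel_measurable lborel" "AE x in lborel. u x = u' x"
    using completion_ex_borel_measurable_real[OF u] by blast
  have ae: "AE x in lebesgue. u x = u' x"
    using u'(2) by (rule AE_completion)
  have b: "u' \<in> borel_measurable borel" "energy u' < \<infinity>"
    using u'(1) fin energy_cong_AE[OF ae] by simp_all
  have "approximable bounded_bounded_support u'"
    by (rule approximable_trans[OF borel_imp_lebesgue[OF b(1)] _ _ approximable_truncation[OF b] approximable_cutoff])
       (auto simp: bounded_finite_support_def bounded_bounded_support_def intro: borel_imp_lebesgue)
  then have "approximable Cc_inf u'"
    using approximable_trans[of u' bounded_bounded_support Cc_inf] approximable_mollification
      borel_imp_lebesgue b(1) Cc_inf_borel
    unfolding bounded_bounded_support_def by blast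
  moreover have "energy (\<lambda>x. c * (u x - w x)) = energy (\<lambda>x. c * (u' x - w x))" for c w
    using ae by (intro energy_cong_AE) (auto elim: eventually_mono)
  ultimately show ?thesis
    by (simp add: approximable_def)
qed

end

section \<open>The quotient space W\<close>

lemma the_elem_image_constant:
  assumes "x \<in> A" "\<And>y. y \<in> A \<Longrightarrow> f y = c"
  shows "the_elem (f ` A) = c"
proof -
  have "f ` A = (\<lambda>_. c) ` A"
    using assms(2) by (rule image_cong[OF refl])
  also have "\<dots> = {c}"
    using assms(1) by (rule image_constant)
  finally show ?thesis
    by simp
qed

context fractional_orlicz
begin

lemma gagliardo_add:
  assumes "u \<in> borel_measurable lebesgue" "v \<in> borel_measurable lebesgue"
  shows "gagliardo H s (\<lambda>x. u x + v x) \<le> gagliardo H s u + gagliardo H s v"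
  unfolding gagliardo_eq_lux difference_add using assms by (intro gag.lux_add difference_measurable)

lemma gagliardo_scale: "gagliardo H s (\<lambda>x. c * u x) = ennreal \<bar>c\<bar> * gagliardo H s u"
  unfolding gagliardo_eq_lux difference_scale by (rule gag.lux_scale)

lemma gagliardo_zero: "gagliardo H s (\<lambda>x. 0) = 0"
  unfolding gagliardo_eq_lux difference_zero by (rule gag.lux_zero)

lemma gagliardo_cong_AE: "(AE x in lebesgue. u x = v x) \<Longrightarrow> gagliardo H s u = gagliardo H s v"
  unfolding gagliardo_eq_lux by (intro gag.lux_cong_AE difference_AE)

lemma gagliardo_diff_commute: "gagliardo H s (\<lambda>x. u x - v x) = gagliardo H s (\<lambda>x. v x - u x)"
  using gagliardo_scale[of "-1" "\<lambda>x. v x - u x"] by simp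

lemma gagliardo_triangle:
  assumes "u \<in> borel_measurable lebesgue" "v \<in> borel_measurable lebesgue" "w \<in> borel_measurable lebesgue"
  shows "gagliardo H s (\<lambda>x. u x - w x) \<le> gagliardo H s (\<lambda>x. u x - v x) + gagliardo H s (\<lambda>x. v x - w x)"
  using gagliardo_add[of "\<lambda>x. u x - v x" "\<lambda>x. v x - w x"] assms by simp

lemma W_fun_measurable: "u \<in> W_fun H s \<Longrightarrow> u \<in> borel_measurable lebesgue"
  by (simp add: W_fun_iff)

lemma W_fun_gagliardo_finite: "u \<in> W_fun H s \<Longrightarrow> gagliardo H s u < \<infinity>"
  by (simp add: W_fun_def)

lemma W_fun_scale:
  assumes "u \<in> W_fun H s"
  shows "(\<lambda>x. c * u x) \<in> W_fun H s"
  using assms energy_scale_finite[of u c] unfolding W_fun_iff by auto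

lemma W_fun_add:
  assumes "u \<in> W_fun H s" "v \<in> W_fun H s"
  shows "(\<lambda>x. u x + v x) \<in> W_fun H s"
proof -
  have m: "u \<in> borel_measurable lebesgue" "v \<in> borel_measurable lebesgue"
    using assms W_fun_measurable by auto
  have "energy (\<lambda>x. u x + v x) \<le> energy (\<lambda>x. 2 * u x) + energy (\<lambda>x. 2 * v x)"
    using m by (rule energy_add)
  also have "\<dots> < \<infinity>"
    using W_fun_scale[OF assms(1), of 2] W_fun_scale[OF assms(2), of 2]
    by (simp add: W_fun_iff ennreal_add_less_top)
  finally show ?thesis
    using m by (simp add: W_fun_iff)
qed

lemma W_fun_diff: "u \<in> W_fun H s \<Longrightarrow> v \<in> W_fun H s \<Longrightarrow> (\<lambda>x. u x - v x) \<in> W_fun H s"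
  using W_fun_add[OF _ W_fun_scale[of v "-1"]] by simp

lemma Cc_inf_W_fun: "u \<in> Cc_inf \<Longrightarrow> u \<in> W_fun H s"
  unfolding W_fun_iff using Cc_inf_energy_finite borel_imp_lebesgue[OF Cc_inf_borel] by blast

lemma Cc_inf_measurable:
  fixes u :: "'a \<Rightarrow> real"
  shows "u \<in> Cc_inf \<Longrightarrow> u \<in> borel_measurable lebesgue"
  by (rule W_fun_measurable[OF Cc_inf_W_fun])

abbreviation W_class :: "('a \<Rightarrow> real) \<Rightarrow> ('a \<Rightarrow> real) set" where
  "W_class u \<equiv> W_rel H s `` {u}"

lemma mem_W_class: "v \<in> W_class u \<longleftrightarrow> u \<in> W_fun H s \<and> v \<in> W_fun H s \<and> (AE x in lebesgue. u x = v x)"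
  by (simp add: W_rel_def)

lemma equiv_W_rel: "equiv (W_fun H s) (W_rel H s)"
proof (rule equivI)
  show "W_rel H s \<subseteq> W_fun H s \<times> W_fun H s"
    by (auto simp: W_rel_def)
  show "refl_on (W_fun H s) (W_rel H s)"
    by (auto simp: refl_on_def W_rel_def)
  show "sym (W_rel H s)"
    by (rule symI) (auto simp: W_rel_def elim: eventually_mono)
  show "trans (W_rel H s)"
  proof (rule transI)
    fix u v w assume "(u, v) \<in> W_rel H s" "(v, w) \<in> W_rel H s"
    then have "AE x in lebesgue. u x = v x" "AE x in lebesgue. v x = w x" "u \<in> W_fun H s" "w \<in> W_fun H s"
      by (auto simp: W_rel_def)
    moreover from this(1,2) have "AE x in lebesgue. u x = w x"
      by eventually_elim simp
    ultimately show "(u, w) \<in> W_rel H s"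
      by (simp add: W_rel_def)
  qed
qed

lemma W_class_self: "u \<in> W_fun H s \<Longrightarrow> u \<in> W_class u"
  unfolding mem_W_class by simp

lemma W_class_eqI:
  assumes "u \<in> W_fun H s" "v \<in> W_fun H s" "AE x in lebesgue. u x = v x"
  shows "W_class u = W_class v"
  using equiv_class_eq[OF equiv_W_rel, of u v] assms by (simp add: W_rel_def)

lemma W_spaceE:
  assumes "A \<in> W_space H s"
  obtains u where "u \<in> W_fun H s" "A = W_class u"
  using assms unfolding W_space_def by (elim quotientE)

lemma W_class_in_space: "u \<in> W_fun H s \<Longrightarrow> W_class u \<in> W_space H s"
  unfolding W_space_def by (rule quotientI)

lemma W_add_class:
  assumes "u \<in> W_fun H s" "v \<in> W_fun H s"
  shows "W_add H s (W_class u) (W_class v) = W_class (\<lambda>x. u x + v x)"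
proof -
  have "W_class (\<lambda>x. u' x + v' x) = W_class (\<lambda>x. u x + v x)" if "u' \<in> W_class u" "v' \<in> W_class v" for u' v'
  proof (rule W_class_eqI)
    have "AE x in lebesgue. u x = u' x" "AE x in lebesgue. v x = v' x"
      using that unfolding mem_W_class by auto
    then show "AE x in lebesgue. u' x + v' x = u x + v x"
      by eventually_elim simp
  qed (use that assms in \<open>auto simp only: mem_W_class intro: W_fun_add\<close>)
  then show ?thesis
    unfolding W_add_def using W_class_self assms by blast
qed

lemma W_scale_class:
  assumes "u \<in> W_fun H s"
  shows "W_scale H s c (W_class u) = W_class (\<lambda>x. c * u x)"
proof -
  have "W_class (\<lambda>x. c * u' x) = W_class (\<lambda>x. c * u x)" if "u' \<in> W_class u" for u'
  proof (rule W_class_eqI)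
    have "AE x in lebesgue. u x = u' x"
      using that unfolding mem_W_class by auto
    then show "AE x in lebesgue. c * u' x = c * u x"
      by eventually_elim simp
  qed (use that assms in \<open>auto simp only: mem_W_class intro: W_fun_scale\<close>)
  then show ?thesis
    unfolding W_scale_def using W_class_self assms by blast
qed

lemma W_gagliardo_class:
  assumes "u \<in> W_fun H s"
  shows "W_gagliardo H s (W_class u) = gagliardo H s u"
proof -
  have "gagliardo H s u' = gagliardo H s u" if "u' \<in> W_class u" for u'
    using that gagliardo_cong_AE[of u u'] unfolding mem_W_class by simp
  then show ?thesis
    unfolding W_gagliardo_def by (rule the_elem_image_constant[OF W_class_self[OF assms]])
qed

lemma W_norm_class:
  assumes "u \<in> W_fun H s"
  shows "W_norm H s (W_class u) = gagliardo H s u + L_star_norm H s u"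
proof -
  have "gagliardo H s u' + L_star_norm H s u' = gagliardo H s u + L_star_norm H s u" if "u' \<in> W_class u" for u'
    using that gagliardo_cong_AE[of u u'] star.lux_cong_AE[of u u']
    unfolding mem_W_class L_star_norm_eq_lux by simp
  then show ?thesis
    unfolding W_norm_def by (rule the_elem_image_constant[OF W_class_self[OF assms]])
qed

lemma Cc_classes_subspace: "W_subspace H s (Cc_classes H s)"
  unfolding W_subspace_def Cc_classes_def
proof (intro conjI ballI allI)
  show "W_class ` Cc_inf \<subseteq> W_space H s"
    using Cc_inf_W_fun W_class_in_space by blast
  show "W_class (\<lambda>x. 0) \<in> W_class ` Cc_inf"
    using Cc_inf_zero by blast
  fix A assume "A \<in> W_class ` Cc_inf"
  then obtain u where u: "u \<in> Cc_inf" "A = W_class u"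
    by blast
  show "W_scale H s c A \<in> W_class ` Cc_inf" for c
    using u Cc_inf_scale[OF u(1)] by (simp add: W_scale_class[OF Cc_inf_W_fun])
  fix B assume "B \<in> W_class ` Cc_inf"
  then obtain v where v: "v \<in> Cc_inf" "B = W_class v"
    by blast
  show "W_add H s A B \<in> W_class ` Cc_inf"
    using u v Cc_inf_add[OF u(1) v(1)] by (simp add: W_add_class[OF Cc_inf_W_fun Cc_inf_W_fun])
qed

lemma Cc_inf_norm_dense:
  assumes u: "u \<in> W_fun H s" and e: "e > 0"
  obtains \<phi> where "\<phi> \<in> Cc_inf"
    "gagliardo H s (\<lambda>x. u x - \<phi> x) + L_star_norm H s (\<lambda>x. u x - \<phi> x) < ennreal e"
proof -
  have "approximable Cc_inf u"
    using u by (intro approximable_Cc_inf) (simp_all add: W_fun_iff)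
  \<comment> \<open>Each of the two Luxemburg functionals will be at most \<open>e / 3\<close>, so the sum is strictly below \<open>e\<close>.\<close>
  then obtain \<phi> where \<phi>: "\<phi> \<in> Cc_inf" "energy (\<lambda>x. 3 / e * (u x - \<phi> x)) \<le> ennreal 1"
    unfolding approximable_def using zero_less_one by blast
  have "gag.rho (\<lambda>p. difference (\<lambda>x. u x - \<phi> x) p / (e / 3)) + star.rho (\<lambda>x. (u x - \<phi> x) / (e / 3)) \<le> 1"
    using \<phi>(2) unfolding energy_def difference_scale by (simp add: mult.commute)
  then have "gag.rho (\<lambda>p. difference (\<lambda>x. u x - \<phi> x) p / (e / 3)) \<le> 1"
    "star.rho (\<lambda>x. (u x - \<phi> x) / (e / 3)) \<le> 1"
    by (meson add_increasing2 add_increasing dual_order.trans order_refl zero_le)+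
  then have "gag.lux (difference (\<lambda>x. u x - \<phi> x)) \<le> ennreal (e / 3)" "star.lux (\<lambda>x. u x - \<phi> x) \<le> ennreal (e / 3)"
    using e by (intro gag.lux_le star.lux_le; simp)+
  then have "gagliardo H s (\<lambda>x. u x - \<phi> x) + L_star_norm H s (\<lambda>x. u x - \<phi> x) \<le> ennreal (e / 3) + ennreal (e / 3)"
    unfolding gagliardo_eq_lux L_star_norm_eq_lux by (rule add_mono)
  also have "\<dots> < ennreal e"
    using e by (simp add: ennreal_less_iff flip: ennreal_plus)
  finally show thesis
    using \<phi>(1) that by blast
qed

lemma Cc_classes_dense: "W_dense H s (Cc_classes H s)"
  unfolding W_dense_def
proof (intro ballI allI impI)
  fix A and e :: real
  assume "A \<in> W_space H s" and e: "e > 0"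
  then obtain u where u: "u \<in> W_fun H s" "A = W_class u"
    using W_spaceE by blast
  obtain \<phi> where \<phi>: "\<phi> \<in> Cc_inf"
    "gagliardo H s (\<lambda>x. u x - \<phi> x) + L_star_norm H s (\<lambda>x. u x - \<phi> x) < ennreal e"
    using Cc_inf_norm_dense[OF u(1) e] by blast
  note \<phi>W = Cc_inf_W_fun[OF \<phi>(1)]
  have "W_add H s A (W_scale H s (- 1) (W_class \<phi>)) = W_class (\<lambda>x. u x + - 1 * \<phi> x)"
    unfolding u(2) W_scale_class[OF \<phi>W] by (rule W_add_class[OF u(1) W_fun_scale[OF \<phi>W]])
  then have "W_norm H s (W_add H s A (W_scale H s (- 1) (W_class \<phi>))) < ennreal e"
    using W_norm_class[OF W_fun_diff[OF u(1) \<phi>W]] \<phi>(2) by simp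
  then show "\<exists>B\<in>Cc_classes H s. W_norm H s (W_add H s A (W_scale H s (- 1) B)) < ennreal e"
    using \<phi>(1) unfolding Cc_classes_def by blast
qed

section \<open>The completion D\<close>

definition converges_to :: "(nat \<Rightarrow> 'a \<Rightarrow> real) \<Rightarrow> ('a \<Rightarrow> real) \<Rightarrow> bool" where
  "converges_to X u \<longleftrightarrow> (\<forall>n. X n \<in> Cc_inf) \<and> u \<in> W_fun H s \<and> (\<lambda>n. gagliardo H s (\<lambda>x. X n x - u x)) \<longlonglongrightarrow> 0"

lemma ennreal_tendsto_0_squeeze:
  fixes a e :: "nat \<Rightarrow> ennreal"
  assumes "e \<longlonglongrightarrow> 0" "\<And>n. a n \<le> e n"
  shows "a \<longlonglongrightarrow> 0"
  by (rule tendsto_sandwich[OF _ _ tendsto_const assms(1)]) (use assms(2) in auto)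

lemma ennreal_add_tendsto_0:
  fixes a b :: "nat \<Rightarrow> ennreal"
  assumes "a \<longlonglongrightarrow> 0" "b \<longlonglongrightarrow> 0"
  shows "(\<lambda>n. a n + b n) \<longlonglongrightarrow> 0"
  using tendsto_add[OF assms] by simp

lemma ennreal_tendsto_0_iff:
  fixes a :: "nat \<Rightarrow> ennreal"
  shows "a \<longlonglongrightarrow> 0 \<longleftrightarrow> (\<forall>e>0. \<forall>\<^sub>F n in sequentially. a n < ennreal e)"
proof
  assume "a \<longlonglongrightarrow> 0"
  then show "\<forall>e>0. \<forall>\<^sub>F n in sequentially. a n < ennreal e"
    by (auto intro: order_tendstoD(2))
next
  assume *: "\<forall>e>0. \<forall>\<^sub>F n in sequentially. a n < ennreal e"
  show "a \<longlonglongrightarrow> 0"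
  proof (rule order_tendstoI)
    fix b :: ennreal assume "0 < b"
    then obtain e where e: "e > 0" "ennreal e \<le> b"
      by (cases b) (auto intro: that[of 1] simp: top_greatest)
    show "\<forall>\<^sub>F n in sequentially. a n < b"
      using *[rule_format, OF e(1)] by eventually_elim (use e(2) in order)
  qed simp
qed

lemma converges_to_W_fun:
  assumes "converges_to X u"
  shows "X n \<in> Cc_inf" "X n \<in> borel_measurable lebesgue" "u \<in> W_fun H s" "u \<in> borel_measurable lebesgue"
    "(\<lambda>n. gagliardo H s (\<lambda>x. X n x - u x)) \<longlonglongrightarrow> 0"
  using assms Cc_inf_measurable W_fun_measurable unfolding converges_to_def by blast+

lemma converges_to_exists:
  assumes u: "u \<in> W_fun H s"
  obtains X where "converges_to X u"
proof -
  have "\<exists>\<phi>. \<phi> \<in> Cc_inf \<and> gagliardo H s (\<lambda>x. \<phi> x - u x) < ennreal (1 / real (Suc n))" for n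
  proof -
    obtain \<phi> where \<phi>: "\<phi> \<in> Cc_inf"
      "gagliardo H s (\<lambda>x. u x - \<phi> x) + L_star_norm H s (\<lambda>x. u x - \<phi> x) < ennreal (1 / real (Suc n))"
      using Cc_inf_norm_dense[OF u, of "1 / real (Suc n)"] by auto
    have "gagliardo H s (\<lambda>x. \<phi> x - u x) \<le> gagliardo H s (\<lambda>x. u x - \<phi> x) + L_star_norm H s (\<lambda>x. u x - \<phi> x)"
      unfolding gagliardo_diff_commute[of \<phi> u] by simp
    with \<phi> show ?thesis
      using le_less_trans by blast
  qed
  then obtain X where X: "\<And>n. X n \<in> Cc_inf" "\<And>n. gagliardo H s (\<lambda>x. X n x - u x) < ennreal (1 / real (Suc n))"
    by metis
  have "(\<lambda>n. 1 / real (Suc n)) \<longlonglongrightarrow> 0"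
    by (rule LIMSEQ_Suc[OF lim_const_over_n])
  then have "(\<lambda>n. ennreal (1 / real (Suc n))) \<longlonglongrightarrow> 0"
    using tendsto_ennrealI by fastforce
  then have "(\<lambda>n. gagliardo H s (\<lambda>x. X n x - u x)) \<longlonglongrightarrow> 0"
    by (rule ennreal_tendsto_0_squeeze) (rule less_imp_le[OF X(2)])
  then have "converges_to X u"
    using X(1) u unfolding converges_to_def by blast
  then show thesis
    by (rule that)
qed

lemma converges_to_cauchy:
  assumes "converges_to X u"
  shows "X \<in> D_cauchy H s"
  unfolding D_cauchy_def
proof (intro CollectI conjI allI impI)
  note X = converges_to_W_fun[OF assms]
  show "X n \<in> Cc_inf" for n
    by (rule X(1))
  fix e :: real
  assume e: "e > 0"
  then obtain M where M: "\<And>n. n \<ge> M \<Longrightarrow> gagliardo H s (\<lambda>x. X n x - u x) < ennreal (e / 2)"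
    using X(5) unfolding ennreal_tendsto_0_iff eventually_sequentially by (meson half_gt_zero)
  have "gagliardo H s (\<lambda>x. X m x - X n x) < ennreal e" if "m \<ge> M" "n \<ge> M" for m n
  proof -
    have "gagliardo H s (\<lambda>x. X m x - X n x) \<le> gagliardo H s (\<lambda>x. X m x - u x) + gagliardo H s (\<lambda>x. X n x - u x)"
      using gagliardo_triangle[OF X(2,4,2), of m n] unfolding gagliardo_diff_commute[of u "X n"] .
    also have "\<dots> < ennreal (e / 2) + ennreal (e / 2)"
      using M that by (intro add_strict_mono) auto
    also have "\<dots> = ennreal e"
      using e by (simp flip: ennreal_plus)
    finally show ?thesis .
  qed
  then show "\<exists>M. \<forall>m\<ge>M. \<forall>n\<ge>M. gagliardo H s (\<lambda>x. X m x - X n x) < ennreal e"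
    by blast
qed

lemma D_cauchy_Cc_inf: "X \<in> D_cauchy H s \<Longrightarrow> X n \<in> Cc_inf"
  by (simp add: D_cauchy_def)

lemma D_cauchy_measurable: "X \<in> D_cauchy H s \<Longrightarrow> X n \<in> borel_measurable lebesgue"
  by (rule Cc_inf_measurable[OF D_cauchy_Cc_inf])

text \<open>
  A class of Cauchy sequences is determined by the common limit of its members.
\<close>

lemma D_class_eq:
  assumes X: "converges_to X u"
  shows "D_rel H s `` {X} = {Y. converges_to Y u}"
proof (intro set_eqI iffI)
  note Xm = converges_to_W_fun[OF X]
  fix Y assume "Y \<in> D_rel H s `` {X}"
  then have XY: "Y \<in> D_cauchy H s" "(\<lambda>n. gagliardo H s (\<lambda>x. X n x - Y n x)) \<longlonglongrightarrow> 0"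
    by (auto simp: D_rel_def)
  have "(\<lambda>n. gagliardo H s (\<lambda>x. Y n x - X n x) + gagliardo H s (\<lambda>x. X n x - u x)) \<longlonglongrightarrow> 0"
    using XY(2) Xm(5) by (intro ennreal_add_tendsto_0) (simp_all add: gagliardo_diff_commute[of "Y _"])
  then have "(\<lambda>n. gagliardo H s (\<lambda>x. Y n x - u x)) \<longlonglongrightarrow> 0"
    by (rule ennreal_tendsto_0_squeeze) (intro gagliardo_triangle D_cauchy_measurable[OF XY(1)] Xm)
  then show "Y \<in> {Y. converges_to Y u}"
    using Xm(3) D_cauchy_Cc_inf[OF XY(1)] by (simp add: converges_to_def)
next
  note Xm = converges_to_W_fun[OF X]
  fix Y assume "Y \<in> {Y. converges_to Y u}"
  then have Y: "converges_to Y u"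
    by simp
  note Ym = converges_to_W_fun[OF Y]
  have "(\<lambda>n. gagliardo H s (\<lambda>x. X n x - u x) + gagliardo H s (\<lambda>x. u x - Y n x)) \<longlonglongrightarrow> 0"
    using Ym(5) Xm(5) by (intro ennreal_add_tendsto_0) (simp_all add: gagliardo_diff_commute[of u])
  then have "(\<lambda>n. gagliardo H s (\<lambda>x. X n x - Y n x)) \<longlonglongrightarrow> 0"
    by (rule ennreal_tendsto_0_squeeze) (intro gagliardo_triangle Xm Ym)
  then show "Y \<in> D_rel H s `` {X}"
    using converges_to_cauchy[OF X] converges_to_cauchy[OF Y] by (simp add: D_rel_def)
qed

lemma converges_to_add:
  assumes X: "converges_to X u" and Y: "converges_to Y v"
  shows "converges_to (\<lambda>n x. X n x + Y n x) (\<lambda>x. u x + v x)"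
proof -
  note Xm = converges_to_W_fun[OF X] and Ym = converges_to_W_fun[OF Y]
  have eq: "(\<lambda>x. X n x + Y n x - (u x + v x)) = (\<lambda>x. (X n x - u x) + (Y n x - v x))" for n
    by auto
  have "(\<lambda>n. gagliardo H s (\<lambda>x. X n x + Y n x - (u x + v x))) \<longlonglongrightarrow> 0"
    unfolding eq
    by (rule ennreal_tendsto_0_squeeze[OF ennreal_add_tendsto_0[OF Xm(5) Ym(5)]])
       (intro gagliardo_add borel_measurable_diff Xm Ym)
  then show ?thesis
    unfolding converges_to_def using Cc_inf_add Xm(1) Ym(1) W_fun_add Xm(3) Ym(3) by blast
qed

lemma converges_to_scale:
  assumes X: "converges_to X u"
  shows "converges_to (\<lambda>n x. c * X n x) (\<lambda>x. c * u x)"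
proof -
  note Xm = converges_to_W_fun[OF X]
  have eq: "(\<lambda>x. c * X n x - c * u x) = (\<lambda>x. c * (X n x - u x))" for n
    by (auto simp: algebra_simps)
  have "(\<lambda>n. ennreal \<bar>c\<bar> * gagliardo H s (\<lambda>x. X n x - u x)) \<longlonglongrightarrow> ennreal \<bar>c\<bar> * 0"
    by (intro ennreal_tendsto_cmult Xm) simp
  then have "(\<lambda>n. gagliardo H s (\<lambda>x. c * X n x - c * u x)) \<longlonglongrightarrow> 0"
    unfolding eq gagliardo_scale by simp
  then show ?thesis
    unfolding converges_to_def using Cc_inf_scale Xm(1) W_fun_scale Xm(3) by blast
qed

lemma converges_to_gagliardo:
  assumes X: "converges_to X u"
  shows "(\<lambda>n. gagliardo H s (X n)) \<longlonglongrightarrow> gagliardo H s u"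
proof -
  note Xm = converges_to_W_fun[OF X]
  let ?e = "\<lambda>n. gagliardo H s (\<lambda>x. X n x - u x)"
  have fin: "gagliardo H s u \<noteq> \<infinity>"
    using W_fun_gagliardo_finite[OF Xm(3)] by auto
  have "(\<lambda>n. gagliardo H s u + ?e n) \<longlonglongrightarrow> gagliardo H s u + 0"
    by (intro tendsto_add tendsto_const Xm(5))
  then have up: "(\<lambda>n. gagliardo H s u + ?e n) \<longlonglongrightarrow> gagliardo H s u"
    by simp
  have "(\<lambda>n. gagliardo H s u - ?e n) \<longlonglongrightarrow> gagliardo H s u - 0"
    using fin by (intro tendsto_diff_ennreal_general tendsto_const Xm(5)) auto
  then have low: "(\<lambda>n. gagliardo H s u - ?e n) \<longlonglongrightarrow> gagliardo H s u"
    by simp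
  have upper: "gagliardo H s (X n) \<le> gagliardo H s u + ?e n" for n
    using gagliardo_add[of u "\<lambda>x. X n x - u x"] Xm(2)[of n] Xm(4) by simp
  have lower: "gagliardo H s u - ?e n \<le> gagliardo H s (X n)" for n
  proof -
    have "gagliardo H s (\<lambda>x. X n x + (u x - X n x)) \<le> gagliardo H s (X n) + gagliardo H s (\<lambda>x. u x - X n x)"
      using Xm by (intro gagliardo_add) auto
    then have "gagliardo H s u \<le> ?e n + gagliardo H s (X n)"
      unfolding gagliardo_diff_commute[of u] by (simp add: add.commute)
    then show ?thesis
      using fin by (simp add: ennreal_minus_le_iff)
  qed
  show ?thesis
    by (rule tendsto_sandwich[OF always_eventually always_eventually low up]) (simp_all add: lower upper)
qed

text \<open>
  The isomorphism: a class of functions is sent to the set of all sequences of test functions that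
  converge to it.
\<close>

definition iso :: "('a \<Rightarrow> real) set \<Rightarrow> (nat \<Rightarrow> 'a \<Rightarrow> real) set" where
  "iso A = {X. \<exists>u\<in>A. converges_to X u}"

lemma iso_class:
  assumes "u \<in> W_fun H s"
  shows "iso (W_class u) = {X. converges_to X u}"
proof -
  have "converges_to X u" if "u' \<in> W_class u" "converges_to X u'" for X u'
  proof -
    have "AE x in lebesgue. X n x - u' x = X n x - u x" for n
      using that(1) unfolding mem_W_class by (auto elim: eventually_mono)
    then have "gagliardo H s (\<lambda>x. X n x - u' x) = gagliardo H s (\<lambda>x. X n x - u x)" for n
      by (rule gagliardo_cong_AE)
    then show ?thesis
      using that(2) assms by (simp add: converges_to_def)
  qed
  then show ?thesis
    unfolding iso_def using W_class_self[OF assms] by blast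
qed

lemma iso_class_eq: "converges_to X u \<Longrightarrow> iso (W_class u) = D_rel H s `` {X}"
  using iso_class[OF converges_to_W_fun(3)] D_class_eq by simp

lemma iso_add:
  assumes "A \<in> W_space H s" "B \<in> W_space H s"
  shows "iso (W_add H s A B) = D_add H s (iso A) (iso B)"
proof -
  obtain u where u: "u \<in> W_fun H s" "A = W_class u"
    using W_spaceE[OF assms(1)] by blast
  obtain v where v: "v \<in> W_fun H s" "B = W_class v"
    using W_spaceE[OF assms(2)] by blast
  have *: "D_rel H s `` {\<lambda>n x. X n x + Y n x} = iso (W_add H s A B)"
    if "X \<in> iso A" "Y \<in> iso B" for X Y
  proof -
    have "converges_to X u" "converges_to Y v"
      using that iso_class u v by auto
    from iso_class_eq[OF converges_to_add[OF this]] show ?thesis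
      unfolding u(2) v(2) W_add_class[OF u(1) v(1)] by simp
  qed
  obtain X where "converges_to X u"
    using converges_to_exists[OF u(1)] by blast
  then have X: "X \<in> iso A"
    using iso_class u by auto
  obtain Y where "converges_to Y v"
    using converges_to_exists[OF v(1)] by blast
  then have Y: "Y \<in> iso B"
    using iso_class v by auto
  show ?thesis
    unfolding D_add_def using * X Y by blast
qed

lemma iso_scale:
  assumes "A \<in> W_space H s"
  shows "iso (W_scale H s k A) = D_scale H s k (iso A)"
proof -
  obtain u where u: "u \<in> W_fun H s" "A = W_class u"
    using W_spaceE[OF assms(1)] by blast
  have *: "D_rel H s `` {\<lambda>n x. k * X n x} = iso (W_scale H s k A)" if "X \<in> iso A" for X
  proof -
    have "converges_to X u"
      using that iso_class u by auto
    from iso_class_eq[OF converges_to_scale[OF this]] show ?thesis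
      unfolding u(2) W_scale_class[OF u(1)] by simp
  qed
  obtain X where "converges_to X u"
    using converges_to_exists[OF u(1)] by blast
  then have "X \<in> iso A"
    using iso_class u by auto
  then show ?thesis
    unfolding D_scale_def using * by blast
qed

lemma iso_norm:
  assumes "A \<in> W_space H s"
  shows "D_norm H s (iso A) = W_gagliardo H s A"
proof -
  obtain u where u: "u \<in> W_fun H s" "A = W_class u"
    using W_spaceE[OF assms(1)] by blast
  obtain X where X: "converges_to X u"
    using converges_to_exists[OF u(1)] by blast
  have "lim (\<lambda>n. gagliardo H s (Y n)) = gagliardo H s u" if "Y \<in> {Y. converges_to Y u}" for Y
    by (rule limI[OF converges_to_gagliardo]) (use that in simp)
  with X show ?thesis
    unfolding u(2) W_gagliardo_class[OF u(1)] D_norm_def iso_class[OF u(1)]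
    by (intro the_elem_image_constant[of X]) simp_all
qed

section \<open>Consequences of the Sobolev inequality\<close>

lemma H_star_unbounded:
  obtains t where "t > 0" "H_star H s 0 t \<ge> B"
proof -
  define r where "r = max 1 (B / H 0 0 1)"
  have H1: "H 0 0 1 > 0"
    by (rule H_pos) simp
  have r: "r \<ge> 1"
    by (simp add: r_def)
  have "B \<le> r * H 0 0 1"
    using H1 by (auto simp: r_def max_def field_simps)
  also have "\<dots> \<le> r powr h1 * H 0 0 1"
    using r ii_const H1 powr_mono[of 1 h1 r] by (intro mult_right_mono) auto
  also have "\<dots> \<le> H 0 0 (r * 1)"
    using r by (intro H_scale_lower) auto
  also have "\<dots> = H_star H s 0 (G r)"
    using r G_inv_G[of r] by (simp add: H_star_eq G_fun_eq)
  finally have "B \<le> H_star H s 0 (G r)" .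
  moreover have "G r > 0"
    using r G_strict_mono[of 0 r] by (simp add: G_zero)
  ultimately show thesis
    using that by blast
qed

lemma superlevel_set_lebesgue:
  fixes w :: "'a \<Rightarrow> real"
  assumes "w \<in> borel_measurable lebesgue"
  shows "{x. a < \<bar>w x\<bar>} \<in> sets lebesgue"
  using borel_measurable_abs[OF assms] unfolding borel_measurable_iff_greater by simp

text \<open>
  Chebyshev's inequality, made effective by the unboundedness of \<open>H_star\<close>: on the superlevel set the
  integrand is at least \<open>H_star H s 0 t\<close>.
\<close>

lemma star_lux_imp_measure_small:
  assumes a: "a > 0" and \<eta>: "\<eta> > 0"
  obtains \<tau> where "\<tau> > 0"
    "\<And>w. w \<in> borel_measurable lebesgue \<Longrightarrow> star.lux w < ennreal \<tau> \<Longrightarrow> emeasure lebesgue {x. a < \<bar>w x\<bar>} \<le> ennreal \<eta>"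
proof -
  obtain t where t: "t > 0" "H_star H s 0 t \<ge> 1 / \<eta>"
    using H_star_unbounded by blast
  have "emeasure lebesgue {x. a < \<bar>w x\<bar>} \<le> ennreal \<eta>"
    if w [measurable]: "w \<in> borel_measurable lebesgue" and lux: "star.lux w < ennreal (a / t)" for w
  proof -
    have rho: "star.rho (\<lambda>x. w x / (a / t)) \<le> 1"
      by (rule star.lux_less_imp_rho(2)[OF lux])
    note set = superlevel_set_lebesgue[OF w]
    have "ennreal (1 / \<eta>) * emeasure lebesgue {x. a < \<bar>w x\<bar>}
        = (\<integral>\<^sup>+x. ennreal (1 / \<eta>) * indicator {x. a < \<bar>w x\<bar>} x \<partial>lebesgue)"
      by (rule nn_integral_cmult_indicator[OF set, symmetric])
    also have "\<dots> \<le> star.rho (\<lambda>x. w x / (a / t))"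
      unfolding star.rho_def
    proof (rule nn_integral_mono)
      fix x
      show "ennreal (1 / \<eta>) * indicator {x. a < \<bar>w x\<bar>} x \<le> ennreal (H_star H s x (w x / (a / t)))"
      proof (cases "a < \<bar>w x\<bar>")
        case True
        have "t \<le> \<bar>w x / (a / t)\<bar>"
          using True a t(1) by (simp add: field_simps abs_mult)
        then have "H_star H s x t \<le> H_star H s x (w x / (a / t))"
          using t(1) by (intro star.Phi_mono_abs) simp
        then have "1 / \<eta> \<le> H_star H s x (w x / (a / t))"
          using t(2) by (simp add: H_star_eq)
        then show ?thesis
          using True by (simp add: ennreal_leI)
      qed simp
    qed
    also have "\<dots> \<le> 1"
      by (rule rho)
    finally have "ennreal \<eta> * (ennreal (1 / \<eta>) * emeasure lebesgue {x. a < \<bar>w x\<bar>}) \<le> ennreal \<eta> * 1"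
      by (rule mult_left_mono) simp
    moreover have "ennreal \<eta> * ennreal (1 / \<eta>) = 1"
      using \<eta> by (simp flip: ennreal_mult)
    ultimately show ?thesis
      by (simp add: mult.assoc[symmetric])
  qed
  then show thesis
    using that[of "a / t"] a t(1) by auto
qed

context
  fixes c :: real
  assumes sobolev: "\<And>u. u \<in> W_fun H s \<Longrightarrow> star.lux u \<le> ennreal c * gagliardo H s u"
begin

lemma gagliardo_zero_imp_AE:
  assumes u: "u \<in> W_fun H s" and zero: "gagliardo H s u = 0"
  shows "AE x in lebesgue. u x = 0"
proof -
  note m [measurable] = W_fun_measurable[OF u]
  have lux: "star.lux u = 0"
    using sobolev[OF u] zero by simp
  have "AE x in lebesgue. \<not> (1 / real (Suc n) < \<bar>u x\<bar>)" for n
  proof -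
    have "emeasure lebesgue {x. 1 / real (Suc n) < \<bar>u x\<bar>} \<le> 0 + ennreal \<eta>" if "\<eta> > 0" for \<eta>
      using star_lux_imp_measure_small[of "1 / real (Suc n)" \<eta>] m lux that
      by (metis add_0 ennreal_less_zero_iff of_nat_0_less_iff zero_less_Suc zero_less_divide_1_iff)
    then have "emeasure lebesgue {x. 1 / real (Suc n) < \<bar>u x\<bar>} \<le> 0"
      by (rule ennreal_leI_epsilon)
    then have "{x. 1 / real (Suc n) < \<bar>u x\<bar>} \<in> null_sets lebesgue"
      using superlevel_set_lebesgue[OF m] by (intro null_setsI) auto
    then show ?thesis
      by (rule AE_I') auto
  qed
  then have "AE x in lebesgue. \<forall>n. \<not> (1 / real (Suc n) < \<bar>u x\<bar>)"
    by (simp add: AE_all_countable)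
  then show ?thesis
  proof eventually_elim
    case (elim x)
    show "u x = 0"
    proof (rule ccontr)
      assume "u x \<noteq> 0"
      then obtain n where "1 / real (Suc n) < \<bar>u x\<bar>"
        using nat_approx_posE[of "\<bar>u x\<bar>"] by auto
      with elim show False
        by blast
    qed
  qed
qed

text \<open>
  By the Sobolev inequality a Cauchy sequence of test functions is Cauchy in measure, so a
  subsequence converges almost everywhere; lower semicontinuity identifies its limit as the limit in
  the seminorm.
\<close>

lemma D_cauchy_AE_subsequence:
  assumes X: "X \<in> D_cauchy H s"
  obtains \<sigma> :: "nat \<Rightarrow> nat" where "\<And>k. k \<le> \<sigma> k" "AE x in lebesgue. convergent (\<lambda>k. X (\<sigma> k) x)"
proof -
  note Xm [measurable] = D_cauchy_measurable[OF X]
  have "\<exists>M. \<forall>m\<ge>M. \<forall>n\<ge>M. emeasure lebesgue {x. (1 / 2) ^ k < \<bar>X m x - X n x\<bar>} \<le> ennreal ((1 / 2) ^ k)" for k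
  proof -
    obtain \<tau> where \<tau>: "\<tau> > 0"
      "\<And>w. w \<in> borel_measurable lebesgue \<Longrightarrow> star.lux w < ennreal \<tau> \<Longrightarrow> emeasure lebesgue {x. (1 / 2) ^ k < \<bar>w x\<bar>} \<le> ennreal ((1 / 2) ^ k)"
      using star_lux_imp_measure_small[of "(1 / 2) ^ k" "(1 / 2) ^ k"] by auto
    define e where "e = (\<tau> / 2) / (\<bar>c\<bar> + 1)"
    have c1: "\<bar>c\<bar> + 1 > 0"
      by simp
    have e: "e > 0" "(\<bar>c\<bar> + 1) * e = \<tau> / 2"
      using \<tau>(1) c1 unfolding e_def by (simp, metis nonzero_mult_div_cancel_left order_less_irrefl times_divide_eq_right)
    obtain M where M: "\<And>m n. m \<ge> M \<Longrightarrow> n \<ge> M \<Longrightarrow> gagliardo H s (\<lambda>x. X m x - X n x) < ennreal e"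
      using X e(1) unfolding D_cauchy_def by blast
    have "emeasure lebesgue {x. (1 / 2) ^ k < \<bar>X m x - X n x\<bar>} \<le> ennreal ((1 / 2) ^ k)" if "m \<ge> M" "n \<ge> M" for m n
    proof (rule \<tau>(2))
      have "star.lux (\<lambda>x. X m x - X n x) \<le> ennreal c * gagliardo H s (\<lambda>x. X m x - X n x)"
        by (intro sobolev W_fun_diff Cc_inf_W_fun D_cauchy_Cc_inf X)
      also have "\<dots> \<le> ennreal (\<bar>c\<bar> + 1) * ennreal e"
        using M[OF that] by (intro mult_mono ennreal_leI) auto
      also have "\<dots> = ennreal ((\<bar>c\<bar> + 1) * e)"
        using e(1) by (simp add: ennreal_mult)
      also have "\<dots> < ennreal \<tau>"
        using \<tau>(1) unfolding e(2) by (simp add: ennreal_less_iff)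
      finally show "star.lux (\<lambda>x. X m x - X n x) < ennreal \<tau>" .
    qed measurable
    then show ?thesis
      by blast
  qed
  then obtain M where M: "\<And>k m n. m \<ge> M k \<Longrightarrow> n \<ge> M k \<Longrightarrow>
      emeasure lebesgue {x. (1 / 2) ^ k < \<bar>X m x - X n x\<bar>} \<le> ennreal ((1 / 2) ^ k)"
    by metis
  \<comment> \<open>Summing all \<open>M i\<close> with \<open>i \<le> k\<close> puts both \<open>\<sigma> k\<close> and \<open>\<sigma> (Suc k)\<close> beyond \<open>M k\<close>.\<close>
  define \<sigma> where "\<sigma> k = k + (\<Sum>i\<le>k. M i)" for k
  have "M k \<le> (\<Sum>i\<le>k. M i)" for k
    by (rule member_le_sum) auto
  then have \<sigma>: "k \<le> \<sigma> k" "M k \<le> \<sigma> k" "M k \<le> \<sigma> (Suc k)" for k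
    using trans_le_add2 by (auto simp: \<sigma>_def intro: le_SucI trans_le_add1 trans_le_add2)
  define A where "A k = {x. (1 / 2) ^ k < \<bar>X (\<sigma> (Suc k)) x - X (\<sigma> k) x\<bar>}" for k
  have A_sets: "A k \<in> sets lebesgue" for k
    unfolding A_def by (intro superlevel_set_lebesgue borel_measurable_diff Xm)
  have A_small: "emeasure lebesgue (A k) \<le> ennreal ((1 / 2) ^ k)" for k
    unfolding A_def by (rule M[OF \<sigma>(3,2)])
  have "AE x in lebesgue. eventually (\<lambda>k. x \<in> space lebesgue - A k) sequentially"
  proof (rule borel_cantelli_AE1[OF A_sets])
    show "emeasure lebesgue (A k) < \<infinity>" for k
      using A_small[of k] le_less_trans by fastforce
    show "summable (\<lambda>k. measure lebesgue (A k))"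
    proof (rule summable_comparison_test')
      show "summable (\<lambda>k. (1 / 2 :: real) ^ k)"
        by (simp add: summable_geometric)
      show "norm (measure lebesgue (A k)) \<le> (1 / 2) ^ k" for k
        using A_small[of k] by (simp add: measure_def enn2real_leI)
    qed
  qed
  then have "AE x in lebesgue. convergent (\<lambda>k. X (\<sigma> k) x)"
  proof eventually_elim
    case (elim x)
    then obtain k0 where k0: "\<And>k. k \<ge> k0 \<Longrightarrow> x \<notin> A k"
      by (auto simp: eventually_sequentially)
    have "summable (\<lambda>k. X (\<sigma> (Suc k)) x - X (\<sigma> k) x)"
    proof (rule summable_comparison_test'[of "\<lambda>k. (1 / 2 :: real) ^ k" k0])
      show "norm (X (\<sigma> (Suc k)) x - X (\<sigma> k) x) \<le> (1 / 2) ^ k" if "k \<ge> k0" for k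
        using k0[OF that] by (simp add: A_def not_less)
    qed (simp add: summable_geometric)
    then have "convergent (\<lambda>n. \<Sum>k<n. X (\<sigma> (Suc k)) x - X (\<sigma> k) x)"
      by (simp add: summable_iff_convergent)
    then have "convergent (\<lambda>n. X (\<sigma> n) x - X (\<sigma> 0) x)"
      by (simp only: sum_lessThan_telescope[of "\<lambda>k. X (\<sigma> k) x"])
    from convergent_add[OF this convergent_const[of "X (\<sigma> 0) x"]] show ?case
      by simp
  qed
  then show thesis
    using \<sigma>(1) by (rule that[rotated])
qed

lemma D_cauchy_converges:
  assumes X: "X \<in> D_cauchy H s"
  obtains u where "converges_to X u"
proof -
  note Xm [measurable] = D_cauchy_measurable[OF X]
  obtain \<sigma> :: "nat \<Rightarrow> nat" where \<sigma>: "\<And>k. k \<le> \<sigma> k" "AE x in lebesgue. convergent (\<lambda>k. X (\<sigma> k) x)"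
    using D_cauchy_AE_subsequence[OF X] by blast
  define u where "u x = lim (\<lambda>k. X (\<sigma> k) x)" for x
  have u_meas [measurable]: "u \<in> borel_measurable lebesgue"
    unfolding u_def by (rule borel_measurable_lim_metric) measurable
  have lim: "AE x in lebesgue. (\<lambda>k. X n x - X (\<sigma> k) x) \<longlonglongrightarrow> X n x - u x" for n
    using \<sigma>(2) by eventually_elim (auto simp: u_def convergent_LIMSEQ_iff intro!: tendsto_diff)
  have tail: "gagliardo H s (\<lambda>x. X n x - u x) \<le> b" "star.lux (\<lambda>x. X n x - u x) \<le> ennreal c * b"
    if b: "\<And>m. m \<ge> N \<Longrightarrow> gagliardo H s (\<lambda>x. X n x - X m x) \<le> b" for n N b
  proof -
    have ev: "\<forall>\<^sub>F k in sequentially. gagliardo H s (\<lambda>x. X n x - X (\<sigma> k) x) \<le> b"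
      using eventually_ge_at_top[of N] by eventually_elim (use \<sigma>(1) b order_trans in blast)
    show "gagliardo H s (\<lambda>x. X n x - u x) \<le> b"
      unfolding gagliardo_eq_lux
      by (rule gag.lux_Fatou[OF _ difference_tendsto_AE[OF lim]])
         (use ev in \<open>simp_all add: gagliardo_eq_lux difference_measurable\<close>)
    show "star.lux (\<lambda>x. X n x - u x) \<le> ennreal c * b"
    proof (rule star.lux_Fatou[OF _ lim])
      show "\<forall>\<^sub>F k in sequentially. star.lux (\<lambda>x. X n x - X (\<sigma> k) x) \<le> ennreal c * b"
        using ev
      proof eventually_elim
        case (elim k)
        have "star.lux (\<lambda>x. X n x - X (\<sigma> k) x) \<le> ennreal c * gagliardo H s (\<lambda>x. X n x - X (\<sigma> k) x)"
          by (intro sobolev W_fun_diff Cc_inf_W_fun D_cauchy_Cc_inf X)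
        also have "\<dots> \<le> ennreal c * b"
          using elim by (rule mult_left_mono) simp
        finally show ?case .
      qed
    qed measurable
  qed
  have cauchy: "\<exists>N. \<forall>m\<ge>N. \<forall>n\<ge>N. gagliardo H s (\<lambda>x. X m x - X n x) < ennreal e" if "e > 0" for e
    using X that unfolding D_cauchy_def by blast
  obtain N where N: "\<And>m n. m \<ge> N \<Longrightarrow> n \<ge> N \<Longrightarrow> gagliardo H s (\<lambda>x. X m x - X n x) < ennreal 1"
    using cauchy[of 1] by auto
  have fin: "gagliardo H s (\<lambda>x. X N x - u x) \<le> ennreal 1" "star.lux (\<lambda>x. X N x - u x) \<le> ennreal c * ennreal 1"
    using tail[of N N "ennreal 1"] N less_imp_le by blast+
  have "star.lux (\<lambda>x. X N x - u x) < \<infinity>" "gag.lux (difference (\<lambda>x. X N x - u x)) < \<infinity>"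
    using fin by (auto simp: gagliardo_eq_lux intro: le_less_trans)
  then have "energy (\<lambda>x. X N x - u x) < \<infinity>"
    using star.lux_finite_iff[of "\<lambda>x. X N x - u x"] gag.lux_finite_iff[OF difference_measurable, of "\<lambda>x. X N x - u x"]
    unfolding energy_finite_iff by simp
  then have "(\<lambda>x. X N x - u x) \<in> W_fun H s"
    by (simp add: W_fun_iff)
  from W_fun_diff[OF Cc_inf_W_fun[OF D_cauchy_Cc_inf[OF X, of N]] this]
  have u: "u \<in> W_fun H s"
    by simp
  have "(\<lambda>n. gagliardo H s (\<lambda>x. X n x - u x)) \<longlonglongrightarrow> 0"
    unfolding ennreal_tendsto_0_iff
  proof (intro allI impI)
    fix e :: real assume e: "e > 0"
    obtain N where N: "\<And>m n. m \<ge> N \<Longrightarrow> n \<ge> N \<Longrightarrow> gagliardo H s (\<lambda>x. X m x - X n x) < ennreal (e / 2)"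
      using cauchy[of "e / 2"] e by auto
    show "\<forall>\<^sub>F n in sequentially. gagliardo H s (\<lambda>x. X n x - u x) < ennreal e"
      using eventually_ge_at_top[of N]
    proof eventually_elim
      case (elim n)
      have "gagliardo H s (\<lambda>x. X n x - u x) \<le> ennreal (e / 2)"
        using N elim by (intro tail(1)[of N]) (auto intro: less_imp_le)
      also have "\<dots> < ennreal e"
        using e by (simp add: ennreal_less_iff)
      finally show ?case .
    qed
  qed
  then have "converges_to X u"
    unfolding converges_to_def using u D_cauchy_Cc_inf[OF X] by blast
  then show thesis
    by (rule that)
qed

text \<open>
  Two limits of one sequence have Gagliardo distance \<open>0\<close>, so they agree almost everywhere; every Cauchy
  sequence has a limit.
\<close>

lemma iso_bij: "bij_betw iso (W_space H s) (D_space H s)"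
  unfolding bij_betw_def
proof
  show "inj_on iso (W_space H s)"
  proof (rule inj_onI)
    fix A B assume AB: "A \<in> W_space H s" "B \<in> W_space H s" "iso A = iso B"
    obtain u where u: "u \<in> W_fun H s" "A = W_class u"
      using W_spaceE[OF AB(1)] by blast
    obtain v where v: "v \<in> W_fun H s" "B = W_class v"
      using W_spaceE[OF AB(2)] by blast
    obtain X where X: "converges_to X u"
      using converges_to_exists[OF u(1)] by blast
    then have Y: "converges_to X v"
      using AB(3) iso_class[OF u(1)] iso_class[OF v(1)] u(2) v(2) by blast
    note Xm = converges_to_W_fun[OF X] and Ym = converges_to_W_fun[OF Y]
    have "(\<lambda>n. gagliardo H s (\<lambda>x. u x - X n x) + gagliardo H s (\<lambda>x. X n x - v x)) \<longlonglongrightarrow> 0"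
      using Xm(5) Ym(5) by (intro ennreal_add_tendsto_0) (simp_all add: gagliardo_diff_commute[of u])
    then have "(\<lambda>n::nat. gagliardo H s (\<lambda>x. u x - v x)) \<longlonglongrightarrow> 0"
      by (rule ennreal_tendsto_0_squeeze) (intro gagliardo_triangle Xm Ym)
    then have "gagliardo H s (\<lambda>x. u x - v x) = 0"
      by (simp add: LIMSEQ_const_iff)
    then have "AE x in lebesgue. u x - v x = 0"
      by (rule gagliardo_zero_imp_AE[OF W_fun_diff[OF u(1) v(1)]])
    then have "AE x in lebesgue. u x = v x"
      by eventually_elim simp
    then show "A = B"
      unfolding u(2) v(2) by (rule W_class_eqI[OF u(1) v(1)])
  qed
  show "iso ` W_space H s = D_space H s"
  proof (intro equalityI subsetI)
    fix D assume "D \<in> iso ` W_space H s"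
    then obtain u where u: "u \<in> W_fun H s" "D = iso (W_class u)"
      using W_spaceE by blast
    obtain X where X: "converges_to X u"
      using converges_to_exists[OF u(1)] by blast
    show "D \<in> D_space H s"
      unfolding u(2) iso_class_eq[OF X] D_space_def by (rule quotientI[OF converges_to_cauchy[OF X]])
  next
    fix D assume "D \<in> D_space H s"
    then obtain X where X: "X \<in> D_cauchy H s" "D = D_rel H s `` {X}"
      unfolding D_space_def by (elim quotientE)
    obtain u where u: "converges_to X u"
      using D_cauchy_converges[OF X(1)] by blast
    then have "D = iso (W_class u)"
      using X(2) iso_class_eq by simp
    then show "D \<in> iso ` W_space H s"
      using W_class_in_space[OF converges_to_W_fun(3)[OF u]] by blast
  qed
qed

end

end

theorem theorem2p14:
  fixes h H :: "'a::euclidean_space \<Rightarrow> 'a \<Rightarrow> real \<Rightarrow> real"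
    and s h1 h2 :: real
  assumes s: "0 < s" "s < 1"
    and h_nonneg: "\<And>x y t. 0 \<le> t \<Longrightarrow> 0 \<le> h x y t"
    and H_def: "\<And>x y t. H x y t = integral {0..\<bar>t\<bar>} (\<lambda>r. h x y r * r)"
    and N_fun: "generalized_N_function H"
    and loc_int: "locally_integrable_N H"
    and i_C1: "\<And>x y. h x y C1_differentiable_on {0<..}"
    and i_deriv: "\<And>x y t. 0 < t \<Longrightarrow> 0 < deriv (\<lambda>r. r * h x y r) t"
    and ii_const: "1 < h1" "h1 < h2" "h2 < real DIM('a)"
      "h2 < real DIM('a) * h1 / (real DIM('a) - s * h1)"
    and ii_lower: "\<And>x y t. t \<noteq> 0 \<Longrightarrow> h1 \<le> h x y \<bar>t\<bar> * \<bar>t\<bar>\<^sup>2 / H x y \<bar>t\<bar>"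
    and ii_upper: "\<And>x y t. t \<noteq> 0 \<Longrightarrow> h x y \<bar>t\<bar> * \<bar>t\<bar>\<^sup>2 / H x y \<bar>t\<bar> \<le> h2"
    and iii_inf: "0 < Inf (range (\<lambda>(x, y). H x y 1))"
    and iii_sup: "bdd_above (range (\<lambda>(x, y). H x y 1))"
    and iv: "\<And>x. \<exists>a>0. \<exists>b>0.
      (\<integral>\<^sup>+t\<in>{a..}. ennreal ((t / H x x t) powr (s / (real DIM('a) - s))) \<partial>lborel) = \<infinity> \<and>
      (\<integral>\<^sup>+t\<in>{0..b}. ennreal ((t / H x x t) powr (s / (real DIM('a) - s))) \<partial>lborel) < \<infinity>"
    and v: "\<And>x y z t. 0 \<le> t \<Longrightarrow> H (x - z) (y - z) t = H x y t"
  shows "W_subspace H s (Cc_classes H s) \<and> W_dense H s (Cc_classes H s) \<and>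
    (sobolev_inequality H s \<longrightarrow>
      (\<exists>T. bij_betw T (W_space H s) (D_space H s) \<and>
        (\<forall>A\<in>W_space H s. \<forall>B\<in>W_space H s. T (W_add H s A B) = D_add H s (T A) (T B)) \<and>
        (\<forall>c. \<forall>A\<in>W_space H s. T (W_scale H s c A) = D_scale H s c (T A)) \<and>
        (\<forall>A\<in>W_space H s. D_norm H s (T A) = W_gagliardo H s A)))"
proof -
  interpret fractional_orlicz h H s h1 h2
  proof
    show "\<exists>b>0. (\<integral>\<^sup>+t\<in>{0..b}. ennreal ((t / H x x t) powr (s / (real DIM('a) - s))) \<partial>lborel) < \<infinity>" for x
      using iv[of x] by blast
  qed (fact s H_def N_fun loc_int i_C1 ii_const ii_lower ii_upper iii_sup v)+
  have "\<exists>T. bij_betw T (W_space H s) (D_space H s) \<and>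
        (\<forall>A\<in>W_space H s. \<forall>B\<in>W_space H s. T (W_add H s A B) = D_add H s (T A) (T B)) \<and>
        (\<forall>c. \<forall>A\<in>W_space H s. T (W_scale H s c A) = D_scale H s c (T A)) \<and>
        (\<forall>A\<in>W_space H s. D_norm H s (T A) = W_gagliardo H s A)"
    if sobolev: "sobolev_inequality H s"
  proof -
    obtain c :: real where c: "\<And>u. u \<in> W_fun H s \<Longrightarrow> star.lux u \<le> ennreal c * gagliardo H s u"
      using sobolev unfolding sobolev_inequality_def L_star_norm_eq_lux by blast
    show ?thesis
      using iso_bij[OF c] iso_add iso_scale iso_norm by blast
  qed
  with Cc_classes_subspace Cc_classes_dense show ?thesis
    by blast
qed

end
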